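(* Let $q\in\mathbb{C}^*$ be a nonzero complex number that is not a root of unity, and let $m,n$ be positive integers. Then $\mathcal{O}_q(M_{m,n})$ is a primitive ring (i.e. $\langle 0\rangle$ is a primitive ideal) if and only if $v_2(m)\neq v_2(n)$.
   Context: $\mathcal{O}_q(M_{m,n})$ (quantum matrices) is the $\mathbb{C}$-algebra generated by $Y_{i,\alpha}$, $1\le i\le m$, $1\le\alpha\le n$, subject to the relations: $Y_{i,\beta}Y_{i,\alpha}=q^{-1}Y_{i,\alpha}Y_{i,\beta}$ for $\alpha<\beta$; $Y_{j,\alpha}Y_{i,\alpha}=q^{-1}Y_{i,\alpha}Y_{j,\alpha}$ for $i<j$; $Y_{j,\beta}Y_{i,\alpha}=Y_{i,\alpha}Y_{j,\beta}$ for $i<j$, $\alpha>\beta$; $Y_{j,\beta}Y_{i,\alpha}=Y_{i,\alpha}Y_{j,\beta}-(q-q^{-1})Y_{i,\beta}Y_{j,\alpha}$ for $i<j$, $\alpha<\beta$. For a positive integer $k$, $v_2(k)$ denotes its $2$-adic valuation, the largest integer $e\ge 0$ with $2^e\mid k$. Primitive means left primitive. *)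

theory Defs
  imports
    Complex_Main
    "HOL-Computational_Algebra.Primes"
    "HOL-Algebra.QuotRing"
    "HOL-Algebra.Module"
begin

section \<open>Simple left modules and left primitive ideals\<close>

text \<open>
  The library's locale \<open>module\<close> requires a commutative base ring, so unital left
  modules over an arbitrary ring are introduced here. The library's record type \<open>module\<close> and its
  locale \<open>submodule\<close> (an additive subgroup closed under the action) do not depend on
  commutativity and are reused. The multiplicative fields of the record \<open>M\<close> play no role.
\<close>

locale left_module = R?: ring R + M?: abelian_group M
  for R :: "('a, 'c) ring_scheme" (structure) and M :: "('a, 'b, 'd) module_scheme" (structure) +
  assumes smult_closed [simp, intro]:
      "\<lbrakk>a \<in> carrier R; x \<in> carrier M\<rbrakk> \<Longrightarrow> a \<odot>\<^bsub>M\<^esub> x \<in> carrier M"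
    and smult_l_distr:
      "\<lbrakk>a \<in> carrier R; b \<in> carrier R; x \<in> carrier M\<rbrakk> \<Longrightarrow>
        (a \<oplus>\<^bsub>R\<^esub> b) \<odot>\<^bsub>M\<^esub> x = a \<odot>\<^bsub>M\<^esub> x \<oplus>\<^bsub>M\<^esub> b \<odot>\<^bsub>M\<^esub> x"
    and smult_r_distr:
      "\<lbrakk>a \<in> carrier R; x \<in> carrier M; y \<in> carrier M\<rbrakk> \<Longrightarrow>
        a \<odot>\<^bsub>M\<^esub> (x \<oplus>\<^bsub>M\<^esub> y) = a \<odot>\<^bsub>M\<^esub> x \<oplus>\<^bsub>M\<^esub> a \<odot>\<^bsub>M\<^esub> y"
    and smult_assoc:
      "\<lbrakk>a \<in> carrier R; b \<in> carrier R; x \<in> carrier M\<rbrakk> \<Longrightarrow>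
        (a \<otimes>\<^bsub>R\<^esub> b) \<odot>\<^bsub>M\<^esub> x = a \<odot>\<^bsub>M\<^esub> (b \<odot>\<^bsub>M\<^esub> x)"
    and smult_one [simp]:
      "x \<in> carrier M \<Longrightarrow> \<one>\<^bsub>R\<^esub> \<odot>\<^bsub>M\<^esub> x = x"

definition simple_left_module ::
    "('a, 'c) ring_scheme \<Rightarrow> ('a, 'b, 'd) module_scheme \<Rightarrow> bool" where
  "simple_left_module R M \<longleftrightarrow>
     left_module R M \<and> carrier M \<noteq> {\<zero>\<^bsub>M\<^esub>} \<and>
     (\<forall>H. submodule H R M \<longrightarrow> H = {\<zero>\<^bsub>M\<^esub>} \<or> H = carrier M)"

definition annihilator ::
    "('a, 'c) ring_scheme \<Rightarrow> ('a, 'b, 'd) module_scheme \<Rightarrow> 'a set" where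
  "annihilator R M = {r \<in> carrier R. \<forall>x \<in> carrier M. r \<odot>\<^bsub>M\<^esub> x = \<zero>\<^bsub>M\<^esub>}"

text \<open>
  A quantifier over modules has to fix the type of their elements. The type \<^typ>\<open>'a set\<close> loses
  nothing: a simple module is cyclic, hence isomorphic to a module of cosets of a left
  ideal. The lemma \<open>left_primitive_idealI\<close> below makes this precise.
\<close>

definition left_primitive_ideal :: "('a, 'c) ring_scheme \<Rightarrow> 'a set \<Rightarrow> bool" where
  "left_primitive_ideal R P \<longleftrightarrow>
     (\<exists>M :: ('a, 'a set) module. simple_left_module R M \<and> annihilator R M = P)"

definition left_primitive_ring :: "('a, 'c) ring_scheme \<Rightarrow> bool" where
  "left_primitive_ring R \<longleftrightarrow> left_primitive_ideal R {\<zero>\<^bsub>R\<^esub>}"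

context left_module
begin

lemma smult_l_null:
  assumes "x \<in> carrier M" shows "\<zero>\<^bsub>R\<^esub> \<odot>\<^bsub>M\<^esub> x = \<zero>\<^bsub>M\<^esub>"
proof -
  have "\<zero>\<^bsub>R\<^esub> \<odot>\<^bsub>M\<^esub> x \<oplus>\<^bsub>M\<^esub> \<zero>\<^bsub>R\<^esub> \<odot>\<^bsub>M\<^esub> x = \<zero>\<^bsub>R\<^esub> \<odot>\<^bsub>M\<^esub> x"
    using smult_l_distr[of "\<zero>\<^bsub>R\<^esub>" "\<zero>\<^bsub>R\<^esub>" x] assms by simp
  thus ?thesis using assms by (metis M.add.r_cancel_one' R.zero_closed smult_closed)
qed

lemma smult_r_null:
  assumes "a \<in> carrier R" shows "a \<odot>\<^bsub>M\<^esub> \<zero>\<^bsub>M\<^esub> = \<zero>\<^bsub>M\<^esub>"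
proof -
  have "a \<odot>\<^bsub>M\<^esub> \<zero>\<^bsub>M\<^esub> \<oplus>\<^bsub>M\<^esub> a \<odot>\<^bsub>M\<^esub> \<zero>\<^bsub>M\<^esub> = a \<odot>\<^bsub>M\<^esub> \<zero>\<^bsub>M\<^esub>"
    using smult_r_distr[of a "\<zero>\<^bsub>M\<^esub>" "\<zero>\<^bsub>M\<^esub>"] assms by simp
  thus ?thesis using assms by (metis M.add.r_cancel_one' M.zero_closed smult_closed)
qed

lemma smult_l_minus:
  assumes "a \<in> carrier R" "x \<in> carrier M"
  shows "(\<ominus>\<^bsub>R\<^esub> a) \<odot>\<^bsub>M\<^esub> x = \<ominus>\<^bsub>M\<^esub> (a \<odot>\<^bsub>M\<^esub> x)"
proof -
  have "(\<ominus>\<^bsub>R\<^esub> a) \<odot>\<^bsub>M\<^esub> x \<oplus>\<^bsub>M\<^esub> a \<odot>\<^bsub>M\<^esub> x = \<zero>\<^bsub>M\<^esub>"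
    using smult_l_distr[of "\<ominus>\<^bsub>R\<^esub> a" a x] assms by (simp add: R.l_neg smult_l_null)
  thus ?thesis using assms by (metis M.minus_equality R.a_inv_closed smult_closed)
qed

lemma cyclic_submodule:
  assumes "x \<in> carrier M"
  shows "submodule ((\<lambda>a. a \<odot>\<^bsub>M\<^esub> x) ` carrier R) R M"
proof (intro submodule.intro subgroup.intro submodule_axioms.intro)
  show "(\<lambda>a. a \<odot>\<^bsub>M\<^esub> x) ` carrier R \<subseteq> carrier (add_monoid M)" using assms by auto
next
  fix u v assume "u \<in> (\<lambda>a. a \<odot>\<^bsub>M\<^esub> x) ` carrier R" "v \<in> (\<lambda>a. a \<odot>\<^bsub>M\<^esub> x) ` carrier R"
  then obtain a b where "a \<in> carrier R" "b \<in> carrier R" "u = a \<odot>\<^bsub>M\<^esub> x" "v = b \<odot>\<^bsub>M\<^esub> x" by auto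
  thus "u \<otimes>\<^bsub>add_monoid M\<^esub> v \<in> (\<lambda>a. a \<odot>\<^bsub>M\<^esub> x) ` carrier R"
    using assms by (auto simp: smult_l_distr[symmetric])
next
  show "\<one>\<^bsub>add_monoid M\<^esub> \<in> (\<lambda>a. a \<odot>\<^bsub>M\<^esub> x) ` carrier R"
    using smult_l_null[OF assms] by (auto intro!: image_eqI[of _ _ "\<zero>\<^bsub>R\<^esub>"])
next
  fix u assume "u \<in> (\<lambda>a. a \<odot>\<^bsub>M\<^esub> x) ` carrier R"
  then obtain a where a: "a \<in> carrier R" "u = a \<odot>\<^bsub>M\<^esub> x" by auto
  have "inv\<^bsub>add_monoid M\<^esub> u = (\<ominus>\<^bsub>R\<^esub> a) \<odot>\<^bsub>M\<^esub> x"
    using a assms smult_l_minus[OF a(1) assms] by (simp add: a_inv_def[of M])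
  thus "inv\<^bsub>add_monoid M\<^esub> u \<in> (\<lambda>a. a \<odot>\<^bsub>M\<^esub> x) ` carrier R" using a by auto
next
  fix a u assume "a \<in> carrier R" "u \<in> (\<lambda>a. a \<odot>\<^bsub>M\<^esub> x) ` carrier R"
  thus "a \<odot>\<^bsub>M\<^esub> u \<in> (\<lambda>a. a \<odot>\<^bsub>M\<^esub> x) ` carrier R"
    using assms by (auto simp: smult_assoc[symmetric])
qed

end

lemma simple_left_module_transport:
  fixes M :: "('a, 'b, 'd) module_scheme" and f :: "'b \<Rightarrow> 'e"
  assumes simple: "simple_left_module R M" and inj: "inj_on f (carrier M)"
  shows "\<exists>N :: ('a, 'e) module. simple_left_module R N \<and> annihilator R N = annihilator R M"
proof -
  interpret left_module R M using simple by (simp add: simple_left_module_def)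
  define g where "g = inv_into (carrier M) f"
  have gf [simp]: "g (f x) = x" if "x \<in> carrier M" for x
    using that inj by (simp add: g_def)
  define N :: "('a, 'e) module" where
    "N = \<lparr>carrier = f ` carrier M, mult = (\<lambda>x y. x), one = f \<zero>\<^bsub>M\<^esub>, zero = f \<zero>\<^bsub>M\<^esub>,
          add = (\<lambda>x y. f (g x \<oplus>\<^bsub>M\<^esub> g y)), smult = (\<lambda>a x. f (a \<odot>\<^bsub>M\<^esub> g x))\<rparr>"
  have N: "carrier N = f ` carrier M" "\<zero>\<^bsub>N\<^esub> = f \<zero>\<^bsub>M\<^esub>"
    "\<And>x y. x \<oplus>\<^bsub>N\<^esub> y = f (g x \<oplus>\<^bsub>M\<^esub> g y)" "\<And>a x. a \<odot>\<^bsub>N\<^esub> x = f (a \<odot>\<^bsub>M\<^esub> g x)"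
    by (simp_all add: N_def)
  have agN: "abelian_group N"
  proof (rule abelian_groupI)
    fix u assume "u \<in> carrier N"
    then obtain x where "x \<in> carrier M" "u = f x" by (auto simp: N)
    thus "\<exists>y\<in>carrier N. y \<oplus>\<^bsub>N\<^esub> u = \<zero>\<^bsub>N\<^esub>"
      by (auto simp: N M.l_neg intro!: bexI[of _ "\<ominus>\<^bsub>M\<^esub> x"])
  qed (auto simp: N M.a_ac)
  then interpret N: abelian_group N .
  have lmN: "left_module R N"
    by unfold_locales (auto simp: N smult_l_distr smult_r_distr smult_assoc)
  have "H = {\<zero>\<^bsub>N\<^esub>} \<or> H = carrier N" if H: "submodule H R N" for H
  proof -
    interpret H: submodule H R N by (rule H)
    have Hsub: "H \<subseteq> f ` carrier M" using H.subset by (simp add: N)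
    have Hfg: "f (g u) = u" if "u \<in> H" for u using Hsub that by auto
    have gM: "g u \<in> carrier M" if "u \<in> H" for u using Hsub that by auto
    have gI: "x \<in> g ` H" if "f x \<in> H" "x \<in> carrier M" for x
      using that by (metis gf imageI)
    have H0: "f \<zero>\<^bsub>M\<^esub> \<in> H" using H.one_closed by (simp add: N)
    have "submodule (g ` H) R M"
    proof (intro submodule.intro subgroup.intro submodule_axioms.intro)
      show "g ` H \<subseteq> carrier (add_monoid M)" using gM by auto
    next
      fix x y assume "x \<in> g ` H" "y \<in> g ` H"
      then obtain u v where uv: "u \<in> H" "v \<in> H" "x = g u" "y = g v" by auto
      have "f (g u \<oplus>\<^bsub>M\<^esub> g v) \<in> H" using H.m_closed[OF uv(1,2)] by (simp add: N)
      hence "g u \<oplus>\<^bsub>M\<^esub> g v \<in> g ` H" by (rule gI) (use uv gM in blast)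
      thus "x \<otimes>\<^bsub>add_monoid M\<^esub> y \<in> g ` H" using uv by simp
    next
      show "\<one>\<^bsub>add_monoid M\<^esub> \<in> g ` H" using gI[OF H0] by simp
    next
      fix x assume "x \<in> g ` H"
      then obtain u where u: "u \<in> H" "x = g u" by auto
      have "(\<ominus>\<^bsub>R\<^esub> \<one>\<^bsub>R\<^esub>) \<odot>\<^bsub>N\<^esub> u \<in> H" using u(1) by (intro H.smult_closed) auto
      hence "f (\<ominus>\<^bsub>M\<^esub> x) \<in> H" using u gM by (simp add: N smult_l_minus)
      hence "\<ominus>\<^bsub>M\<^esub> x \<in> g ` H" by (rule gI) (use u gM in blast)
      thus "inv\<^bsub>add_monoid M\<^esub> x \<in> g ` H" by (simp add: a_inv_def)
    next
      fix a x assume a: "a \<in> carrier R" and "x \<in> g ` H"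
      then obtain u where u: "u \<in> H" "x = g u" by auto
      have "f (a \<odot>\<^bsub>M\<^esub> x) \<in> H" using H.smult_closed[OF a u(1)] u by (simp add: N)
      thus "a \<odot>\<^bsub>M\<^esub> x \<in> g ` H" by (rule gI) (use a u gM in blast)
    qed
    hence "g ` H = {\<zero>\<^bsub>M\<^esub>} \<or> g ` H = carrier M" using simple by (simp add: simple_left_module_def)
    moreover have "H = f ` g ` H" using Hfg by force
    ultimately show ?thesis by (metis N(1,2) image_empty image_insert)
  qed
  moreover have "carrier N \<noteq> {\<zero>\<^bsub>N\<^esub>}"
  proof
    assume "carrier N = {\<zero>\<^bsub>N\<^esub>}"
    hence "carrier M = {\<zero>\<^bsub>M\<^esub>}"
      using inj M.zero_closed by (auto simp: N inj_on_def)
    thus False using simple by (simp add: simple_left_module_def)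
  qed
  moreover have "annihilator R N = annihilator R M"
    using inj by (auto simp: annihilator_def N inj_on_def)
  ultimately show ?thesis using lmN by (auto simp: simple_left_module_def)
qed

lemma left_primitive_idealI:
  fixes M :: "('a, 'b, 'd) module_scheme"
  assumes simple: "simple_left_module R M" and ann: "annihilator R M = P"
  shows "left_primitive_ideal R P"
proof -
  interpret left_module R M using simple by (simp add: simple_left_module_def)
  obtain x where x: "x \<in> carrier M" "x \<noteq> \<zero>\<^bsub>M\<^esub>"
    using simple M.zero_closed unfolding simple_left_module_def by blast
  have "x \<in> (\<lambda>a. a \<odot>\<^bsub>M\<^esub> x) ` carrier R"
    using x by (auto intro!: image_eqI[of _ _ "\<one>\<^bsub>R\<^esub>"])
  hence gen: "(\<lambda>a. a \<odot>\<^bsub>M\<^esub> x) ` carrier R = carrier M"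
    using cyclic_submodule[OF x(1)] simple x(2) unfolding simple_left_module_def by blast
  have "inj_on (\<lambda>y. {a \<in> carrier R. a \<odot>\<^bsub>M\<^esub> x = y}) (carrier M)"
    unfolding gen[symmetric] inj_on_def by blast
  from simple_left_module_transport[OF simple this] show ?thesis
    using ann by (auto simp: left_primitive_ideal_def)
qed


section \<open>Free associative algebras\<close>

text \<open>
  The free associative algebra on the set \<open>X\<close>: finitely supported functions on words over \<open>X\<close>,
  with convolution over the factorisations of a word (all of them are
  \<open>w = take k w @ drop k w\<close> with \<open>k \<le> length w\<close>) as product. It is a plain ring; the scalars
  are the multiples of the empty word. They are central, so two-sided ideals, quotients and unital
  modules agree with those of the algebra.
\<close>

definition free_algebra :: "'x set \<Rightarrow> ('x list \<Rightarrow> 'k::field) ring" where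
  "free_algebra X =
     \<lparr>carrier = {f. finite {w. f w \<noteq> 0} \<and> {w. f w \<noteq> 0} \<subseteq> lists X},
      mult = (\<lambda>f g w. \<Sum>k\<le>length w. f (take k w) * g (drop k w)),
      one = (\<lambda>w. if w = [] then 1 else 0),
      zero = (\<lambda>w. 0),
      add = (\<lambda>f g w. f w + g w)\<rparr>"

definition free_scalar :: "'k \<Rightarrow> 'x list \<Rightarrow> 'k::field" where
  "free_scalar c = (\<lambda>w. if w = [] then c else 0)"

definition free_gen :: "'x \<Rightarrow> 'x list \<Rightarrow> 'k::field" where
  "free_gen x = (\<lambda>w. if w = [x] then 1 else 0)"

lemma ring_free_algebra: "ring (free_algebra X :: ('x list \<Rightarrow> 'k::field) ring)"
proof -
  let ?F = "free_algebra X :: ('x list \<Rightarrow> 'k) ring"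
  have conv: "(f \<otimes>\<^bsub>?F\<^esub> g) w = (\<Sum>k\<le>length w. f (take k w) * g (drop k w))" for f g w
    by (simp add: free_algebra_def)
  have prod_closed: "f \<otimes>\<^bsub>?F\<^esub> g \<in> carrier ?F" if "f \<in> carrier ?F" "g \<in> carrier ?F" for f g
  proof -
    let ?S = "(\<lambda>(u, v). u @ v) ` ({w. f w \<noteq> 0} \<times> {w. g w \<noteq> 0})"
    have "w \<in> ?S" if nz: "(f \<otimes>\<^bsub>?F\<^esub> g) w \<noteq> 0" for w
    proof -
      have "(\<Sum>k\<le>length w. f (take k w) * g (drop k w)) \<noteq> 0"
        using nz by (simp add: free_algebra_def)
      then obtain k where "f (take k w) * g (drop k w) \<noteq> 0"
        using sum.not_neutral_contains_not_neutral by blast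
      thus "w \<in> ?S" by (intro image_eqI[of _ _ "(take k w, drop k w)"]) auto
    qed
    hence sub: "{w. (f \<otimes>\<^bsub>?F\<^esub> g) w \<noteq> 0} \<subseteq> ?S" by blast
    have "finite ?S"
      using that by (auto simp: free_algebra_def)
    with sub have fin: "finite {w. (f \<otimes>\<^bsub>?F\<^esub> g) w \<noteq> 0}" by (rule finite_subset)
    have "?S \<subseteq> lists X"
      using that by (auto simp: free_algebra_def in_lists_conv_set subset_iff)
    with sub have "{w. (f \<otimes>\<^bsub>?F\<^esub> g) w \<noteq> 0} \<subseteq> lists X" by (rule order_trans)
    with fin show ?thesis by (simp add: free_algebra_def)
  qed
  have prod_assoc: "f \<otimes>\<^bsub>?F\<^esub> g \<otimes>\<^bsub>?F\<^esub> h = f \<otimes>\<^bsub>?F\<^esub> (g \<otimes>\<^bsub>?F\<^esub> h)" for f g h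
  proof
    fix w :: "'x list"
    define t where "t = (\<lambda>i k. f (take i w) * g (take (k - i) (drop i w)) * h (drop k w))"
    have "(f \<otimes>\<^bsub>?F\<^esub> g \<otimes>\<^bsub>?F\<^esub> h) w = (\<Sum>k\<le>length w. \<Sum>i\<le>k. t i k)"
      unfolding conv sum_distrib_right t_def
      by (intro sum.cong refl) (simp_all add: min_absorb1 min_absorb2 drop_take)
    also have "\<dots> = (\<Sum>(k, i)\<in>Sigma {..length w} (\<lambda>k. {..k}). t i k)"
      by (simp add: sum.Sigma)
    also have "\<dots> = (\<Sum>(i, l)\<in>Sigma {..length w} (\<lambda>i. {..length w - i}). t i (i + l))"
      by (rule sum.reindex_bij_witness[of _ "\<lambda>(i, l). (i + l, i)" "\<lambda>(k, i). (i, k - i)"]) auto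
    also have "\<dots> = (\<Sum>i\<le>length w. \<Sum>l\<le>length w - i. t i (i + l))"
      by (simp add: sum.Sigma)
    also have "\<dots> = (f \<otimes>\<^bsub>?F\<^esub> (g \<otimes>\<^bsub>?F\<^esub> h)) w"
      unfolding conv sum_distrib_left t_def
      by (intro sum.cong refl) (simp_all add: mult.assoc add.commute)
    finally show "(f \<otimes>\<^bsub>?F\<^esub> g \<otimes>\<^bsub>?F\<^esub> h) w = (f \<otimes>\<^bsub>?F\<^esub> (g \<otimes>\<^bsub>?F\<^esub> h)) w" .
  qed
  have l_one: "\<one>\<^bsub>?F\<^esub> \<otimes>\<^bsub>?F\<^esub> f = f" for f
  proof
    fix w :: "'x list"
    have "(\<one>\<^bsub>?F\<^esub> \<otimes>\<^bsub>?F\<^esub> f) w = (\<Sum>k\<le>length w. if k = 0 then f w else 0)"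
      unfolding conv by (intro sum.cong refl) (auto simp: free_algebra_def)
    thus "(\<one>\<^bsub>?F\<^esub> \<otimes>\<^bsub>?F\<^esub> f) w = f w" by simp
  qed
  have r_one: "f \<otimes>\<^bsub>?F\<^esub> \<one>\<^bsub>?F\<^esub> = f" for f
  proof
    fix w :: "'x list"
    have "(f \<otimes>\<^bsub>?F\<^esub> \<one>\<^bsub>?F\<^esub>) w = (\<Sum>k\<le>length w. if k = length w then f w else 0)"
      unfolding conv by (intro sum.cong refl) (auto simp: free_algebra_def)
    thus "(f \<otimes>\<^bsub>?F\<^esub> \<one>\<^bsub>?F\<^esub>) w = f w" by simp
  qed
  show ?thesis
  proof (rule ringI)
    show "abelian_group ?F"
    proof (rule abelian_groupI)
      fix f g assume f: "f \<in> carrier ?F" and g: "g \<in> carrier ?F"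
      have "{w. f w + g w \<noteq> 0} \<subseteq> {w. f w \<noteq> 0} \<union> {w. g w \<noteq> 0}" by auto
      moreover from this have "finite {w. f w + g w \<noteq> 0}"
        by (rule finite_subset) (use f g in \<open>simp add: free_algebra_def\<close>)
      ultimately show "f \<oplus>\<^bsub>?F\<^esub> g \<in> carrier ?F"
        using f g unfolding free_algebra_def by auto
    next
      fix f assume "f \<in> carrier ?F"
      thus "\<exists>g\<in>carrier ?F. g \<oplus>\<^bsub>?F\<^esub> f = \<zero>\<^bsub>?F\<^esub>"
        by (intro bexI[of _ "\<lambda>w. - f w"]) (auto simp: free_algebra_def)
    qed (auto simp: free_algebra_def ac_simps)
    have "{w :: 'x list. (if w = [] then 1 else 0 :: 'k) \<noteq> 0} = {[]}" by auto
    hence "\<one>\<^bsub>?F\<^esub> \<in> carrier ?F" by (simp add: free_algebra_def)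
    thus "monoid ?F" by unfold_locales (auto simp: prod_closed prod_assoc l_one r_one)
  qed (auto simp: free_algebra_def algebra_simps sum.distrib)
qed

lemma free_scalar_closed: "free_scalar c \<in> carrier (free_algebra X)"
proof -
  have "{w. free_scalar c w \<noteq> 0} \<subseteq> {[]}" by (auto simp: free_scalar_def)
  thus ?thesis by (auto simp: free_algebra_def free_scalar_def intro: finite_subset)
qed

lemma free_gen_closed:
  assumes "x \<in> X"
  shows "(free_gen x :: 'x list \<Rightarrow> 'k::field) \<in> carrier (free_algebra X)"
proof -
  have "{w. (free_gen x w :: 'k) \<noteq> 0} = {[x]}" by (auto simp: free_gen_def)
  thus ?thesis using assms by (auto simp: free_algebra_def)
qed


section \<open>Quantum matrices\<close>

abbreviation qm_free :: "nat \<Rightarrow> nat \<Rightarrow> ((nat \<times> nat) list \<Rightarrow> complex) ring" where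
  "qm_free m n \<equiv> free_algebra ({1..m} \<times> {1..n})"

abbreviation qm_Y :: "nat \<Rightarrow> nat \<Rightarrow> (nat \<times> nat) list \<Rightarrow> complex" where
  "qm_Y i a \<equiv> free_gen (i, a)"

text \<open>Each defining relation \<open>lhs = rhs\<close> is encoded as the relator \<open>lhs - rhs\<close>.\<close>

inductive_set qm_relators :: "complex \<Rightarrow> nat \<Rightarrow> nat \<Rightarrow> ((nat \<times> nat) list \<Rightarrow> complex) set"
  for q :: complex and m n :: nat where
  same_row:
    "\<lbrakk>i \<in> {1..m}; \<alpha> \<in> {1..n}; \<beta> \<in> {1..n}; \<alpha> < \<beta>\<rbrakk> \<Longrightarrow>
      qm_Y i \<beta> \<otimes>\<^bsub>qm_free m n\<^esub> qm_Y i \<alpha> \<ominus>\<^bsub>qm_free m n\<^esub>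
        free_scalar (inverse q) \<otimes>\<^bsub>qm_free m n\<^esub> qm_Y i \<alpha> \<otimes>\<^bsub>qm_free m n\<^esub> qm_Y i \<beta>
      \<in> qm_relators q m n"
| same_column:
    "\<lbrakk>i \<in> {1..m}; j \<in> {1..m}; \<alpha> \<in> {1..n}; i < j\<rbrakk> \<Longrightarrow>
      qm_Y j \<alpha> \<otimes>\<^bsub>qm_free m n\<^esub> qm_Y i \<alpha> \<ominus>\<^bsub>qm_free m n\<^esub>
        free_scalar (inverse q) \<otimes>\<^bsub>qm_free m n\<^esub> qm_Y i \<alpha> \<otimes>\<^bsub>qm_free m n\<^esub> qm_Y j \<alpha>
      \<in> qm_relators q m n"
| antidiagonal:
    "\<lbrakk>i \<in> {1..m}; j \<in> {1..m}; \<alpha> \<in> {1..n}; \<beta> \<in> {1..n}; i < j; \<alpha> > \<beta>\<rbrakk> \<Longrightarrow>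
      qm_Y j \<beta> \<otimes>\<^bsub>qm_free m n\<^esub> qm_Y i \<alpha> \<ominus>\<^bsub>qm_free m n\<^esub>
        qm_Y i \<alpha> \<otimes>\<^bsub>qm_free m n\<^esub> qm_Y j \<beta>
      \<in> qm_relators q m n"
| diagonal:
    "\<lbrakk>i \<in> {1..m}; j \<in> {1..m}; \<alpha> \<in> {1..n}; \<beta> \<in> {1..n}; i < j; \<alpha> < \<beta>\<rbrakk> \<Longrightarrow>
      qm_Y j \<beta> \<otimes>\<^bsub>qm_free m n\<^esub> qm_Y i \<alpha> \<ominus>\<^bsub>qm_free m n\<^esub>
        (qm_Y i \<alpha> \<otimes>\<^bsub>qm_free m n\<^esub> qm_Y j \<beta> \<ominus>\<^bsub>qm_free m n\<^esub>
          free_scalar (q - inverse q) \<otimes>\<^bsub>qm_free m n\<^esub> qm_Y i \<beta> \<otimes>\<^bsub>qm_free m n\<^esub> qm_Y j \<alpha>)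
      \<in> qm_relators q m n"

definition quantum_matrices ::
    "complex \<Rightarrow> nat \<Rightarrow> nat \<Rightarrow> ((nat \<times> nat) list \<Rightarrow> complex) set ring" where
  "quantum_matrices q m n =
     qm_free m n Quot genideal (qm_free m n) (qm_relators q m n)"

lemma qm_relators_subset: "qm_relators q m n \<subseteq> carrier (qm_free m n)"
proof -
  interpret F: ring "qm_free m n" by (rule ring_free_algebra)
  show ?thesis
    by (auto simp del: One_nat_def elim!: qm_relators.cases
        intro!: F.minus_closed F.m_closed free_gen_closed free_scalar_closed)
qed

lemma ring_quantum_matrices: "ring (quantum_matrices q m n)"
proof -
  interpret F: ring "qm_free m n" by (rule ring_free_algebra)
  show ?thesis unfolding quantum_matrices_def
    by (rule ideal.quotient_is_ring[OF F.genideal_ideal[OF qm_relators_subset]])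
qed

end

theory Submission
  imports Defs "HOL-Library.Function_Algebras" "HOL-Library.Product_Lexorder"
    "HOL-Computational_Algebra.Polynomial" "HOL-Analysis.Continuum_Not_Denumerable"
begin

text \<open>
  The path model realises quantum matrices inside a quantum torus: an \<open>m \<times> n\<close> quantum matrix arises
  from an \<open>(m - 1) \<times> n\<close> one by adding a row of torus generators, and leading terms of ordered
  monomials show that the map is injective. Monomials of the torus that lie in the algebra generate
  the whole lattice of exponents, so the torus is a localisation of the algebra at monomials, and
  everything is governed by the integer skew form describing the commutation of monomials.

  If this form is nondegenerate, each nonzero ideal contains a monomial, hence a power of one fixed
  monomial \<open>c\<close>; a maximal left ideal containing \<open>1 - c\<close> then gives a faithful simple module. If it is
  degenerate, a central monomial of the torus obstructs primitivity, by Amitsur's uncountability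
  argument. Extending exponents antiperiodically in rows and columns, the radical of the form
  consists of the functions of \<open>i - \<alpha>\<close> that are antiperiodic with respect to both \<open>m\<close> and \<open>n\<close>, and
  nonzero ones exist precisely when \<open>m\<close> and \<open>n\<close> have the same \<open>2\<close>-adic valuation.
\<close>

hide_const (open) Polynomial.smult

section \<open>Linear operators on function spaces\<close>

text \<open>The torus, its localisations and the algebra sit in one ring of operators, so that lying
  in the algebra is plain membership and fractions of monomials are ordinary elements. The obstacle
  is that a central monomial \<open>z\<close> of the torus usually lies outside the algebra and
  cannot act on its modules directly. Arguments about \<open>z\<close> therefore run with
  numerators: \<open>z\<close> meets only elements \<open>b\<close> for which finitely many products
  \<open>z ^ i * b\<close> stay inside the algebra. Amitsur's argument is adapted accordingly: the
  resolvents of \<open>z\<close> at all complex numbers form an uncountable family in a space of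
  countable dimension, and a linear relation between them becomes a nonzero polynomial in
  \<open>z\<close> that would have to act as 0. The presentation gives no basis of the quotient.
  That sorted words span it comes from rewriting, that they are independent comes from their images
  in the torus; together these identify the ideal of relations with the kernel of
  evaluation.\<close>

typedef 'a lop = "{f :: ('a \<Rightarrow> complex) \<Rightarrow> ('a \<Rightarrow> complex).
    (\<forall>g h. f (\<lambda>x. g x + h x) = (\<lambda>x. f g x + f h x)) \<and> (\<forall>c g. f (\<lambda>x. c * g x) = (\<lambda>x. c * f g x))}"
  by (rule exI[of _ id]) auto

setup_lifting type_definition_lop

instantiation lop :: (type) ring_1
begin

lift_definition zero_lop :: "'a lop" is "\<lambda>g x. 0" by auto
lift_definition one_lop :: "'a lop" is "\<lambda>g. g" by auto
lift_definition plus_lop :: "'a lop \<Rightarrow> 'a lop \<Rightarrow> 'a lop" is "\<lambda>f h g x. f g x + h g x"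
  by (auto simp: algebra_simps)
lift_definition minus_lop :: "'a lop \<Rightarrow> 'a lop \<Rightarrow> 'a lop" is "\<lambda>f h g x. f g x - h g x"
  by (auto simp: algebra_simps)
lift_definition uminus_lop :: "'a lop \<Rightarrow> 'a lop" is "\<lambda>f g x. - f g x"
  by (auto simp: algebra_simps)
lift_definition times_lop :: "'a lop \<Rightarrow> 'a lop \<Rightarrow> 'a lop" is "\<lambda>f h g. f (h g)"
  by auto

instance
proof
  fix a b c :: "'a lop"
  show "a * b * c = a * (b * c)" "1 * a = a" "a * 1 = a" "a + b + c = a + (b + c)"
    "a + b = b + a" "0 + a = a" "- a + a = 0" "a - b = a + - b" "(a + b) * c = a * c + b * c"
    by (transfer; auto simp: fun_eq_iff algebra_simps)+
  show "a * (b + c) = a * b + a * c"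
    by transfer (auto simp: fun_eq_iff)
  have "(\<lambda>g x. 0) \<noteq> (\<lambda>g :: 'a \<Rightarrow> complex. g)"
    by (metis zero_neq_one)
  thus "(0 :: 'a lop) \<noteq> 1" by transfer
qed

end

lift_definition scl :: "complex \<Rightarrow> 'a lop \<Rightarrow> 'a lop" (infixr \<open>\<bullet>\<close> 75) is "\<lambda>c f g x. c * f g x"
  by (auto simp: algebra_simps)

interpretation lop: vector_space "scl :: complex \<Rightarrow> 'a lop \<Rightarrow> 'a lop"
  by unfold_locales (transfer; auto simp: fun_eq_iff algebra_simps)+

lemma scl_mult_left [simp]: "(c \<bullet> f) * g = c \<bullet> (f * g)"
  by transfer auto

lemma scl_mult_right [simp]: "f * (c \<bullet> g) = c \<bullet> (f * g)"
  by transfer (auto simp: fun_eq_iff)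

section \<open>Primitivity of subrings of a unital ring\<close>

text \<open>A bridge between two styles: primitivity is a statement about records, while
  computations use the type class \<open>ring_1\<close>.\<close>

definition subring_record :: "'r::ring_1 set \<Rightarrow> 'r ring" where
  "subring_record A = \<lparr>carrier = A, mult = (*), one = 1, zero = 0, add = (+)\<rparr>"

lemma subring_record_simps [simp]:
  "carrier (subring_record A) = A" "mult (subring_record A) = (*)" "one (subring_record A) = 1"
  "zero (subring_record A) = 0" "add (subring_record A) = (+)"
  by (simp_all add: subring_record_def)

definition is_subring :: "'r::ring_1 set \<Rightarrow> bool" where
  "is_subring A \<longleftrightarrow> 1 \<in> A \<and> (\<forall>x\<in>A. \<forall>y\<in>A. x - y \<in> A \<and> x * y \<in> A)"

definition is_left_ideal :: "'r::ring_1 set \<Rightarrow> 'r set \<Rightarrow> bool" where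
  "is_left_ideal A I \<longleftrightarrow> I \<subseteq> A \<and> 0 \<in> I \<and> (\<forall>x\<in>I. \<forall>y\<in>I. x + y \<in> I) \<and> (\<forall>a\<in>A. \<forall>x\<in>I. a * x \<in> I)"

definition is_right_ideal :: "'r::ring_1 set \<Rightarrow> 'r set \<Rightarrow> bool" where
  "is_right_ideal A I \<longleftrightarrow> I \<subseteq> A \<and> 0 \<in> I \<and> (\<forall>x\<in>I. \<forall>y\<in>I. x + y \<in> I) \<and> (\<forall>a\<in>A. \<forall>x\<in>I. x * a \<in> I)"

lemma is_subringD:
  assumes "is_subring A"
  shows "1 \<in> A" "0 \<in> A" "x \<in> A \<Longrightarrow> y \<in> A \<Longrightarrow> x + y \<in> A" "x \<in> A \<Longrightarrow> y \<in> A \<Longrightarrow> x - y \<in> A"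
    "x \<in> A \<Longrightarrow> y \<in> A \<Longrightarrow> x * y \<in> A" "x \<in> A \<Longrightarrow> - x \<in> A"
proof -
  have d: "x - y \<in> A" if "x \<in> A" "y \<in> A" for x y using assms that by (auto simp: is_subring_def)
  show one: "1 \<in> A" using assms by (auto simp: is_subring_def)
  show z: "0 \<in> A" using d[OF one one] by simp
  have m: "- x \<in> A" if "x \<in> A" for x using d[OF z that] by simp
  show "x \<in> A \<Longrightarrow> - x \<in> A" by (rule m)
  show "x \<in> A \<Longrightarrow> y \<in> A \<Longrightarrow> x + y \<in> A" using d[of x "- y"] m[of y] by simp
  show "x \<in> A \<Longrightarrow> y \<in> A \<Longrightarrow> x - y \<in> A" by (rule d)
  show "x \<in> A \<Longrightarrow> y \<in> A \<Longrightarrow> x * y \<in> A" using assms by (auto simp: is_subring_def)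
qed

lemma is_left_idealD:
  assumes "is_left_ideal A I"
  shows "x \<in> I \<Longrightarrow> x \<in> A" "0 \<in> I" "x \<in> I \<Longrightarrow> y \<in> I \<Longrightarrow> x + y \<in> I"
    "a \<in> A \<Longrightarrow> x \<in> I \<Longrightarrow> a * x \<in> I"
  using assms by (auto simp: is_left_ideal_def)

lemma is_left_ideal_diff:
  assumes "is_subring A" "is_left_ideal A I"
  shows "y \<in> I \<Longrightarrow> - y \<in> I" "x \<in> I \<Longrightarrow> y \<in> I \<Longrightarrow> x - y \<in> I"
proof -
  show m: "- y \<in> I" if "y \<in> I" for y
    using is_left_idealD(4)[OF assms(2), of "-1" y] is_subringD[OF assms(1)] that by auto
  show "x - y \<in> I" if "x \<in> I" "y \<in> I"
    using is_left_idealD(3)[OF assms(2) that(1) m[OF that(2)]] by simp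
qed

lemma is_left_ideal_sum:
  assumes "is_left_ideal A I" "\<And>u. u \<in> E \<Longrightarrow> g u \<in> I"
  shows "sum g E \<in> I"
  using assms(2)
  by (induction E rule: infinite_finite_induct) (auto intro: is_left_idealD[OF assms(1)])

lemma ring_subring_record:
  assumes "is_subring A"
  shows "ring (subring_record A)"
proof (rule ringI)
  show "abelian_group (subring_record A)"
    by (rule abelian_groupI) (auto intro: is_subringD[OF assms] bexI[of _ "- x" for x] simp: ac_simps)
  show "Group.monoid (subring_record A)"
    by unfold_locales (auto intro: is_subringD[OF assms] simp: mult.assoc)
qed (auto simp: algebra_simps)

text \<open>Zorn's lemma applies since properness is the condition \<open>1 \<notin> I\<close>,
  which the union of a chain inherits.\<close>

lemma maximal_left_ideal_exists:
  fixes A :: "'r::ring_1 set"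
  assumes L0: "is_left_ideal A L0" "1 \<notin> L0"
  obtains L where "is_left_ideal A L" "L0 \<subseteq> L" "1 \<notin> L"
    "\<And>I. is_left_ideal A I \<Longrightarrow> L \<subseteq> I \<Longrightarrow> 1 \<notin> I \<Longrightarrow> I = L"
proof -
  define \<A> where "\<A> = {I. is_left_ideal A I \<and> L0 \<subseteq> I \<and> 1 \<notin> I}"
  have "\<exists>M\<in>\<A>. \<forall>X\<in>\<A>. M \<subseteq> X \<longrightarrow> X = M"
  proof (rule subset_Zorn_nonempty)
    show "\<A> \<noteq> {}" using L0 by (auto simp: \<A>_def)
  next
    fix C assume C: "C \<noteq> {}" "subset.chain \<A> C"
    have sub: "\<And>I. I \<in> C \<Longrightarrow> is_left_ideal A I \<and> L0 \<subseteq> I \<and> 1 \<notin> I"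
      and tot: "\<And>I J. I \<in> C \<Longrightarrow> J \<in> C \<Longrightarrow> I \<subseteq> J \<or> J \<subseteq> I"
      using C(2) by (auto simp: subset_chain_def \<A>_def)
    have "x + y \<in> \<Union>C" if "x \<in> \<Union>C" "y \<in> \<Union>C" for x y
    proof -
      from that obtain I J where IJ: "I \<in> C" "J \<in> C" "x \<in> I" "y \<in> J" by auto
      from tot[OF IJ(1,2)] IJ obtain K where "K \<in> C" "x \<in> K" "y \<in> K" by blast
      thus ?thesis using sub[of K] by (auto simp: is_left_ideal_def)
    qed
    moreover have "\<Union>C \<subseteq> A" "0 \<in> \<Union>C" "L0 \<subseteq> \<Union>C" "1 \<notin> \<Union>C" "\<And>a x. a \<in> A \<Longrightarrow> x \<in> \<Union>C \<Longrightarrow> a * x \<in> \<Union>C"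
      using sub C(1) unfolding is_left_ideal_def by blast+
    ultimately show "\<Union>C \<in> \<A>" by (auto simp: \<A>_def is_left_ideal_def)
  qed
  then obtain L where L: "L \<in> \<A>" "\<And>X. X \<in> \<A> \<Longrightarrow> L \<subseteq> X \<Longrightarrow> X = L" by blast
  show ?thesis
    by (rule that[of L]) (use L in \<open>auto simp: \<A>_def\<close>)
qed

text \<open>The module is \<open>A\<close> modulo \<open>L\<close>, carried by representatives
  instead of cosets. Submodules pull back to left ideals above \<open>L\<close>, so maximality gives
  simplicity.\<close>

lemma simple_quotient:
  fixes A :: "'r::ring_1 set"
  assumes A: "is_subring A" and L: "is_left_ideal A L" "1 \<notin> L"
    and maxL: "\<And>I. is_left_ideal A I \<Longrightarrow> L \<subseteq> I \<Longrightarrow> 1 \<notin> I \<Longrightarrow> I = L"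
  shows "\<exists>M :: ('r, 'r) module. simple_left_module (subring_record A) M \<and>
           annihilator (subring_record A) M = {a \<in> A. \<forall>x\<in>A. a * x \<in> L}"
proof -
  note cl = is_subringD[OF A]
  \<comment> \<open>Congruent elements satisfy the same choice predicate, so the chosen
    representative depends only on the coset.\<close>
  define r where "r x = (SOME y. y - x \<in> L)" for x
  have r: "r x - x \<in> L" for x
    unfolding r_def by (rule someI[of _ x]) (simp add: is_left_idealD(2)[OF L(1)])
  have r_eqI: "r x = r y" if "x - y \<in> L" for x y
  proof -
    have "z - x \<in> L \<longleftrightarrow> z - y \<in> L" for z
      using is_left_idealD(3)[OF L(1) _ that, of "z - x"] is_left_ideal_diff(2)[OF A L(1) _ that, of "z - y"]
      by auto
    thus ?thesis by (simp add: r_def)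
  qed
  have r_eq: "r x = r y \<longleftrightarrow> x - y \<in> L" for x y
  proof
    assume "r x = r y"
    hence "(r y - y) - (r x - x) = x - y" by simp
    thus "x - y \<in> L" using is_left_ideal_diff(2)[OF A L(1) r[of y] r[of x]] by simp
  qed (rule r_eqI)
  have rA: "r x \<in> A" if "x \<in> A" for x
    using is_subringD(3)[OF A is_left_idealD(1)[OF L(1) r[of x]] that] by simp
  have rr [simp]: "r (r x) = r x" for x using r r_eq by blast
  have r_add: "r (r x + y) = r (x + y)" "r (x + r y) = r (x + y)" for x y
    using r[of x] r[of y] by (auto simp: r_eq)
  have r_mult: "r (a * r x) = r (a * x)" if "a \<in> A" for a x
    using is_left_idealD(4)[OF L(1) that r[of x]] by (simp add: r_eq algebra_simps)
  define M :: "('r, 'r) module" where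
    "M = \<lparr>carrier = r ` A, mult = (\<lambda>x y. x), one = 0, zero = r 0,
          add = (\<lambda>x y. r (x + y)), smult = (\<lambda>a x. r (a * x))\<rparr>"
  have M: "carrier M = r ` A" "\<zero>\<^bsub>M\<^esub> = r 0" "\<And>x y. x \<oplus>\<^bsub>M\<^esub> y = r (x + y)"
     "\<And>a x. a \<odot>\<^bsub>M\<^esub> x = r (a * x)"
    by (simp_all add: M_def)
  interpret R: ring "subring_record A" by (rule ring_subring_record[OF A])
  have agM: "abelian_group M"
  proof (rule abelian_groupI)
    fix u assume "u \<in> carrier M"
    then obtain x where "x \<in> A" "u = r x" by (auto simp: M)
    thus "\<exists>y\<in>carrier M. y \<oplus>\<^bsub>M\<^esub> u = \<zero>\<^bsub>M\<^esub>"
      by (intro bexI[of _ "r (- x)"]) (auto simp: M r_add intro: cl)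
  qed (auto simp: M r_add ac_simps intro: cl)
  interpret M: abelian_group M by (rule agM)
  have lm: "left_module (subring_record A) M"
  proof
    fix a b x y
    assume "a \<in> carrier (subring_record A)" "b \<in> carrier (subring_record A)"
      and "x \<in> carrier M" "y \<in> carrier M"
    then obtain u v where ab: "a \<in> A" "b \<in> A" "u \<in> A" "v \<in> A" "x = r u" "y = r v"
      by (auto simp: M)
    show "(a \<oplus>\<^bsub>subring_record A\<^esub> b) \<odot>\<^bsub>M\<^esub> x = a \<odot>\<^bsub>M\<^esub> x \<oplus>\<^bsub>M\<^esub> b \<odot>\<^bsub>M\<^esub> x"
      using ab r_mult[of "a + b" u] is_subringD(3)[OF A ab(1,2)]
      by (simp add: M r_add r_mult distrib_right)
    show "a \<odot>\<^bsub>M\<^esub> (x \<oplus>\<^bsub>M\<^esub> y) = a \<odot>\<^bsub>M\<^esub> x \<oplus>\<^bsub>M\<^esub> a \<odot>\<^bsub>M\<^esub> y"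
      using ab by (simp add: M r_add r_mult distrib_left)
    show "(a \<otimes>\<^bsub>subring_record A\<^esub> b) \<odot>\<^bsub>M\<^esub> x = a \<odot>\<^bsub>M\<^esub> (b \<odot>\<^bsub>M\<^esub> x)"
      using ab r_mult[of "a * b" u] is_subringD(5)[OF A ab(1,2)]
      by (simp add: M r_mult) (simp add: mult.assoc)
  qed (auto simp: M r_mult intro: cl)
  interpret LM: left_module "subring_record A" M by (rule lm)
  have simple: "H = {\<zero>\<^bsub>M\<^esub>} \<or> H = carrier M" if H: "submodule H (subring_record A) M" for H
  proof -
    interpret H: submodule H "subring_record A" M by (rule H)
    define I where "I = {x \<in> A. r x \<in> H}"
    have Hsub: "H \<subseteq> r ` A" using H.subset by (simp add: M)
    have "r (x + y) \<in> H" if "r x \<in> H" "r y \<in> H" for x y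
      using H.m_closed[OF that] by (simp add: M r_add)
    moreover have "r (a * x) \<in> H" if "a \<in> A" "r x \<in> H" for a x
      using H.smult_closed[of a, OF _ that(2)] that(1) by (simp add: M r_mult)
    moreover have "r 0 \<in> H" using H.one_closed by (simp add: M)
    ultimately have "is_left_ideal A I"
      unfolding is_left_ideal_def I_def by (auto intro: cl)
    moreover have "L \<subseteq> I"
    proof
      fix x assume "x \<in> L"
      moreover from this have "r x = r 0" by (simp add: r_eq)
      ultimately show "x \<in> I" using H.one_closed is_left_idealD(1)[OF L(1)] by (auto simp: M I_def)
    qed
    ultimately have "I = L \<or> 1 \<in> I" using maxL by blast
    thus ?thesis
    proof
      assume "I = L"
      have "x = r 0" if "x \<in> H" for x
      proof -
        from that Hsub obtain y where y: "y \<in> A" "x = r y" by auto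
        hence "y \<in> L" using that \<open>I = L\<close> by (auto simp: I_def)
        thus ?thesis using y by (simp add: r_eq)
      qed
      moreover have "r 0 \<in> H" using H.one_closed by (simp add: M)
      ultimately have "H = {r 0}" by blast
      thus ?thesis by (simp add: M)
    next
      assume "1 \<in> I"
      hence one: "r 1 \<in> H" by (simp add: I_def)
      have "r a \<in> H" if "a \<in> A" for a
        using H.smult_closed[of a, OF _ one] that by (simp add: M r_mult)
      thus ?thesis using Hsub by (auto simp: M)
    qed
  qed
  have "carrier M \<noteq> {\<zero>\<^bsub>M\<^esub>}"
  proof
    assume "carrier M = {\<zero>\<^bsub>M\<^esub>}"
    hence "r 1 = r 0" using is_subringD(1)[OF A] by (auto simp: M)
    thus False using L by (simp add: r_eq)
  qed
  moreover have "r (a * r x) = r 0 \<longleftrightarrow> a * x \<in> L" if "a \<in> A" for a x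
    using r_eq[of "a * x" 0] by (simp add: r_mult[OF that])
  hence "annihilator (subring_record A) M = {a \<in> A. \<forall>x\<in>A. a * x \<in> L}"
    by (auto simp: annihilator_def M)
  ultimately show ?thesis using simple lm
    by (intro exI[of _ M]) (simp add: simple_left_module_def)
qed

text \<open>Put \<open>1 - c\<close> into a maximal left ideal \<open>L\<close>. Then
  \<open>c\<close>, and with it each power of \<open>c\<close>, is congruent to 1 modulo
  \<open>L\<close>, so no power annihilates the simple quotient. The annihilator is a two-sided
  ideal without powers of \<open>c\<close>, hence zero. The condition on \<open>a * (1 - c)\<close>
  makes the left ideal generated by \<open>1 - c\<close> proper.\<close>

lemma left_primitive_ring_if_powers_meet_ideals:
  fixes A :: "'r::ring_1 set"
  assumes A: "is_subring A" and c: "c \<in> A" "\<And>a. a \<in> A \<Longrightarrow> a * (1 - c) \<noteq> 1"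
    and pow: "\<And>I. is_left_ideal A I \<Longrightarrow> is_right_ideal A I \<Longrightarrow> I \<noteq> {0} \<Longrightarrow> \<exists>k. c ^ k \<in> I"
  shows "left_primitive_ring (subring_record A)"
proof -
  note [intro] = is_subringD[OF A]
  have "is_left_ideal A ((\<lambda>a. a * (1 - c)) ` A)"
    using c(1) unfolding is_left_ideal_def
    by (auto simp: distrib_right[symmetric] mult.assoc[symmetric] intro!: imageI intro: image_eqI[of _ _ 0])
  moreover have "1 \<notin> (\<lambda>a. a * (1 - c)) ` A" using c(2) by force
  ultimately obtain L where L: "is_left_ideal A L" "(\<lambda>a. a * (1 - c)) ` A \<subseteq> L" "1 \<notin> L"
    "\<And>I. is_left_ideal A I \<Longrightarrow> L \<subseteq> I \<Longrightarrow> 1 \<notin> I \<Longrightarrow> I = L"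
    by (rule maximal_left_ideal_exists) blast
  obtain M :: "('r, 'r) module" where M: "simple_left_module (subring_record A) M"
    "annihilator (subring_record A) M = {a \<in> A. \<forall>x\<in>A. a * x \<in> L}"
    using simple_quotient[OF A L(1,3,4)] by blast
  define I where "I = {a \<in> A. \<forall>x\<in>A. a * x \<in> L}"
  have "1 * (1 - c) \<in> L" using L(2) is_subringD(1)[OF A] by blast
  hence "1 - c \<in> L" by simp
  hence c1: "c - 1 \<in> L" using is_left_ideal_diff(1)[OF A L(1), of "1 - c"] by simp
  have powL: "c ^ k - 1 \<in> L" for k
  proof (induction k)
    case (Suc k)
    have "c ^ Suc k - 1 = c * (c ^ k - 1) + (c - 1)" by (simp add: algebra_simps)
    thus ?case using Suc c1 c(1) L(1) by (metis is_left_idealD(3,4))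
  qed (use L(1) in \<open>simp add: is_left_idealD\<close>)
  have "is_left_ideal A I" "is_right_ideal A I"
    using L(1) unfolding is_left_ideal_def is_right_ideal_def I_def
    by (auto simp: mult.assoc distrib_right)
  moreover have "c ^ k \<notin> I" for k
  proof
    assume "c ^ k \<in> I"
    hence "c ^ k * 1 \<in> L" using is_subringD(1)[OF A] by (auto simp: I_def)
    from is_left_ideal_diff(2)[OF A L(1) this powL[of k]] show False using L(3) by simp
  qed
  ultimately have "I = {0}" using pow by blast
  hence "annihilator (subring_record A) M = {\<zero>\<^bsub>subring_record A\<^esub>}" using M(2) by (simp add: I_def)
  thus ?thesis unfolding left_primitive_ring_def using left_primitive_idealI[OF M(1)] by blast
qed

section \<open>A criterion for non-primitivity\<close>

text \<open>Horner evaluation of a polynomial at an operator; the complex coefficients act as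
  scalars.\<close>

definition poly_op :: "'a lop \<Rightarrow> complex poly \<Rightarrow> 'a lop" where
  "poly_op z p = fold_coeffs (\<lambda>a r. a \<bullet> 1 + z * r) p 0"

lemma poly_op_0 [simp]: "poly_op z 0 = 0"
  by (simp add: poly_op_def)

lemma poly_op_pCons [simp]: "poly_op z (pCons a p) = a \<bullet> 1 + z * poly_op z p"
  by (cases "p = 0 \<and> a = 0") (auto simp: poly_op_def fold_coeffs_pCons_coeff_not_0_eq fold_coeffs_pCons_not_0_0_eq)

lemma poly_op_add: "poly_op z (p + r) = poly_op z p + poly_op z r"
  by (induction p r rule: poly_induct2) (auto simp: algebra_simps lop.scale_left_distrib)

lemma poly_op_smult: "poly_op z (Polynomial.smult c p) = c \<bullet> poly_op z p"
  by (induction p) (auto simp: lop.scale_right_distrib)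

lemma poly_op_sum: "poly_op z (\<Sum>i\<in>I. p i) = (\<Sum>i\<in>I. poly_op z (p i))"
  by (induction I rule: infinite_finite_induct) (auto simp: poly_op_add)

lemma poly_op_mult: "poly_op z (p * r) = poly_op z p * poly_op z r"
  by (induction p) (auto simp: poly_op_add poly_op_smult algebra_simps)

lemma poly_op_commute:
  assumes "z * b = b * z"
  shows "poly_op z p * b = b * poly_op z p"
proof (induction p)
  case (pCons a p)
  have "z * poly_op z p * b = z * (b * poly_op z p)" by (simp add: mult.assoc pCons)
  also have "\<dots> = b * (z * poly_op z p)" by (simp add: mult.assoc[symmetric] assms)
  finally show ?case by (simp add: algebra_simps)
qed simp

text \<open>The element \<open>z\<close> may lie outside \<open>A\<close>. Each induction step moves
  one factor \<open>z\<close> from the polynomial into \<open>b\<close>, which lowers the degree and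
  the bound \<open>N\<close> together.\<close>

lemma poly_op_mult_closed:
  assumes A: "lop.subspace A" and b: "\<And>i. i \<le> N \<Longrightarrow> z ^ i * b \<in> A" and p: "degree p \<le> N"
    and z: "z * b = b * z"
  shows "poly_op z p * b \<in> A"
  using b p z
proof (induction p arbitrary: b N)
  case 0
  thus ?case using A by (simp add: lop.subspace_0)
next
  case (pCons a p)
  have "a \<bullet> (z ^ 0 * b) \<in> A" using pCons.prems(1)[of 0] A lop.subspace_scale by blast
  hence ab: "a \<bullet> b \<in> A" by simp
  show ?case
  proof (cases "p = 0")
    case False
    then obtain N' where N: "N = Suc N'" "degree p \<le> N'"
      using pCons.prems(2) by (cases N) auto
    have "poly_op z p * (z * b) \<in> A"
    proof (rule pCons.IH[OF _ N(2)])
      fix i assume "i \<le> N'"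
      hence "z ^ Suc i * b \<in> A" by (intro pCons.prems(1)) (simp add: N)
      thus "z ^ i * (z * b) \<in> A" by (simp add: mult.assoc[symmetric] power_commutes)
    qed (metis mult.assoc pCons.prems(3))
    moreover have "z * poly_op z p = poly_op z p * z"
      using poly_op_commute[of z z] by simp
    ultimately have "z * poly_op z p * b \<in> A" by (simp add: mult.assoc)
    thus ?thesis using ab A by (simp add: algebra_simps lop.subspace_add)
  qed (use ab in simp)
qed

text \<open>Each value uses finitely many elements of \<open>W\<close>, and \<open>W\<close> has
  only countably many finite subsets, so some finite \<open>G\<close> serves infinitely many
  indices. Infinitely many distinct vectors in the span of \<open>G\<close> are dependent; a
  repeated value is a relation by itself.\<close>

lemma uncountable_family_dependent:
  fixes f :: "complex \<Rightarrow> 'a lop"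
  assumes W: "countable W" and f: "\<And>u. f u \<in> lop.span W"
  shows "\<exists>E c. finite E \<and> (\<Sum>u\<in>E. c u \<bullet> f u) = 0 \<and> (\<exists>u\<in>E. c u \<noteq> 0)"
proof -
  have "\<exists>F. finite F \<and> F \<subseteq> W \<and> f u \<in> lop.span F" for u
  proof -
    obtain F r where "finite F" "F \<subseteq> W" "f u = (\<Sum>a\<in>F. r a \<bullet> a)"
      using f[of u] by (auto simp: lop.span_explicit)
    moreover have "(\<Sum>a\<in>F. r a \<bullet> a) \<in> lop.span F"
      by (intro lop.span_sum lop.span_scale lop.span_base)
    ultimately show ?thesis by auto
  qed
  then obtain F where F: "\<And>u. finite (F u)" "\<And>u. F u \<subseteq> W" "\<And>u. f u \<in> lop.span (F u)" by metis
  have "\<exists>G. infinite {u. F u = G}"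
  proof (rule ccontr)
    assume "\<not> ?thesis"
    hence "\<And>G. countable {u. F u = G}" by (auto intro: countable_finite)
    hence "countable (\<Union>G\<in>{G. finite G \<and> G \<subseteq> W}. {u. F u = G})"
      using W by (intro countable_UN countable_Collect_finite_subset) auto
    moreover have "(\<Union>G\<in>{G. finite G \<and> G \<subseteq> W}. {u. F u = G}) = UNIV" using F by auto
    ultimately show False using uncountable_UNIV_complex by simp
  qed
  then obtain G where G: "infinite {u. F u = G}" by blast
  define S where "S = {u. F u = G}"
  have S: "infinite S" "finite G" "f ` S \<subseteq> lop.span G"
    using G F(1,3) infinite_imp_nonempty[OF G] unfolding S_def by auto
  show ?thesis
  proof (cases "inj_on f S")
    case False
    then obtain u v where uv: "u \<noteq> v" "f u = f v" by (auto simp: inj_on_def)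
    show ?thesis
      by (rule exI[of _ "{u, v}"], rule exI[of _ "\<lambda>x. if x = u then 1 else -1"])
         (use uv in \<open>auto simp: lop.scale_minus_left\<close>)
  next
    case True
    have "lop.dependent (f ` S)"
      using lop.independent_span_bound[OF S(2) _ S(3)] finite_imageD[OF _ True] S(1) by blast
    then obtain T r v where T: "finite T" "T \<subseteq> f ` S" "(\<Sum>v\<in>T. r v \<bullet> v) = 0" "v \<in> T" "r v \<noteq> 0"
      unfolding lop.dependent_explicit by blast
    define E where "E = {u \<in> S. f u \<in> T}"
    have bij: "bij_betw f E T"
      using True T(2) unfolding bij_betw_def E_def inj_on_def by blast
    have "(\<Sum>u\<in>E. r (f u) \<bullet> f u) = 0"
      using sum.reindex_bij_betw[OF bij, of "\<lambda>v. r v \<bullet> v"] T(3) by simp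
    moreover have "finite E" using bij_betw_finite[OF bij] T(1) by simp
    moreover have "\<exists>u\<in>E. r (f u) \<noteq> 0"
      using T(4,5) bij unfolding bij_betw_def by (metis imageE)
    ultimately show ?thesis
      by (intro exI[of _ E] exI[of _ "\<lambda>u. r (f u)"] conjI)
  qed
qed

text \<open>
  A simple faithful module would let the central element \<open>z\<close> act by an endomorphism commuting with
  the algebra; the argument is Amitsur's proof that such an endomorphism is a scalar, unfolded so that
  only the ideals \<open>{b. z ^ i * b \<in> A for i \<le> N}\<close> are needed.
\<close>
lemma not_left_primitive_ring_if_central:
  fixes A :: "'a lop set"
  assumes A: "is_subring A" "lop.subspace A" and W: "countable W" "A \<subseteq> lop.span W"
    and z: "\<And>b. b \<in> A \<Longrightarrow> z * b = b * z"
    and nz: "\<And>p N. p \<noteq> 0 \<Longrightarrow> \<exists>b\<in>A. (\<forall>i\<le>N. z ^ i * b \<in> A) \<and> poly_op z p * b \<noteq> 0"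
  shows "\<not> left_primitive_ring (subring_record A)"
proof
  note [intro] = is_subringD[OF A(1)]
  assume "left_primitive_ring (subring_record A)"
  then obtain M :: "('a lop, 'a lop set) module" where
    simple: "simple_left_module (subring_record A) M" and ann: "annihilator (subring_record A) M = {0}"
    unfolding left_primitive_ring_def left_primitive_ideal_def by auto
  interpret left_module "subring_record A" M using simple by (simp add: simple_left_module_def)
  obtain x0 where x0: "x0 \<in> carrier M" "x0 \<noteq> \<zero>\<^bsub>M\<^esub>"
    using simple M.zero_closed unfolding simple_left_module_def by blast
  have gen: "(\<lambda>a. a \<odot>\<^bsub>M\<^esub> x0) ` I = {\<zero>\<^bsub>M\<^esub>} \<or> (\<lambda>a. a \<odot>\<^bsub>M\<^esub> x0) ` I = carrier M" if I: "is_left_ideal A I" for I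
  proof -
    note IA = is_left_idealD(1)[OF I]
    have "submodule ((\<lambda>a. a \<odot>\<^bsub>M\<^esub> x0) ` I) (subring_record A) M"
    proof (intro submodule.intro subgroup.intro submodule_axioms.intro)
      show "(\<lambda>a. a \<odot>\<^bsub>M\<^esub> x0) ` I \<subseteq> carrier (add_monoid M)" using x0(1) IA by auto
    next
      fix u v assume "u \<in> (\<lambda>a. a \<odot>\<^bsub>M\<^esub> x0) ` I" "v \<in> (\<lambda>a. a \<odot>\<^bsub>M\<^esub> x0) ` I"
      then obtain a b where ab: "a \<in> I" "b \<in> I" "u = a \<odot>\<^bsub>M\<^esub> x0" "v = b \<odot>\<^bsub>M\<^esub> x0" by auto
      hence "u \<oplus>\<^bsub>M\<^esub> v = (a + b) \<odot>\<^bsub>M\<^esub> x0" using smult_l_distr[of a b x0] x0 IA by simp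
      thus "u \<otimes>\<^bsub>add_monoid M\<^esub> v \<in> (\<lambda>a. a \<odot>\<^bsub>M\<^esub> x0) ` I"
        using is_left_idealD(3)[OF I ab(1,2)] by simp
    next
      show "\<one>\<^bsub>add_monoid M\<^esub> \<in> (\<lambda>a. a \<odot>\<^bsub>M\<^esub> x0) ` I"
        using smult_l_null[OF x0(1)] is_left_idealD(2)[OF I] by (auto intro!: image_eqI[of _ _ 0])
    next
      fix u assume "u \<in> (\<lambda>a. a \<odot>\<^bsub>M\<^esub> x0) ` I"
      then obtain a where a: "a \<in> I" "u = a \<odot>\<^bsub>M\<^esub> x0" by auto
      have "\<ominus>\<^bsub>subring_record A\<^esub> a = - a"
        using IA[OF a(1)] is_subringD[OF A(1)] by (intro R.minus_equality) auto
      hence "inv\<^bsub>add_monoid M\<^esub> u = (- a) \<odot>\<^bsub>M\<^esub> x0"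
        using a x0(1) smult_l_minus[of a x0] IA by (simp add: a_inv_def[of M])
      thus "inv\<^bsub>add_monoid M\<^esub> u \<in> (\<lambda>a. a \<odot>\<^bsub>M\<^esub> x0) ` I"
        using is_left_ideal_diff(1)[OF A(1) I a(1)] by simp
    next
      fix a u assume "a \<in> carrier (subring_record A)" "u \<in> (\<lambda>a. a \<odot>\<^bsub>M\<^esub> x0) ` I"
      then obtain b where b: "b \<in> I" "u = b \<odot>\<^bsub>M\<^esub> x0" "a \<in> A" by auto
      hence "a \<odot>\<^bsub>M\<^esub> u = (a * b) \<odot>\<^bsub>M\<^esub> x0" using x0(1) IA smult_assoc[of a b x0] by simp
      thus "a \<odot>\<^bsub>M\<^esub> u \<in> (\<lambda>a. a \<odot>\<^bsub>M\<^esub> x0) ` I"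
        using is_left_idealD(4)[OF I b(3,1)] by simp
    qed
    thus ?thesis using simple by (simp add: simple_left_module_def)
  qed
  have lA: "is_left_ideal A A" using is_subringD[OF A(1)] by (auto simp: is_left_ideal_def)
  have "x0 \<in> (\<lambda>a. a \<odot>\<^bsub>M\<^esub> x0) ` A"
    using smult_one[OF x0(1)] is_subringD(1)[OF A(1)] by (auto intro!: image_eqI[of _ _ 1])
  hence cyclic: "(\<lambda>a. a \<odot>\<^bsub>M\<^esub> x0) ` A = carrier M" using gen[OF lA] x0(2) by blast
  define L where "L = {a \<in> A. a \<odot>\<^bsub>M\<^esub> x0 = \<zero>\<^bsub>M\<^esub>}"
  have L: "is_left_ideal A L"
    unfolding is_left_ideal_def L_def
    using x0(1) smult_l_distr[of _ _ x0] smult_assoc[of _ _ x0] smult_l_null[of x0] smult_r_null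
    by auto
  \<comment> \<open>If all \<open>a * b\<close> lie in \<open>L\<close>, then \<open>a\<close> kills
    the whole cyclic module, and faithfulness forces \<open>a = 0\<close>.\<close>
  have right_ideal_L: "a = 0" if a: "a \<in> A" "\<And>b. b \<in> A \<Longrightarrow> a * b \<in> L" for a
  proof -
    have "a \<odot>\<^bsub>M\<^esub> x = \<zero>\<^bsub>M\<^esub>" if x: "x \<in> carrier M" for x
    proof -
      from x cyclic obtain b where b: "b \<in> A" "x = b \<odot>\<^bsub>M\<^esub> x0" by blast
      thus ?thesis using a(2)[OF b(1)] smult_assoc[of a b x0] a(1) x0(1) by (simp add: L_def)
    qed
    hence "a \<in> annihilator (subring_record A) M" using a(1) by (simp add: annihilator_def)
    thus ?thesis using ann by simp
  qed
  \<comment> \<open>Here \<open>b\<close> applied to \<open>x0\<close> plays the role of the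
    resolvent of \<open>z\<close> at \<open>u\<close> applied to \<open>x0\<close>.\<close>
  have "\<exists>b\<in>A. z * b \<in> A \<and> (z - u \<bullet> 1) * b - 1 \<in> L" for u
  proof -
    define I where "I = {(z - u \<bullet> 1) * b | b. b \<in> A \<and> z * b \<in> A}"
    have sc: "u \<bullet> b \<in> A" if "b \<in> A" for b using A(2) that by (rule lop.subspace_scale)
    have I: "is_left_ideal A I"
      unfolding is_left_ideal_def
    proof (intro conjI ballI)
      show "I \<subseteq> A" using sc by (auto simp: I_def left_diff_distrib)
      show "0 \<in> I" unfolding I_def by (rule CollectI, rule exI[of _ 0]) auto
    next
      fix x y assume "x \<in> I" "y \<in> I"
      then obtain b c where "b \<in> A" "z * b \<in> A" "c \<in> A" "z * c \<in> A" "x = (z - u \<bullet> 1) * b" "y = (z - u \<bullet> 1) * c"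
        by (auto simp: I_def)
      thus "x + y \<in> I" unfolding I_def by (intro CollectI exI[of _ "b + c"]) (auto simp: distrib_left)
    next
      fix a x assume a: "a \<in> A" and "x \<in> I"
      then obtain b where b: "b \<in> A" "z * b \<in> A" "x = (z - u \<bullet> 1) * b" by (auto simp: I_def)
      have *: "z * (a * b) = a * (z * b)" using z[OF a] by (simp add: mult.assoc[symmetric])
      hence "a * x = (z - u \<bullet> 1) * (a * b)" by (simp add: b algebra_simps)
      thus "a * x \<in> I" unfolding I_def using a b *
        by (intro CollectI exI[of _ "a * b"]) auto
    qed
    \<comment> \<open>Otherwise a suitable nonzero \<open>(z - u \<bullet> 1) * b\<close> would have
      all its right multiples in \<open>L\<close>, against faithfulness.\<close>
    have "(\<lambda>a. a \<odot>\<^bsub>M\<^esub> x0) ` I \<noteq> {\<zero>\<^bsub>M\<^esub>}"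
    proof
      assume zero: "(\<lambda>a. a \<odot>\<^bsub>M\<^esub> x0) ` I = {\<zero>\<^bsub>M\<^esub>}"
      obtain b where b: "b \<in> A" "\<And>i. i \<le> 1 \<Longrightarrow> z ^ i * b \<in> A" "poly_op z [:-u, 1:] * b \<noteq> 0"
        using nz[of "[:-u, 1:]" 1] by auto
      have zb: "z * b \<in> A" using b(2)[of 1] by simp
      have "(z - u \<bullet> 1) * b * c \<in> L" if c: "c \<in> A" for c
      proof -
        have "(z - u \<bullet> 1) * (b * c) \<in> I" unfolding I_def
          by (intro CollectI exI[of _ "b * c"]) (use b(1) c zb in \<open>auto simp: mult.assoc[symmetric]\<close>)
        thus ?thesis using zero is_left_idealD(1)[OF I] by (auto simp: L_def mult.assoc)
      qed
      moreover have "(z - u \<bullet> 1) * b \<in> A" using sc b(1) zb by (auto simp: left_diff_distrib)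
      ultimately have "(z - u \<bullet> 1) * b = 0" by (intro right_ideal_L)
      thus False using b(3) by (simp add: lop.scale_minus_left)
    qed
    hence "x0 \<in> (\<lambda>a. a \<odot>\<^bsub>M\<^esub> x0) ` I" using gen[OF I] x0(1) by blast
    then obtain a where a: "a \<in> I" "a \<odot>\<^bsub>M\<^esub> x0 = x0" by force
    have "a - 1 = a + (-1)" by simp
    moreover have "(-1) \<odot>\<^bsub>M\<^esub> x0 = \<ominus>\<^bsub>M\<^esub> x0"
    proof -
      have "\<ominus>\<^bsub>subring_record A\<^esub> 1 = - 1"
        using is_subringD[OF A(1)] by (intro R.minus_equality) auto
      thus ?thesis using smult_l_minus[of 1 x0] x0(1) is_subringD(1)[OF A(1)] smult_one[of x0] by simp
    qed
    ultimately have "(a - 1) \<odot>\<^bsub>M\<^esub> x0 = \<zero>\<^bsub>M\<^esub>"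
      using smult_l_distr[of a "-1" x0] a x0(1) is_left_idealD(1)[OF I a(1)] is_subringD[OF A(1)]
      by (simp add: M.r_neg)
    hence "a - 1 \<in> L" using is_left_idealD(1)[OF I a(1)] is_subringD[OF A(1)] by (auto simp: L_def)
    thus ?thesis using a(1) by (auto simp: I_def)
  qed
  then obtain f where f: "\<And>u. f u \<in> A" "\<And>u. z * f u \<in> A" "\<And>u. (z - u \<bullet> 1) * f u - 1 \<in> L" by metis
  \<comment> \<open>There is one resolvent for every complex number, but \<open>A\<close> has
    countable dimension.\<close>
  obtain E c u0 where E: "finite E" "(\<Sum>u\<in>E. c u \<bullet> f u) = 0" "u0 \<in> E" "c u0 \<noteq> 0"
    using uncountable_family_dependent[OF W(1), of f] f(1) W(2) by blast
  \<comment> \<open>The relation is brought over the common denominator \<open>P\<close>: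
    \<open>r u\<close> is \<open>P\<close> divided by the factor of \<open>u\<close>, and
    \<open>p\<close> is the resulting numerator. At \<open>u0\<close> only the summand of
    \<open>u0\<close> survives, hence \<open>p \<noteq> 0\<close>.\<close>
  define P where "P = (\<Prod>v\<in>E. [:-v, 1:])"
  define r where "r u = (\<Prod>v\<in>E - {u}. [:-v, 1:])" for u
  define p where "p = (\<Sum>u\<in>E. Polynomial.smult (c u) (r u))"
  have P: "P = [:-u, 1:] * r u" if "u \<in> E" for u
    unfolding P_def r_def using E(1) that by (rule prod.remove)
  have degr: "degree (r u) \<le> card E" for u
  proof -
    have "degree (r u) \<le> (\<Sum>v\<in>E - {u}. degree [:-v, 1:])"
      unfolding r_def using E(1) by (intro degree_prod_sum_le[unfolded comp_def]) auto
    also have "\<dots> \<le> card E" using E(1) by (simp add: card_mono)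
    finally show ?thesis .
  qed
  have "poly p u0 = (\<Sum>u\<in>E. if u = u0 then c u0 * poly (r u0) u0 else 0)"
    unfolding p_def poly_sum by (intro sum.cong refl) (use E in \<open>auto simp: r_def poly_prod\<close>)
  also have "\<dots> = c u0 * (\<Prod>v\<in>E - {u0}. u0 - v)" using E by (simp add: r_def poly_prod)
  also have "\<dots> \<noteq> 0" using E by auto
  finally have "p \<noteq> 0" by auto
  from nz[OF this, of "card E"] obtain b where
    b: "b \<in> A" "\<And>i. i \<le> card E \<Longrightarrow> z ^ i * b \<in> A" "poly_op z p * b \<noteq> 0" by blast
  have in_L: "poly_op z p * d \<in> L" if d: "d \<in> A" "\<And>i. i \<le> card E \<Longrightarrow> z ^ i * d \<in> A" for d
  proof -
    have rd: "poly_op z (r u) * d \<in> A" for u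
      using poly_op_mult_closed[OF A(2) d(2) degr z[OF d(1)]] .
    \<comment> \<open>Modulo \<open>L\<close>, the factor \<open>(z - u \<bullet> 1) * f u\<close>
      may be replaced by 1, and multiplying \<open>r u\<close> by the factor of \<open>u\<close>
      gives \<open>P\<close>. Summing over \<open>E\<close> leaves \<open>P\<close> times the
      vanishing combination of the \<open>f u\<close>.\<close>
    have "c u \<bullet> (poly_op z (r u) * d) - poly_op z P * d * (c u \<bullet> f u) \<in> L" if u: "u \<in> E" for u
    proof -
      have "(- (c u)) \<bullet> (poly_op z (r u) * d) \<in> A" using rd A(2) lop.subspace_scale by blast
      hence "((- (c u)) \<bullet> (poly_op z (r u) * d)) * ((z - u \<bullet> 1) * f u - 1) \<in> L"
        by (rule is_left_idealD(4)[OF L _ f(3)])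
      moreover have "poly_op z P = poly_op z (r u) * (z - u \<bullet> 1)"
        unfolding P[OF u] by (subst mult.commute) (simp only: poly_op_mult, simp add: lop.scale_minus_left)
      moreover have "(z - u \<bullet> 1) * d = d * (z - u \<bullet> 1)" using z[OF d(1)] by (simp add: algebra_simps)
      ultimately show ?thesis
        by (simp add: mult.assoc lop.scale_minus_left) (simp add: algebra_simps lop.scale_right_diff_distrib)
    qed
    hence "(\<Sum>u\<in>E. c u \<bullet> (poly_op z (r u) * d) - poly_op z P * d * (c u \<bullet> f u)) \<in> L"
      by (rule is_left_ideal_sum[OF L])
    moreover have "(\<Sum>u\<in>E. poly_op z P * d * (c u \<bullet> f u)) = 0"
      by (simp only: sum_distrib_left[symmetric] E(2)) simp
    moreover have "(\<Sum>u\<in>E. c u \<bullet> (poly_op z (r u) * d)) = poly_op z p * d"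
      by (simp add: p_def poly_op_sum poly_op_smult sum_distrib_right)
    ultimately show ?thesis by (simp only: sum_subtractf) simp
  qed
  \<comment> \<open>The previous step applies to every \<open>b * a\<close> as well, so all right
    multiples of \<open>poly_op z p * b\<close> lie in \<open>L\<close>.\<close>
  have "poly_op z p * b = 0"
  proof (rule right_ideal_L)
    show "poly_op z p * b \<in> A" using in_L[OF b(1,2)] is_left_idealD(1)[OF L] by blast
    fix a assume a: "a \<in> A"
    have "z ^ i * (b * a) \<in> A" if "i \<le> card E" for i
      using is_subringD(5)[OF A(1) b(2)[OF that] a] by (simp add: mult.assoc)
    from in_L[OF is_subringD(5)[OF A(1) b(1) a] this] show "poly_op z p * b * a \<in> L"
      by (simp add: mult.assoc)
  qed
  thus False using b(3) by contradiction
qed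

section \<open>The quantum torus\<close>

text \<open>
  The torus is realised by weighted translations of functions on the lattice of exponents, so that
  associativity is inherited from composition. The coefficient of an operator at \<open>a\<close> is read off
  from its value on the delta function at \<open>0\<close>.
\<close>

lift_definition wshift :: "('a::ab_group_add \<Rightarrow> complex) \<Rightarrow> 'a \<Rightarrow> 'a lop" is
  "\<lambda>s a g x. s (x - a) * g (x - a)"
  by (auto simp: algebra_simps)

lemma wshift_mult: "wshift s a * wshift t b = wshift (\<lambda>x. s (x + b) * t x) (a + b)"
  by transfer (auto simp: fun_eq_iff algebra_simps)

lemma wshift_scale: "c \<bullet> wshift s a = wshift (\<lambda>x. c * s x) a"
  by transfer (auto simp: fun_eq_iff)

lift_definition cf :: "'a::zero lop \<Rightarrow> 'a \<Rightarrow> complex" is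
  "\<lambda>f. f (\<lambda>x. if x = 0 then 1 else 0)" .

lemma cf_wshift: "cf (wshift s a) b = (if b = a then s 0 else 0)" for a b :: "'a::ab_group_add"
  by transfer auto

lemma cf_wshift_mult: "cf (wshift s a * f) b = s (b - a) * cf f (b - a)"
  by transfer auto

lemma cf_linear [simp]:
  "cf (f + g) a = cf f a + cf g a" "cf (f - g) a = cf f a - cf g a" "cf (c \<bullet> f) a = c * cf f a"
  "cf 0 a = 0" "cf (- f) a = - cf f a"
  by (transfer; simp)+

lemma cf_sum: "cf (sum f I) a = (\<Sum>i\<in>I. cf (f i) a)"
  by (induction I rule: infinite_finite_induct) auto

type_synonym weight = "nat \<times> nat \<Rightarrow> int"

locale qtorus =
  fixes q :: complex and m n :: nat
  assumes q0: "q \<noteq> 0" and nonroot: "\<And>k :: nat. k > 0 \<Longrightarrow> q ^ k \<noteq> 1"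
begin

lemma q_powi_inj: "q powi i = q powi j \<longleftrightarrow> i = j"
proof
  have pos: "q powi i \<noteq> 1" if "i > 0" for i
    using nonroot[of "nat i"] that by (simp add: power_int_def)
  assume "q powi i = q powi j"
  hence "q powi (i - j) = 1" "q powi (j - i) = 1" using q0 by (auto simp: power_int_diff)
  thus "i = j" using pos[of "i - j"] pos[of "j - i"] by linarith
qed simp

section \<open>Exponents, the cocycle and the commutation form\<close>

definition box :: "(nat \<times> nat) set" where "box = {1..m} \<times> {1..n}"

lemma finite_box [simp]: "finite box" by (simp add: box_def)

text \<open>Matrix of a one-sided cocycle whose antisymmetrisation is the commutation form. Half of
  the skew form would also be a cocycle, but would require a square root of
  \<open>q\<close>.\<close>

definition bx :: "nat \<times> nat \<Rightarrow> nat \<times> nat \<Rightarrow> int" where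
  "bx x y = of_bool (fst x = fst y \<and> snd x < snd y \<or> snd x = snd y \<and> fst x < fst y)"

definition phi :: "weight \<Rightarrow> weight \<Rightarrow> int" where
  "phi a b = (\<Sum>x\<in>box. \<Sum>y\<in>box. bx x y * a x * b y)"

definition skew :: "weight \<Rightarrow> weight \<Rightarrow> int" where "skew a b = phi a b - phi b a"

lemma phi_add: "phi (a + b) c = phi a c + phi b c" "phi a (b + c) = phi a b + phi a c"
  by (simp_all add: phi_def sum.distrib algebra_simps)

lemma phi_uminus: "phi (- a) c = - phi a c" "phi a (- c) = - phi a c"
  by (simp_all add: phi_def sum_negf)

lemma phi_diff: "phi (a - b) c = phi a c - phi b c" "phi a (b - c) = phi a b - phi a c"
  using phi_add(1)[of a "- b" c] phi_add(2)[of a b "- c"] by (simp_all add: phi_uminus)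

lemma phi_zero [simp]: "phi 0 c = 0" "phi c 0 = 0"
  by (simp_all add: phi_def)

lemma skew_add: "skew (a + b) c = skew a c + skew b c" "skew a (b + c) = skew a b + skew a c"
  by (simp_all add: skew_def phi_add)

lemma skew_uminus: "skew (- a) c = - skew a c" "skew a (- c) = - skew a c"
  by (simp_all add: skew_def phi_uminus)

lemma skew_zero [simp]: "skew 0 c = 0" "skew c 0 = 0"
  by (simp_all add: skew_def)

lemma skew_diff: "skew (a - b) c = skew a c - skew b c" "skew a (b - c) = skew a b - skew a c"
  by (simp_all add: skew_def phi_diff)

text \<open>Left regular representation of the twisted group algebra: \<open>T a\<close> sends the
  delta function at \<open>x\<close> to \<open>q powi phi a x\<close> times the delta function at
  \<open>a + x\<close>.\<close>

definition T :: "weight \<Rightarrow> weight lop" where "T a = wshift (\<lambda>x. q powi phi a x) a"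

lemma T_mult: "T a * T b = q powi phi a b \<bullet> T (a + b)"
  by (simp add: T_def wshift_mult wshift_scale phi_add power_int_add q0 mult_ac)

lemma T_0 [simp]: "T 0 = 1"
proof -
  have "wshift (\<lambda>x. 1) (0 :: weight) = 1" by transfer simp
  thus ?thesis by (simp add: T_def)
qed

lemma T_commute: "T a * T b = q powi skew a b \<bullet> (T b * T a)"
  by (simp add: T_mult skew_def add.commute power_int_diff q0)

lemma cf_T: "cf (T a) b = (if b = a then 1 else 0)"
  by (simp add: T_def cf_wshift)

lemma cf_T_mult: "cf (T a * f) b = q powi phi a (b - a) * cf f (b - a)"
  by (simp add: T_def cf_wshift_mult)

definition Lam :: "weight set" where "Lam = {a. \<forall>x. x \<notin> box \<longrightarrow> a x = 0}"

lemma Lam_closed: "0 \<in> Lam" "a \<in> Lam \<Longrightarrow> b \<in> Lam \<Longrightarrow> a + b \<in> Lam" "a \<in> Lam \<Longrightarrow> - a \<in> Lam"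
   "a \<in> Lam \<Longrightarrow> b \<in> Lam \<Longrightarrow> a - b \<in> Lam"
  by (auto simp: Lam_def)

definition QT :: "weight lop set" where "QT = lop.span (T ` Lam)"

lemma T_in_QT: "a \<in> Lam \<Longrightarrow> T a \<in> QT"
  unfolding QT_def by (rule lop.span_base) simp

lemma QT_subspace: "lop.subspace QT" unfolding QT_def by (rule lop.subspace_span)

lemma QT_induct [consumes 1, case_names zero add]:
  assumes "f \<in> QT" "P 0" "\<And>c a f. a \<in> Lam \<Longrightarrow> f \<in> QT \<Longrightarrow> P f \<Longrightarrow> P (c \<bullet> T a + f)"
  shows "P f"
proof -
  have "f \<in> QT \<and> P f"
    using assms(1)[unfolded QT_def]
  proof (induction rule: lop.span_induct_alt)
    case base
    thus ?case using assms(2) by (simp add: QT_def lop.span_zero)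
  next
    case (step c x y)
    then obtain a where a: "a \<in> Lam" "x = T a" by auto
    hence "c \<bullet> x + y \<in> QT"
      using step lop.span_superset[of "T ` Lam"] unfolding QT_def
      by (intro lop.span_add lop.span_scale) auto
    thus ?case using assms(3) a step by auto
  qed
  thus ?thesis ..
qed

lemma QT_linear:
  "0 \<in> QT" "f \<in> QT \<Longrightarrow> g \<in> QT \<Longrightarrow> f + g \<in> QT" "f \<in> QT \<Longrightarrow> g \<in> QT \<Longrightarrow> f - g \<in> QT" "f \<in> QT \<Longrightarrow> c \<bullet> f \<in> QT"
  using QT_subspace lop.subspace_0 lop.subspace_add lop.subspace_diff lop.subspace_scale by auto

text \<open>An operator in \<open>QT\<close> is determined by its value on a single delta function,
  so \<open>cf\<close> loses no information there.\<close>

lemma QT_expand: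
  assumes "f \<in> QT"
  shows "finite {a. cf f a \<noteq> 0} \<and> {a. cf f a \<noteq> 0} \<subseteq> Lam \<and> f = (\<Sum>a | cf f a \<noteq> 0. cf f a \<bullet> T a)"
proof -
  have "\<exists>S r. finite S \<and> S \<subseteq> Lam \<and> f = (\<Sum>a\<in>S. r a \<bullet> T a)"
    using assms
  proof (induction rule: QT_induct)
    case zero
    show ?case by (rule exI[of _ "{}"]) auto
  next
    case (add c a f)
    then obtain S r where S: "finite S" "S \<subseteq> Lam" "f = (\<Sum>a\<in>S. r a \<bullet> T a)" by auto
    define r' where "r' = (\<lambda>b. (if b = a then c else 0) + (if b \<in> S then r b else 0))"
    have "(\<Sum>b\<in>insert a S. r' b \<bullet> T b) = (\<Sum>b\<in>insert a S. if b = a then c \<bullet> T b else 0) + (\<Sum>b\<in>insert a S. if b \<in> S then r b \<bullet> T b else 0)"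
      unfolding sum.distrib[symmetric] r'_def by (intro sum.cong refl) (auto simp: lop.scale_left_distrib)
    also have "(\<Sum>b\<in>insert a S. if b = a then c \<bullet> T b else 0) = c \<bullet> T a" using S(1) by simp
    also have "(\<Sum>b\<in>insert a S. if b \<in> S then r b \<bullet> T b else 0) = f"
      unfolding S(3) using S(1) by (intro sum.mono_neutral_cong_right) auto
    finally show ?case using S(1,2) add(1) by (intro exI[of _ "insert a S"] exI[of _ r']) auto
  qed
  then obtain S r where S: "finite S" "S \<subseteq> Lam" "f = (\<Sum>a\<in>S. r a \<bullet> T a)" by auto
  have cf: "cf f b = (if b \<in> S then r b else 0)" for b
    unfolding S(3) cf_sum using S(1) by (simp add: cf_T if_distrib[of "\<lambda>x. _ * x"] cong: if_cong)
  have sub: "{a. cf f a \<noteq> 0} \<subseteq> S" by (auto simp: cf split: if_splits)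
  have "f = (\<Sum>a | cf f a \<noteq> 0. cf f a \<bullet> T a)"
    by (subst S(3), rule sum.mono_neutral_cong_right) (use S(1) sub in \<open>auto simp: cf\<close>)
  thus ?thesis using sub S(1,2) finite_subset by blast
qed

lemma finite_supp: "f \<in> QT \<Longrightarrow> finite {a. cf f a \<noteq> 0}"
  using QT_expand by blast

lemma supp_Lam: "f \<in> QT \<Longrightarrow> cf f a \<noteq> 0 \<Longrightarrow> a \<in> Lam"
  using QT_expand[of f] by blast

lemma QT_eq_0: "f \<in> QT \<Longrightarrow> (\<And>a. cf f a = 0) \<Longrightarrow> f = 0"
  using QT_expand[of f] by simp

lemma T_mult_QT:
  assumes "a \<in> Lam" "f \<in> QT"
  shows "T a * f \<in> QT"
  using assms(2)
proof (induction rule: QT_induct)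
  case (add c b f)
  have "T (a + b) \<in> QT" using assms(1) add(1) by (intro T_in_QT Lam_closed)
  thus ?case using add by (simp add: distrib_left T_mult QT_linear)
qed (simp add: QT_linear)

lemma QT_mult:
  assumes "f \<in> QT" "g \<in> QT"
  shows "f * g \<in> QT"
  using assms(1)
  by (induction rule: QT_induct) (auto simp: distrib_right QT_linear T_mult_QT assms(2))

lemma cf_mult_T:
  assumes "f \<in> QT"
  shows "cf (f * T a) b = q powi phi (b - a) a * cf f (b - a)"
proof -
  define x where "x = b - a"
  have "cf (f * T a) b = q powi phi x a * cf f x"
    using assms
  proof (induction rule: QT_induct)
    case (add c d f)
    have "cf (T d * T a) b = q powi phi x a * cf (T d) x"
      by (auto simp: T_mult cf_T x_def)
    thus ?case using add by (simp add: distrib_right distrib_left)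
  qed simp
  thus ?thesis by (simp add: x_def)
qed

lemma cf_mult:
  assumes "f \<in> QT"
  shows "cf (f * g) b = (\<Sum>a | cf f a \<noteq> 0. cf f a * q powi phi a (b - a) * cf g (b - a))"
proof -
  have "f * g = (\<Sum>a | cf f a \<noteq> 0. cf f a \<bullet> (T a * g))"
    by (subst QT_expand[OF assms, THEN conjunct2, THEN conjunct2]) (simp add: sum_distrib_right)
  thus ?thesis by (simp add: cf_sum cf_T_mult mult_ac)
qed

text \<open>Any additive functional that separates \<open>T (e (i, a))\<close> from the other terms of the path sums would do.\<close>

definition ht :: "weight \<Rightarrow> int" where "ht a = (\<Sum>x\<in>box. int (fst x * snd x) * a x)"

lemma ht_add: "ht (a + b) = ht a + ht b" "ht (a - b) = ht a - ht b"
  by (simp_all add: ht_def sum.distrib sum_subtractf algebra_simps)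

text \<open>Different exponents can have equal height, so a leading exponent is required to beat all
  others strictly.\<close>

definition lead :: "weight lop \<Rightarrow> weight \<Rightarrow> bool" where
  "lead f a \<longleftrightarrow> f \<in> QT \<and> cf f a \<noteq> 0 \<and> (\<forall>b. cf f b \<noteq> 0 \<longrightarrow> b = a \<or> ht b < ht a)"

lemma lead_T: "a \<in> Lam \<Longrightarrow> lead (T a) a"
  by (auto simp: lead_def T_in_QT cf_T)

text \<open>Heights add, so \<open>a + b\<close> arises only from the pair of leading exponents and
  nothing can cancel it.\<close>

lemma lead_mult:
  assumes f: "lead f a" and g: "lead g b"
  shows "lead (f * g) (a + b)"
proof -
  have fg: "f \<in> QT" "g \<in> QT" using f g by (auto simp: lead_def)
  note cm = cf_mult[OF fg(1), of g]
  have le: "cf f x \<noteq> 0 \<Longrightarrow> ht x \<le> ht a" "cf g x \<noteq> 0 \<Longrightarrow> ht x \<le> ht b" for x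
    using f g by (force simp: lead_def)+
  have "cf (f * g) (a + b) = (\<Sum>x\<in>{a}. cf f x * q powi phi x (a + b - x) * cf g (a + b - x))"
    unfolding cm
  proof (rule sum.mono_neutral_right)
    show "\<forall>x\<in>{x. cf f x \<noteq> 0} - {a}. cf f x * q powi phi x (a + b - x) * cf g (a + b - x) = 0"
    proof
      fix x assume "x \<in> {x. cf f x \<noteq> 0} - {a}"
      hence "ht x < ht a" using f by (auto simp: lead_def)
      hence "cf g (a + b - x) = 0" using le(2)[of "a + b - x"] by (auto simp: ht_add)
      thus "cf f x * q powi phi x (a + b - x) * cf g (a + b - x) = 0" by simp
    qed
  qed (use f finite_supp[OF fg(1)] in \<open>auto simp: lead_def\<close>)
  also have "\<dots> \<noteq> 0" using f g q0 by (simp add: lead_def)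
  finally have 1: "cf (f * g) (a + b) \<noteq> 0" .
  have "x = a + b \<or> ht x < ht (a + b)" if "cf (f * g) x \<noteq> 0" for x
  proof -
    from that obtain y where y: "cf f y \<noteq> 0" "cf g (x - y) \<noteq> 0"
      unfolding cm by (force elim: sum.not_neutral_contains_not_neutral)
    hence "y = a \<or> ht y < ht a" "x - y = b \<or> ht (x - y) < ht b" using f g by (auto simp: lead_def)
    thus ?thesis by (auto simp: ht_add)
  qed
  thus ?thesis using 1 QT_mult[OF fg] by (auto simp: lead_def)
qed

text \<open>Among the terms with nonzero coefficient take one whose leading exponent has maximal
  height. Other terms may reach that height, but only at their own, different leading exponent, so
  its coefficient cannot cancel.\<close>

lemma lead_independent:
  assumes S: "finite S" and f: "\<And>i. i \<in> S \<Longrightarrow> lead (f i) (a i)" and inj: "inj_on a S"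
    and zero: "(\<Sum>i\<in>S. c i \<bullet> f i) = 0"
  shows "\<forall>i\<in>S. c i = 0"
proof (rule ccontr)
  assume "\<not> ?thesis"
  hence "{i\<in>S. c i \<noteq> 0} \<noteq> {}" by auto
  then obtain i0 where i0: "i0 \<in> S" "c i0 \<noteq> 0" "\<And>i. i \<in> S \<Longrightarrow> c i \<noteq> 0 \<Longrightarrow> ht (a i) \<le> ht (a i0)"
    using S finite_has_maximal[of "(\<lambda>i. ht (a i)) ` {i\<in>S. c i \<noteq> 0}"]
    by (smt (verit, best) finite_imageI finite_subset imageE imageI image_is_empty mem_Collect_eq subsetI)
  have "0 = (\<Sum>i\<in>S. c i * cf (f i) (a i0))"
    using arg_cong[OF zero, of "\<lambda>f. cf f (a i0)"] by (simp add: cf_sum)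
  also have "\<dots> = (\<Sum>i\<in>{i0}. c i * cf (f i) (a i0))"
  proof (rule sum.mono_neutral_right)
    show "\<forall>i\<in>S - {i0}. c i * cf (f i) (a i0) = 0"
    proof
      fix i assume i: "i \<in> S - {i0}"
      hence "a i \<noteq> a i0" using inj i0(1) by (auto simp: inj_on_def)
      thus "c i * cf (f i) (a i0) = 0"
        using f[of i] i i0(3)[of i] by (force simp: lead_def)
    qed
  qed (use S i0 in auto)
  finally show False using i0 f[of i0] by (simp add: lead_def)
qed

end

section \<open>Adding a row to a quantum matrix\<close>

text \<open>Reduces identities between linear combinations of operators to identities in
  \<open>complex\<close>, where powers of \<open>q\<close> can be cancelled by field
  arithmetic.\<close>

lemma lop_eqI: "(\<And>g x. Rep_lop f g x = Rep_lop h g x) \<Longrightarrow> f = h"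
  by (metis Rep_lop_inject ext)

lemma Rep_lop_simps:
  "Rep_lop (f + h) g x = Rep_lop f g x + Rep_lop h g x"
  "Rep_lop (f - h) g x = Rep_lop f g x - Rep_lop h g x"
  "Rep_lop (- f) g x = - Rep_lop f g x"
  "Rep_lop (c \<bullet> f) g x = c * Rep_lop f g x"
  by (transfer; simp)+

text \<open>Makes a commutation rule applicable inside right-nested products, so that the simplifier
  can order monomials.\<close>

lemma commute_assoc:
  fixes a b x :: "'a lop"
  assumes "a * b = c \<bullet> (b * a)"
  shows "a * (b * x) = c \<bullet> (b * (a * x))"
  by (metis assms mult.assoc scl_mult_left)

definition qm_relations :: "complex \<Rightarrow> nat \<Rightarrow> nat \<Rightarrow> (nat \<Rightarrow> nat \<Rightarrow> 'a lop) \<Rightarrow> bool" where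
  "qm_relations q k n Y \<longleftrightarrow>
    (\<forall>i\<in>{1..k}. \<forall>\<alpha>\<in>{1..n}. \<forall>\<beta>\<in>{1..n}. \<alpha> < \<beta> \<longrightarrow> Y i \<beta> * Y i \<alpha> = inverse q \<bullet> (Y i \<alpha> * Y i \<beta>)) \<and>
    (\<forall>i\<in>{1..k}. \<forall>j\<in>{1..k}. \<forall>\<alpha>\<in>{1..n}. i < j \<longrightarrow> Y j \<alpha> * Y i \<alpha> = inverse q \<bullet> (Y i \<alpha> * Y j \<alpha>)) \<and>
    (\<forall>i\<in>{1..k}. \<forall>j\<in>{1..k}. \<forall>\<alpha>\<in>{1..n}. \<forall>\<beta>\<in>{1..n}. i < j \<longrightarrow> \<beta> < \<alpha> \<longrightarrow> Y j \<beta> * Y i \<alpha> = Y i \<alpha> * Y j \<beta>) \<and>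
    (\<forall>i\<in>{1..k}. \<forall>j\<in>{1..k}. \<forall>\<alpha>\<in>{1..n}. \<forall>\<beta>\<in>{1..n}. i < j \<longrightarrow> \<alpha> < \<beta> \<longrightarrow>
       Y j \<beta> * Y i \<alpha> = Y i \<alpha> * Y j \<beta> - (q - inverse q) \<bullet> (Y i \<beta> * Y j \<alpha>))"

lemma qm_relationsD:
  assumes "qm_relations q k n Y"
  shows "i \<in> {1..k} \<Longrightarrow> \<alpha> \<in> {1..n} \<Longrightarrow> \<beta> \<in> {1..n} \<Longrightarrow> \<alpha> < \<beta> \<Longrightarrow>
      Y i \<beta> * Y i \<alpha> = inverse q \<bullet> (Y i \<alpha> * Y i \<beta>)"
    and "i \<in> {1..k} \<Longrightarrow> j \<in> {1..k} \<Longrightarrow> \<alpha> \<in> {1..n} \<Longrightarrow> i < j \<Longrightarrow>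
      Y j \<alpha> * Y i \<alpha> = inverse q \<bullet> (Y i \<alpha> * Y j \<alpha>)"
    and "i \<in> {1..k} \<Longrightarrow> j \<in> {1..k} \<Longrightarrow> \<alpha> \<in> {1..n} \<Longrightarrow> \<beta> \<in> {1..n} \<Longrightarrow> i < j \<Longrightarrow> \<beta> < \<alpha> \<Longrightarrow>
      Y j \<beta> * Y i \<alpha> = Y i \<alpha> * Y j \<beta>"
    and "i \<in> {1..k} \<Longrightarrow> j \<in> {1..k} \<Longrightarrow> \<alpha> \<in> {1..n} \<Longrightarrow> \<beta> \<in> {1..n} \<Longrightarrow> i < j \<Longrightarrow> \<alpha> < \<beta> \<Longrightarrow>
      Y j \<beta> * Y i \<alpha> = Y i \<alpha> * Y j \<beta> - (q - inverse q) \<bullet> (Y i \<beta> * Y j \<alpha>)"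
  using assms by (auto simp: qm_relations_def)

text \<open>The new row \<open>t\<close> lies below \<open>X\<close>, and \<open>t \<beta>\<close>
  fails to commute only with the entries of \<open>X\<close> in its own column. The correction term
  of the diagonal relation is thus not assumed between \<open>t\<close> and \<open>X\<close>; the
  sums in \<open>Y\<close> produce it.\<close>

locale add_row =
  fixes q :: complex and k n :: nat and X :: "nat \<Rightarrow> nat \<Rightarrow> 'a lop" and t s :: "nat \<Rightarrow> 'a lop"
  assumes q0: "q \<noteq> 0"
    and X: "qm_relations q k n X"
    and ts: "\<And>\<alpha>. t \<alpha> * s \<alpha> = 1" "\<And>\<alpha>. s \<alpha> * t \<alpha> = 1"
    and tt: "\<And>\<alpha> \<beta>. 1 \<le> \<alpha> \<Longrightarrow> \<alpha> < \<beta> \<Longrightarrow> \<beta> \<le> n \<Longrightarrow> t \<beta> * t \<alpha> = inverse q \<bullet> (t \<alpha> * t \<beta>)"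
    and tX: "\<And>i \<alpha> \<beta>. i \<in> {1..k} \<Longrightarrow> \<alpha> \<in> {1..n} \<Longrightarrow> \<beta> \<in> {1..n} \<Longrightarrow>
               t \<beta> * X i \<alpha> = (if \<alpha> = \<beta> then inverse q else 1) \<bullet> (X i \<alpha> * t \<beta>)"
begin

lemmas X_same_row = qm_relationsD(1)[OF X]
  and X_same_column = qm_relationsD(2)[OF X]
  and X_antidiagonal = qm_relationsD(3)[OF X]
  and X_diagonal = qm_relationsD(4)[OF X]

lemma inverse_commute:
  assumes "t \<alpha> * x = c \<bullet> (x * t \<alpha>)" "c \<noteq> 0"
  shows "s \<alpha> * x = inverse c \<bullet> (x * s \<alpha>)"
proof -
  have "s \<alpha> * (t \<alpha> * x) * s \<alpha> = c \<bullet> (s \<alpha> * x * (t \<alpha> * s \<alpha>))"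
    by (simp add: assms(1) mult.assoc)
  hence "x * s \<alpha> = c \<bullet> (s \<alpha> * x)" by (simp add: mult.assoc[symmetric] ts)
  thus ?thesis using assms(2) by simp
qed

lemma sX: "i \<in> {1..k} \<Longrightarrow> \<alpha> \<in> {1..n} \<Longrightarrow> \<beta> \<in> {1..n} \<Longrightarrow>
    s \<beta> * X i \<alpha> = (if \<alpha> = \<beta> then q else 1) \<bullet> (X i \<alpha> * s \<beta>)"
  using inverse_commute[OF tX, of i \<alpha> \<beta>] q0 by auto

lemma t_commute: "\<alpha> \<in> {1..n} \<Longrightarrow> \<beta> \<in> {1..n} \<Longrightarrow> \<alpha> \<noteq> \<beta> \<Longrightarrow>
    t \<beta> * t \<alpha> = (if \<alpha> < \<beta> then inverse q else q) \<bullet> (t \<alpha> * t \<beta>)"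
  using tt[of \<alpha> \<beta>] tt[of \<beta> \<alpha>] q0 by auto

lemma st: "\<alpha> \<in> {1..n} \<Longrightarrow> \<beta> \<in> {1..n} \<Longrightarrow> \<alpha> \<noteq> \<beta> \<Longrightarrow>
    s \<beta> * t \<alpha> = (if \<alpha> < \<beta> then q else inverse q) \<bullet> (t \<alpha> * s \<beta>)"
  using inverse_commute[OF t_commute, of \<alpha> \<beta>] q0 by (auto split: if_splits)

lemma ts_commute: "\<alpha> \<in> {1..n} \<Longrightarrow> \<beta> \<in> {1..n} \<Longrightarrow> \<alpha> \<noteq> \<beta> \<Longrightarrow>
    t \<alpha> * s \<beta> = (if \<alpha> < \<beta> then inverse q else q) \<bullet> (s \<beta> * t \<alpha>)"
  using st[of \<alpha> \<beta>] q0 by auto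

lemma ss: "\<alpha> \<in> {1..n} \<Longrightarrow> \<beta> \<in> {1..n} \<Longrightarrow> \<alpha> < \<beta> \<Longrightarrow> s \<beta> * s \<alpha> = inverse q \<bullet> (s \<alpha> * s \<beta>)"
  using inverse_commute[OF ts_commute, of \<alpha> \<beta>] q0 by auto

definition u :: "nat \<Rightarrow> nat \<Rightarrow> 'a lop" where "u i \<beta> = X i \<beta> * s \<beta>"

lemma u_mult:
  assumes "i \<in> {1..k}" "j \<in> {1..k}" "\<alpha> \<in> {1..n}" "\<beta> \<in> {1..n}"
  shows "u i \<alpha> * u j \<beta> = (if \<alpha> = \<beta> then q else 1) \<bullet> (X i \<alpha> * X j \<beta> * (s \<alpha> * s \<beta>))"
  using sX[OF assms(2,4,3), THEN commute_assoc, of "s \<beta>"] by (auto simp: u_def mult.assoc)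

lemma t_u:
  assumes "i \<in> {1..k}" "\<gamma> \<in> {1..n}" "\<beta> \<in> {1..n}"
  shows "t \<gamma> * u i \<beta> = (if \<gamma> \<le> \<beta> then inverse q else q) \<bullet> (u i \<beta> * t \<gamma>)"
proof -
  have "t \<gamma> * u i \<beta> = (if \<beta> = \<gamma> then inverse q else 1) \<bullet> (X i \<beta> * (t \<gamma> * s \<beta>))"
    using commute_assoc[OF tX[OF assms(1,3,2)], of "s \<beta>"] by (simp add: u_def)
  thus ?thesis
    using ts_commute[of \<gamma> \<beta>] assms by (cases "\<gamma> = \<beta>") (auto simp: u_def ts mult.assoc)
qed

lemma u_same_row:
  assumes "i \<in> {1..k}" "\<alpha> \<in> {1..n}" "\<beta> \<in> {1..n}" "\<alpha> < \<beta>"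
  shows "u i \<beta> * u i \<alpha> = (inverse q * inverse q) \<bullet> (u i \<alpha> * u i \<beta>)"
  using assms by (simp add: u_mult X_same_row ss)

lemma u_same_column:
  assumes "i \<in> {1..k}" "j \<in> {1..k}" "\<alpha> \<in> {1..n}" "i < j"
  shows "u j \<alpha> * u i \<alpha> = inverse q \<bullet> (u i \<alpha> * u j \<alpha>)"
  using assms by (simp add: u_mult X_same_column)

lemma u_antidiagonal:
  assumes "i \<in> {1..k}" "j \<in> {1..k}" "\<alpha> \<in> {1..n}" "\<beta> \<in> {1..n}" "i < j" "\<beta> < \<alpha>"
  shows "u j \<beta> * u i \<alpha> = q \<bullet> (u i \<alpha> * u j \<beta>)"
  using assms q0 ss[of \<beta> \<alpha>] by (simp add: u_mult X_antidiagonal)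

lemma u_diagonal:
  assumes "i \<in> {1..k}" "j \<in> {1..k}" "\<alpha> \<in> {1..n}" "\<beta> \<in> {1..n}" "i < j" "\<alpha> < \<beta>"
  shows "u j \<beta> * u i \<alpha> = inverse q \<bullet> (u i \<alpha> * u j \<beta>) - (q - inverse q) \<bullet> (u i \<beta> * u j \<alpha>)"
  using assms q0 ss[of \<alpha> \<beta>]
  by (simp add: u_mult X_diagonal left_diff_distrib lop.scale_right_diff_distrib mult_ac)

text \<open>Sums over blocks of columns. By bilinearity, two blocks with one entirely to the left of
  the other obey the relations of single entries; \<open>Y\<close> uses the tails
  \<open>{\<alpha>..n}\<close>.\<close>

definition W :: "nat \<Rightarrow> nat set \<Rightarrow> 'a lop" where "W i P = (\<Sum>\<beta>\<in>P. u i \<beta>)"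

lemma W_mult: "W i P * W j Q = (\<Sum>\<alpha>\<in>P. \<Sum>\<beta>\<in>Q. u i \<alpha> * u j \<beta>)"
  by (simp add: W_def sum_product)

lemma W_mult': "W i P * W j Q = (\<Sum>\<beta>\<in>Q. \<Sum>\<alpha>\<in>P. u i \<alpha> * u j \<beta>)"
  unfolding W_mult by (rule sum.swap)

lemma t_W:
  assumes "i \<in> {1..k}" "\<gamma> \<in> {1..n}" "P \<subseteq> {1..n}"
  shows "(\<And>\<beta>. \<beta> \<in> P \<Longrightarrow> \<gamma> \<le> \<beta>) \<Longrightarrow> t \<gamma> * W i P = inverse q \<bullet> (W i P * t \<gamma>)"
    "(\<And>\<beta>. \<beta> \<in> P \<Longrightarrow> \<beta> < \<gamma>) \<Longrightarrow> t \<gamma> * W i P = q \<bullet> (W i P * t \<gamma>)"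
  unfolding W_def sum_distrib_left sum_distrib_right lop.scale_sum_right
  by (intro sum.cong refl; use assms t_u[of i \<gamma>] in force)+

lemma W_same_row:
  assumes "i \<in> {1..k}" "P \<subseteq> {1..n}" "Q \<subseteq> {1..n}" "\<And>\<alpha> \<beta>. \<alpha> \<in> P \<Longrightarrow> \<beta> \<in> Q \<Longrightarrow> \<alpha> < \<beta>"
  shows "W i Q * W i P = (inverse q * inverse q) \<bullet> (W i P * W i Q)"
  unfolding W_mult[of i P] W_mult'[of i Q] lop.scale_sum_right
  by (intro sum.cong refl u_same_row) (use assms in auto)

lemma W_antidiagonal:
  assumes "i \<in> {1..k}" "j \<in> {1..k}" "i < j" "P \<subseteq> {1..n}" "Q \<subseteq> {1..n}" "\<And>\<alpha> \<beta>. \<alpha> \<in> P \<Longrightarrow> \<beta> \<in> Q \<Longrightarrow> \<alpha> < \<beta>"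
  shows "W j P * W i Q = q \<bullet> (W i Q * W j P)"
  unfolding W_mult[of j P] W_mult'[of i Q] lop.scale_sum_right
  by (intro sum.cong refl u_antidiagonal) (use assms in auto)

lemma W_diagonal:
  assumes "i \<in> {1..k}" "j \<in> {1..k}" "i < j" "P \<subseteq> {1..n}" "Q \<subseteq> {1..n}" "\<And>\<alpha> \<beta>. \<alpha> \<in> P \<Longrightarrow> \<beta> \<in> Q \<Longrightarrow> \<alpha> < \<beta>"
  shows "W j Q * W i P = inverse q \<bullet> (W i P * W j Q) - (q - inverse q) \<bullet> (W i Q * W j P)"
  unfolding W_mult[of j Q] W_mult[of i Q] W_mult'[of i P] lop.scale_sum_right sum_subtractf[symmetric]
  by (intro sum.cong refl u_diagonal) (use assms in auto)

lemma W_insert: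
  assumes "\<alpha> \<le> n"
  shows "W i {\<alpha>..n} = W i {\<alpha>} + W i {Suc \<alpha>..n}"
proof -
  have "{\<alpha>..n} = insert \<alpha> {Suc \<alpha>..n}" using assms by auto
  thus ?thesis by (simp add: W_def)
qed

lemma W_split:
  assumes "\<alpha> \<le> \<beta>" "\<beta> \<le> n"
  shows "W i {\<alpha>..n} = W i {\<alpha>..<\<beta>} + W i {\<beta>..n}"
proof -
  have "{\<alpha>..n} = {\<alpha>..<\<beta>} \<union> {\<beta>..n}" using assms by auto
  thus ?thesis unfolding W_def by (simp only:) (subst sum.union_disjoint, auto)
qed

text \<open>Split off the first column of the tail. The antidiagonal and diagonal rules together
  give the mixed product \<open>W i {Suc \<alpha>..n} * W j {\<alpha>}\<close> the coefficient
  \<open>q - (q - inverse q) = inverse q\<close>, so a tail behaves like a single entry.\<close>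

lemma W_same_column:
  assumes "i \<in> {1..k}" "j \<in> {1..k}" "i < j" "1 \<le> \<alpha>"
  shows "W j {\<alpha>..n} * W i {\<alpha>..n} = inverse q \<bullet> (W i {\<alpha>..n} * W j {\<alpha>..n})"
  using assms(4)
proof (induction "Suc n - \<alpha>" arbitrary: \<alpha>)
  case 0
  thus ?case by (simp add: W_def)
next
  case (Suc d)
  hence \<alpha>: "\<alpha> \<in> {1..n}" by auto
  have IH: "W j {Suc \<alpha>..n} * W i {Suc \<alpha>..n} = inverse q \<bullet> (W i {Suc \<alpha>..n} * W j {Suc \<alpha>..n})"
    using Suc by auto
  have 1: "W j {\<alpha>} * W i {\<alpha>} = inverse q \<bullet> (W i {\<alpha>} * W j {\<alpha>})"
    using u_same_column[OF assms(1,2) \<alpha> assms(3)] by (simp add: W_def)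
  have 2: "W j {\<alpha>} * W i {Suc \<alpha>..n} = q \<bullet> (W i {Suc \<alpha>..n} * W j {\<alpha>})"
    by (rule W_antidiagonal) (use assms \<alpha> in auto)
  have 3: "W j {Suc \<alpha>..n} * W i {\<alpha>} = inverse q \<bullet> (W i {\<alpha>} * W j {Suc \<alpha>..n}) - (q - inverse q) \<bullet> (W i {Suc \<alpha>..n} * W j {\<alpha>})"
    by (rule W_diagonal) (use assms \<alpha> in auto)
  have "\<alpha> \<le> n" using \<alpha> by simp
  show ?case unfolding W_insert[OF \<open>\<alpha> \<le> n\<close>] distrib_left distrib_right IH 1 2 3
    by (rule lop_eqI) (simp add: Rep_lop_simps algebra_simps)
qed

text \<open>For \<open>i \<le> k\<close> this is a sum over columns
  \<open>\<beta> \<ge> \<alpha>\<close>: paths that arrive from \<open>X i \<beta>\<close> and then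
  run along the new row from column \<open>\<beta>\<close> to column \<open>\<alpha>\<close>, with
  weight \<open>s \<beta> * t \<alpha>\<close>.\<close>

definition Y :: "nat \<Rightarrow> nat \<Rightarrow> 'a lop" where
  "Y i \<alpha> = (if i \<le> k then W i {\<alpha>..n} * t \<alpha> else t \<alpha>)"

text \<open>The tail of the smaller column is split at the larger one. The pieces and the
  \<open>t\<close> commute up to powers of \<open>q\<close>, so both sides can be brought to the
  same order and compared; the later relations follow the same pattern.\<close>

lemma Y_same_row:
  assumes i: "i \<in> {1..k}" and \<alpha>: "\<alpha> \<in> {1..n}" "\<beta> \<in> {1..n}" "\<alpha> < \<beta>"
  shows "Y i \<beta> * Y i \<alpha> = inverse q \<bullet> (Y i \<alpha> * Y i \<beta>)"
proof -
  let ?V = "W i {\<alpha>..<\<beta>}" and ?W = "W i {\<beta>..n}"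
  have a: "W i {\<alpha>..n} = ?V + ?W" using W_split[of \<alpha> \<beta> i] \<alpha> by simp
  have r: "?W * ?V = (inverse q * inverse q) \<bullet> (?V * ?W)"
    by (rule W_same_row) (use i \<alpha> in auto)
  have t: "t \<beta> * ?V = q \<bullet> (?V * t \<beta>)" "t \<beta> * ?W = inverse q \<bullet> (?W * t \<beta>)"
    "t \<alpha> * ?W = inverse q \<bullet> (?W * t \<alpha>)"
    by (rule t_W; use i \<alpha> in auto)+
  have tab: "t \<beta> * t \<alpha> = inverse q \<bullet> (t \<alpha> * t \<beta>)" using \<alpha> tt by auto
  show ?thesis using i
    by (simp add: Y_def a distrib_left distrib_right mult.assoc
          r[THEN commute_assoc] t[THEN commute_assoc] tab[THEN commute_assoc] tab)
       (rule lop_eqI, simp add: Rep_lop_simps field_simps q0)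
qed

lemma Y_same_column:
  assumes i: "i \<in> {1..k}" "j \<in> {1..k}" "i < j" and \<alpha>: "\<alpha> \<in> {1..n}"
  shows "Y j \<alpha> * Y i \<alpha> = inverse q \<bullet> (Y i \<alpha> * Y j \<alpha>)"
proof -
  let ?W = "\<lambda>i. W i {\<alpha>..n}"
  have r: "?W j * ?W i = inverse q \<bullet> (?W i * ?W j)"
    by (rule W_same_column) (use i \<alpha> in auto)
  have t: "t \<alpha> * ?W i = inverse q \<bullet> (?W i * t \<alpha>)" "t \<alpha> * ?W j = inverse q \<bullet> (?W j * t \<alpha>)"
    by (rule t_W; use i \<alpha> in auto)+
  show ?thesis using i
    by (simp add: Y_def mult.assoc r[THEN commute_assoc] t[THEN commute_assoc])
qed

lemma Y_antidiagonal:
  assumes i: "i \<in> {1..k}" "j \<in> {1..k}" "i < j" and \<alpha>: "\<alpha> \<in> {1..n}" "\<beta> \<in> {1..n}" "\<beta> < \<alpha>"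
  shows "Y j \<beta> * Y i \<alpha> = Y i \<alpha> * Y j \<beta>"
proof -
  let ?V = "\<lambda>i. W i {\<beta>..<\<alpha>}" and ?W = "\<lambda>i. W i {\<alpha>..n}"
  have a: "W j {\<beta>..n} = ?V j + ?W j" using W_split[of \<beta> \<alpha> j] \<alpha> by simp
  have r: "?W j * ?W i = inverse q \<bullet> (?W i * ?W j)"
    by (rule W_same_column) (use i \<alpha> in auto)
  have r': "?V j * ?W i = q \<bullet> (?W i * ?V j)"
    by (rule W_antidiagonal) (use i \<alpha> in auto)
  have t: "t \<beta> * ?W i = inverse q \<bullet> (?W i * t \<beta>)" "t \<alpha> * ?W j = inverse q \<bullet> (?W j * t \<alpha>)"
    "t \<alpha> * ?V j = q \<bullet> (?V j * t \<alpha>)"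
    by (rule t_W; use i \<alpha> in auto)+
  have tab: "t \<alpha> * t \<beta> = inverse q \<bullet> (t \<beta> * t \<alpha>)" using \<alpha> tt by auto
  show ?thesis using i
    by (simp add: Y_def a distrib_left distrib_right mult.assoc
          r[THEN commute_assoc] r'[THEN commute_assoc] t[THEN commute_assoc] tab[THEN commute_assoc] tab)
qed

text \<open>With \<open>t \<beta> * t \<alpha>\<close> moved to the right, the products
  \<open>V i * W j\<close>, \<open>W i * V j\<close> and \<open>W i * W j\<close> of the local
  pieces can be compared separately. For the last one the identity is
  \<open>q^-2 = 1 - (q - q^-1) q^-1\<close>.\<close>

lemma Y_diagonal:
  assumes i: "i \<in> {1..k}" "j \<in> {1..k}" "i < j" and \<alpha>: "\<alpha> \<in> {1..n}" "\<beta> \<in> {1..n}" "\<alpha> < \<beta>"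
  shows "Y j \<beta> * Y i \<alpha> = Y i \<alpha> * Y j \<beta> - (q - inverse q) \<bullet> (Y i \<beta> * Y j \<alpha>)"
proof -
  let ?V = "\<lambda>i. W i {\<alpha>..<\<beta>}" and ?W = "\<lambda>i. W i {\<beta>..n}"
  have a: "W i {\<alpha>..n} = ?V i + ?W i" for i using W_split[of \<alpha> \<beta> i] \<alpha> by simp
  have r: "?W j * ?W i = inverse q \<bullet> (?W i * ?W j)"
    by (rule W_same_column) (use i \<alpha> in auto)
  have r': "?W j * ?V i = inverse q \<bullet> (?V i * ?W j) - (q - inverse q) \<bullet> (?W i * ?V j)"
    by (rule W_diagonal) (use i \<alpha> in auto)
  have r'': "?W j * (?V i * x) = inverse q \<bullet> (?V i * (?W j * x)) - (q - inverse q) \<bullet> (?W i * (?V j * x))" for x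
    using arg_cong[OF r', of "\<lambda>y. y * x"] by (simp add: left_diff_distrib mult.assoc)
  have t: "t \<beta> * ?W i = inverse q \<bullet> (?W i * t \<beta>)" "t \<alpha> * ?W j = inverse q \<bullet> (?W j * t \<alpha>)"
    "t \<beta> * ?W j = inverse q \<bullet> (?W j * t \<beta>)"
    "t \<beta> * ?V i = q \<bullet> (?V i * t \<beta>)" "t \<beta> * ?V j = q \<bullet> (?V j * t \<beta>)"
    by (rule t_W; use i \<alpha> in auto)+
  have tab: "t \<beta> * t \<alpha> = inverse q \<bullet> (t \<alpha> * t \<beta>)" using \<alpha> tt by auto
  show ?thesis using i
    by (simp add: Y_def a distrib_left distrib_right mult.assoc
          r[THEN commute_assoc] r'' t[THEN commute_assoc] tab[THEN commute_assoc] tab)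
       (rule lop_eqI, simp add: Rep_lop_simps field_simps q0)
qed

lemma relations_Y: "qm_relations q (Suc k) n Y"
proof -
  have c: "t \<alpha> * Y i \<alpha> = inverse q \<bullet> (Y i \<alpha> * t \<alpha>)"
    if "i \<in> {1..k}" "\<alpha> \<in> {1..n}" for i \<alpha>
  proof -
    have "t \<alpha> * W i {\<alpha>..n} = inverse q \<bullet> (W i {\<alpha>..n} * t \<alpha>)" by (rule t_W) (use that in auto)
    thus ?thesis using that by (simp add: Y_def mult.assoc commute_assoc)
  qed
  have a: "t \<beta> * Y i \<alpha> = Y i \<alpha> * t \<beta>"
    if "i \<in> {1..k}" "\<alpha> \<in> {1..n}" "\<beta> \<in> {1..n}" "\<beta> < \<alpha>" for i \<alpha> \<beta>
  proof -
    have "t \<beta> * W i {\<alpha>..n} = inverse q \<bullet> (W i {\<alpha>..n} * t \<beta>)" by (rule t_W) (use that in auto)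
    moreover have "t \<alpha> * t \<beta> = inverse q \<bullet> (t \<beta> * t \<alpha>)" using that tt by auto
    ultimately show ?thesis using that by (simp add: Y_def mult.assoc commute_assoc)
  qed
  have d: "t \<beta> * Y i \<alpha> = Y i \<alpha> * t \<beta> - (q - inverse q) \<bullet> (Y i \<beta> * t \<alpha>)"
    if "i \<in> {1..k}" "\<alpha> \<in> {1..n}" "\<beta> \<in> {1..n}" "\<alpha> < \<beta>" for i \<alpha> \<beta>
  proof -
    let ?V = "W i {\<alpha>..<\<beta>}" and ?W = "W i {\<beta>..n}"
    have a: "W i {\<alpha>..n} = ?V + ?W" using W_split[of \<alpha> \<beta> i] that by simp
    \<comment> \<open>The two pieces of the tail pick up opposite powers of \<open>q\<close>; this
      discrepancy is the source of the correction term.\<close>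
    have t: "t \<beta> * ?V = q \<bullet> (?V * t \<beta>)" "t \<beta> * ?W = inverse q \<bullet> (?W * t \<beta>)"
      by (rule t_W; use that in auto)+
    have tab: "t \<beta> * t \<alpha> = inverse q \<bullet> (t \<alpha> * t \<beta>)" using that tt by auto
    show ?thesis using that
      by (simp add: Y_def a distrib_left distrib_right mult.assoc t[THEN commute_assoc] tab)
         (rule lop_eqI, simp add: Rep_lop_simps field_simps q0)
  qed
  have last: "Y (Suc k) \<alpha> = t \<alpha>" for \<alpha> by (simp add: Y_def)
  have rows: "i \<in> {1..k} \<or> i = Suc k" if "i \<in> {1..Suc k}" for i using that by auto
  show ?thesis
    unfolding qm_relations_def
  proof (intro conjI ballI impI)
    fix i \<alpha> \<beta> assume *: "i \<in> {1..Suc k}" "\<alpha> \<in> {1..n}" "\<beta> \<in> {1..n}" "\<alpha> < \<beta>"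
    show "Y i \<beta> * Y i \<alpha> = inverse q \<bullet> (Y i \<alpha> * Y i \<beta>)"
      using rows[OF *(1)] Y_same_row[OF _ *(2-4)] tt[of \<alpha> \<beta>] * last by auto
  next
    fix i j \<alpha> assume *: "i \<in> {1..Suc k}" "j \<in> {1..Suc k}" "\<alpha> \<in> {1..n}" "i < j"
    show "Y j \<alpha> * Y i \<alpha> = inverse q \<bullet> (Y i \<alpha> * Y j \<alpha>)"
      using rows[OF *(2)] Y_same_column[OF _ _ *(4,3)] c[of i \<alpha>] * last by auto
  next
    fix i j \<alpha> \<beta> assume *: "i \<in> {1..Suc k}" "j \<in> {1..Suc k}" "\<alpha> \<in> {1..n}" "\<beta> \<in> {1..n}" "i < j" "\<beta> < \<alpha>"
    show "Y j \<beta> * Y i \<alpha> = Y i \<alpha> * Y j \<beta>"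
      using rows[OF *(2)] Y_antidiagonal[OF _ _ *(5,3,4,6)] a[OF _ *(3,4,6), of i] * last by auto
  next
    fix i j \<alpha> \<beta> assume *: "i \<in> {1..Suc k}" "j \<in> {1..Suc k}" "\<alpha> \<in> {1..n}" "\<beta> \<in> {1..n}" "i < j" "\<alpha> < \<beta>"
    show "Y j \<beta> * Y i \<alpha> = Y i \<alpha> * Y j \<beta> - (q - inverse q) \<bullet> (Y i \<beta> * Y j \<alpha>)"
      using rows[OF *(2)] Y_diagonal[OF _ _ *(5,3,4,6)] d[OF _ *(3,4,6), of i] * last by auto
  qed
qed

end

section \<open>The path matrix in the quantum torus\<close>

lemma span_mult_closed:
  assumes "\<And>x y. x \<in> S \<Longrightarrow> y \<in> S \<Longrightarrow> x * y \<in> lop.span S" "f \<in> lop.span S" "g \<in> lop.span S"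
  shows "f * g \<in> lop.span S"
  using assms(2)
proof (induction rule: lop.span_induct_alt)
  case (step c x y)
  have "x * g \<in> lop.span S"
    using assms(3)
  proof (induction rule: lop.span_induct_alt)
    case (step d z w)
    thus ?case using assms(1)[OF \<open>x \<in> S\<close> step(1)]
      by (simp add: distrib_left lop.span_add lop.span_scale)
  qed (simp add: lop.span_zero)
  thus ?case using step by (simp add: distrib_right lop.span_add lop.span_scale)
qed (simp add: lop.span_zero)

context qtorus
begin

definition e :: "nat \<times> nat \<Rightarrow> weight" where "e x = (\<lambda>y. if y = x then 1 else 0)"

lemma e_Lam: "x \<in> box \<Longrightarrow> e x \<in> Lam" by (auto simp: Lam_def e_def)

lemma phi_e: "phi (e x) (e y) = (if x \<in> box \<and> y \<in> box then bx x y else 0)"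
proof -
  have "phi (e x) (e y) = (\<Sum>z\<in>box. \<Sum>w\<in>box. if w = y then if z = x then bx x y else 0 else 0)"
    unfolding phi_def by (intro sum.cong refl) (auto simp: e_def)
  also have "\<dots> = (\<Sum>z\<in>box. if z = x then if y \<in> box then bx x y else 0 else 0)"
    by (intro sum.cong refl) auto
  also have "\<dots> = (if x \<in> box \<and> y \<in> box then bx x y else 0)" by (simp add: sum.delta)
  finally show ?thesis .
qed

lemma ht_e: "x \<in> box \<Longrightarrow> ht (e x) = int (fst x * snd x)"
  unfolding ht_def e_def by (subst sum.mono_neutral_cong_right[of _ "{x}"]) auto

lemma skew_e: "x \<in> box \<Longrightarrow> y \<in> box \<Longrightarrow> skew (e x) (e y) = bx x y - bx y x"
  by (simp add: skew_def phi_e)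

lemma T_e_inverse: "T (e x) * T (- e x) = 1" "T (- e x) * T (e x) = 1"
  by (auto simp: T_mult phi_uminus phi_e bx_def)

text \<open>The path matrix of the first \<open>k\<close> rows: one step is \<open>add_row.Y\<close>
  with the generators of row \<open>Suc k\<close> as new row.\<close>

primrec pm :: "nat \<Rightarrow> nat \<Rightarrow> nat \<Rightarrow> weight lop" where
  "pm 0 i \<alpha> = 0"
| "pm (Suc k) i \<alpha> =
     (if i \<le> k then (\<Sum>\<beta>=\<alpha>..n. pm k i \<beta> * T (- e (Suc k, \<beta>))) * T (e (Suc k, \<alpha>)) else T (e (Suc k, \<alpha>)))"

lemma T_row_commute:
  assumes "l \<in> {1..m}" "\<alpha> \<in> {1..n}" "\<beta> \<in> {1..n}" "\<alpha> < \<beta>"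
  shows "T (e (l, \<beta>)) * T (e (l, \<alpha>)) = inverse q \<bullet> (T (e (l, \<alpha>)) * T (e (l, \<beta>)))"
proof -
  have "skew (e (l, \<beta>)) (e (l, \<alpha>)) = -1" using assms by (subst skew_e) (auto simp: box_def bx_def)
  thus ?thesis using T_commute[of "e (l, \<beta>)" "e (l, \<alpha>)"] by (simp add: power_int_minus)
qed

text \<open>Each summand combines an entry of column \<open>\<gamma>\<close> with the inverse
  generator of the same column. Their commutation factors with \<open>T (e (l, \<beta>))\<close>
  cancel, so only the final factor \<open>T (e (Suc k, \<alpha>))\<close> contributes.\<close>

lemma T_pm_commute:
  assumes "l \<in> {Suc k..m}" "i \<in> {1..k}" "\<alpha> \<in> {1..n}" "\<beta> \<in> {1..n}"
  shows "T (e (l, \<beta>)) * pm k i \<alpha> = (if \<alpha> = \<beta> then inverse q else 1) \<bullet> (pm k i \<alpha> * T (e (l, \<beta>)))"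
  using assms
proof (induction k arbitrary: \<alpha>)
  case (Suc k)
  have box: "(l, \<gamma>) \<in> box" "(Suc k, \<gamma>) \<in> box" if "\<gamma> \<in> {1..n}" for \<gamma>
    using that Suc.prems by (auto simp: box_def)
  have sk: "skew (e (l, \<beta>)) (e (Suc k, \<gamma>)) = (if \<gamma> = \<beta> then -1 else 0)" if "\<gamma> \<in> {1..n}" for \<gamma>
    using Suc.prems box that by (auto simp: skew_e bx_def)
  have t: "T (e (l, \<beta>)) * T (e (Suc k, \<gamma>)) = (if \<gamma> = \<beta> then inverse q else 1) \<bullet> (T (e (Suc k, \<gamma>)) * T (e (l, \<beta>)))"
    "T (e (l, \<beta>)) * T (- e (Suc k, \<gamma>)) = (if \<gamma> = \<beta> then q else 1) \<bullet> (T (- e (Suc k, \<gamma>)) * T (e (l, \<beta>)))"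
    if "\<gamma> \<in> {1..n}" for \<gamma>
    using T_commute[of "e (l, \<beta>)" "e (Suc k, \<gamma>)"] T_commute[of "e (l, \<beta>)" "- e (Suc k, \<gamma>)"] sk[OF that]
    by (auto simp: skew_uminus power_int_minus)
  show ?case
  proof (cases "i = Suc k")
    case True
    thus ?thesis using t(1)[of \<alpha>] Suc.prems by simp
  next
    case False
    hence i: "i \<in> {1..k}" using Suc.prems by auto
    have "T (e (l, \<beta>)) * (pm k i \<gamma> * T (- e (Suc k, \<gamma>))) = pm k i \<gamma> * T (- e (Suc k, \<gamma>)) * T (e (l, \<beta>))"
      if \<gamma>: "\<gamma> \<in> {1..n}" for \<gamma>
    proof -
      have IH: "T (e (l, \<beta>)) * pm k i \<gamma> = (if \<gamma> = \<beta> then inverse q else 1) \<bullet> (pm k i \<gamma> * T (e (l, \<beta>)))"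
        by (rule Suc.IH) (use Suc.prems i \<gamma> in auto)
      show ?thesis using q0
        by (simp only: commute_assoc[OF IH] t(2)[OF \<gamma>]) (auto simp: mult.assoc)
    qed
    hence "T (e (l, \<beta>)) * (\<Sum>\<gamma>=\<alpha>..n. pm k i \<gamma> * T (- e (Suc k, \<gamma>))) =
        (\<Sum>\<gamma>=\<alpha>..n. pm k i \<gamma> * T (- e (Suc k, \<gamma>))) * T (e (l, \<beta>))"
      unfolding sum_distrib_left sum_distrib_right using Suc.prems by (intro sum.cong refl) auto
    hence c: "T (e (l, \<beta>)) * (\<Sum>\<gamma>=\<alpha>..n. pm k i \<gamma> * T (- e (Suc k, \<gamma>))) =
        1 \<bullet> ((\<Sum>\<gamma>=\<alpha>..n. pm k i \<gamma> * T (- e (Suc k, \<gamma>))) * T (e (l, \<beta>)))" by simp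
    show ?thesis using i t(1)[of \<alpha>] Suc.prems by (simp add: commute_assoc[OF c] mult.assoc)
  qed
qed simp

lemma pm_add_row:
  assumes "Suc k \<le> m" "qm_relations q k n (pm k)"
  shows "add_row q k n (pm k) (\<lambda>\<alpha>. T (e (Suc k, \<alpha>))) (\<lambda>\<alpha>. T (- e (Suc k, \<alpha>)))"
proof
  fix \<alpha> \<beta> :: nat assume "1 \<le> \<alpha>" "\<alpha> < \<beta>" "\<beta> \<le> n"
  thus "T (e (Suc k, \<beta>)) * T (e (Suc k, \<alpha>)) = inverse q \<bullet> (T (e (Suc k, \<alpha>)) * T (e (Suc k, \<beta>)))"
    using assms(1) by (intro T_row_commute) auto
next
  fix i \<alpha> \<beta> assume "i \<in> {1..k}" "\<alpha> \<in> {1..n}" "\<beta> \<in> {1..n}"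
  thus "T (e (Suc k, \<beta>)) * pm k i \<alpha> = (if \<alpha> = \<beta> then inverse q else 1) \<bullet> (pm k i \<alpha> * T (e (Suc k, \<beta>)))"
    using assms(1) by (intro T_pm_commute) auto
qed (use q0 assms T_e_inverse in auto)

lemma pm_relations: "k \<le> m \<Longrightarrow> qm_relations q k n (pm k)"
proof (induction k)
  case 0
  show ?case by (simp add: qm_relations_def)
next
  case (Suc k)
  interpret R: add_row q k n "pm k" "\<lambda>\<alpha>. T (e (Suc k, \<alpha>))" "\<lambda>\<alpha>. T (- e (Suc k, \<alpha>))"
    by (rule pm_add_row) (use Suc in auto)
  have "R.Y = pm (Suc k)" by (auto simp: fun_eq_iff R.Y_def R.W_def R.u_def)
  thus ?case using R.relations_Y by (simp only:)
qed

lemma lead_add: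
  assumes "lead f a" "g \<in> QT" "\<And>b. cf g b \<noteq> 0 \<Longrightarrow> ht b < ht a"
  shows "lead (f + g) a"
proof -
  have "cf g a = 0" using assms(3)[of a] by auto
  thus ?thesis using assms unfolding lead_def by (auto simp: QT_linear) (metis add.left_neutral)+
qed

text \<open>In the summand \<open>\<gamma> = \<alpha>\<close> the two generators of the new row
  cancel, which keeps the old leading exponent; all other summands lose height.\<close>

lemma lead_pm:
  assumes "k \<le> m" "i \<in> {1..k}" "\<alpha> \<in> {1..n}"
  shows "lead (pm k i \<alpha>) (e (i, \<alpha>))"
  using assms
proof (induction k arbitrary: \<alpha>)
  case (Suc k)
  have box: "(i, \<gamma>) \<in> box" "(Suc k, \<gamma>) \<in> box" if "\<gamma> \<in> {1..n}" for \<gamma>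
    using that Suc.prems by (auto simp: box_def)
  show ?case
  proof (cases "i = Suc k")
    case True
    thus ?thesis using box[OF Suc.prems(3)] by (auto intro!: lead_T e_Lam)
  next
    case False
    hence i: "i \<in> {1..k}" using Suc.prems by auto
    define f where "f \<gamma> = pm k i \<gamma> * T (- e (Suc k, \<gamma>)) * T (e (Suc k, \<alpha>))" for \<gamma>
    have f: "lead (f \<gamma>) (e (i, \<gamma>) + (- e (Suc k, \<gamma>)) + e (Suc k, \<alpha>))" if "\<gamma> \<in> {1..n}" for \<gamma>
      unfolding f_def using that Suc.prems i box
      by (intro lead_mult lead_T Suc.IH Lam_closed(3) e_Lam) auto
    have "pm (Suc k) i \<alpha> = (\<Sum>\<gamma>=\<alpha>..n. f \<gamma>)" using i by (simp add: f_def sum_distrib_right)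
    also have "{\<alpha>..n} = insert \<alpha> {Suc \<alpha>..n}" using Suc.prems by auto
    finally have pm: "pm (Suc k) i \<alpha> = f \<alpha> + (\<Sum>\<gamma>=Suc \<alpha>..n. f \<gamma>)" by simp
    show ?thesis unfolding pm
    proof (rule lead_add)
      show "lead (f \<alpha>) (e (i, \<alpha>))" using f[OF Suc.prems(3)] by simp
      show "sum f {Suc \<alpha>..n} \<in> QT"
        by (rule lop.subspace_sum[OF QT_subspace]) (use f Suc.prems in \<open>auto simp: lead_def\<close>)
    next
      fix b assume "cf (sum f {Suc \<alpha>..n}) b \<noteq> 0"
      then obtain \<gamma> where \<gamma>: "\<gamma> \<in> {Suc \<alpha>..n}" "cf (f \<gamma>) b \<noteq> 0"
        unfolding cf_sum by (rule sum.not_neutral_contains_not_neutral)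
      hence \<gamma>': "\<gamma> \<in> {1..n}" by auto
      have "ht b \<le> ht (e (i, \<gamma>) + (- e (Suc k, \<gamma>)) + e (Suc k, \<alpha>))"
        using f[OF \<gamma>'] \<gamma>(2) by (force simp: lead_def)
      also have "\<dots> = int i * int \<gamma> - int (Suc k) * int \<gamma> + int (Suc k) * int \<alpha>"
        using box[OF \<gamma>'] box[OF Suc.prems(3)] by (simp add: ht_add ht_e algebra_simps)
      \<comment> \<open>The loss of height is a product of two positive differences, because
        \<open>i < Suc k\<close> and \<open>\<alpha> < \<gamma>\<close>.\<close>
      also have "\<dots> = int i * int \<alpha> - (int (Suc k) - int i) * (int \<gamma> - int \<alpha>)" by (simp add: algebra_simps)
      also have "\<dots> < int i * int \<alpha>" using \<gamma>(1) i by simp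
      also have "\<dots> = ht (e (i, \<alpha>))" using box[OF Suc.prems(3)] by (simp add: ht_e)
      finally show "ht b < ht (e (i, \<alpha>))" .
    qed
  qed
qed simp

section \<open>The algebras generated by the path matrices\<close>

definition wd :: "nat \<Rightarrow> (nat \<times> nat) list \<Rightarrow> weight lop" where
  "wd k w = prod_list (map (\<lambda>x. pm k (fst x) (snd x)) w)"

lemma wd_simps [simp]: "wd k [] = 1" "wd k (x # w) = pm k (fst x) (snd x) * wd k w" "wd k (u @ v) = wd k u * wd k v"
  by (simp_all add: wd_def)

definition Alg :: "nat \<Rightarrow> weight lop set" where
  "Alg k = lop.span (wd k ` lists ({1..k} \<times> {1..n}))"

lemma Alg_subspace: "lop.subspace (Alg k)" by (simp add: Alg_def)

lemma Alg_linear: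
  "0 \<in> Alg k" "f \<in> Alg k \<Longrightarrow> g \<in> Alg k \<Longrightarrow> f + g \<in> Alg k" "f \<in> Alg k \<Longrightarrow> g \<in> Alg k \<Longrightarrow> f - g \<in> Alg k" "f \<in> Alg k \<Longrightarrow> c \<bullet> f \<in> Alg k"
  using Alg_subspace[of k] lop.subspace_0 lop.subspace_add lop.subspace_diff lop.subspace_scale by auto

lemma wd_Alg: "w \<in> lists ({1..k} \<times> {1..n}) \<Longrightarrow> wd k w \<in> Alg k"
  unfolding Alg_def by (rule lop.span_base) simp

lemma one_Alg: "1 \<in> Alg k" using wd_Alg[of "[]" k] by simp

lemma pm_Alg: "i \<in> {1..k} \<Longrightarrow> \<alpha> \<in> {1..n} \<Longrightarrow> pm k i \<alpha> \<in> Alg k"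
  using wd_Alg[of "[(i, \<alpha>)]" k] by simp

lemma Alg_mult: "f \<in> Alg k \<Longrightarrow> g \<in> Alg k \<Longrightarrow> f * g \<in> Alg k"
  unfolding Alg_def
proof (rule span_mult_closed)
  fix x y assume "x \<in> wd k ` lists ({1..k} \<times> {1..n})" "y \<in> wd k ` lists ({1..k} \<times> {1..n})"
  then obtain u v where "u \<in> lists ({1..k} \<times> {1..n})" "v \<in> lists ({1..k} \<times> {1..n})" "x = wd k u" "y = wd k v"
    by auto
  hence "x * y = wd k (u @ v)" "u @ v \<in> lists ({1..k} \<times> {1..n})" by auto
  thus "x * y \<in> lop.span (wd k ` lists ({1..k} \<times> {1..n}))" by (metis imageI lop.span_base)
qed

lemma Alg_subring: "is_subring (Alg k)"
  unfolding is_subring_def using one_Alg Alg_linear Alg_mult by auto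

text \<open>Leading exponents add along a word and forget the order of its letters, so they can
  separate sorted words.\<close>

lemma lead_wd:
  assumes "k \<le> m" "w \<in> lists ({1..k} \<times> {1..n})"
  shows "lead (wd k w) (\<lambda>x. int (count_list w x))"
  using assms(2)
proof (induction w)
  case Nil
  have "(\<lambda>x. int (count_list [] x)) = (0 :: weight)" by (simp add: fun_eq_iff)
  moreover have "lead (wd k []) 0" using lead_T[OF Lam_closed(1)] by simp
  ultimately show ?case by metis
next
  case (Cons x w)
  have "(\<lambda>y. int (count_list (x # w) y)) = e x + (\<lambda>y. int (count_list w y))"
    by (auto simp: fun_eq_iff e_def)
  thus ?case using Cons lead_pm[OF assms(1), of "fst x" "snd x"] by (auto intro!: lead_mult)
qed

lemma Alg_QT: "k \<le> m \<Longrightarrow> Alg k \<subseteq> QT"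
  unfolding Alg_def using lead_wd QT_subspace by (intro lop.span_minimal) (auto simp: lead_def)

text \<open>The product is the 2 by 2 quantum minor of \<open>pm (Suc k)\<close> on rows
  \<open>i\<close>, \<open>Suc k\<close> and columns \<open>\<alpha>\<close>,
  \<open>Suc \<alpha>\<close>: the term subtracted with factor \<open>q\<close> removes everything
  but the first summand of the path sum.\<close>

lemma pm_T_next:
  assumes k: "Suc k \<le> m" and i: "i \<in> {1..k}" and \<alpha>: "1 \<le> \<alpha>" "\<alpha> < n"
  shows "pm k i \<alpha> * T (e (Suc k, Suc \<alpha>)) \<in> Alg (Suc k)"
proof -
  interpret R: add_row q k n "pm k" "\<lambda>\<alpha>. T (e (Suc k, \<alpha>))" "\<lambda>\<alpha>. T (- e (Suc k, \<alpha>))"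
    by (rule pm_add_row) (use k pm_relations in auto)
  have Y: "R.Y = pm (Suc k)" by (auto simp: fun_eq_iff R.Y_def R.W_def R.u_def)
  let ?t = "\<lambda>\<alpha>. T (e (Suc k, \<alpha>))"
  have t: "?t \<gamma> \<in> Alg (Suc k)" if "\<gamma> \<in> {1..n}" for \<gamma>
    using pm_Alg[of "Suc k" "Suc k" \<gamma>] that by simp
  have "R.W i {\<alpha>..n} * ?t \<alpha> = pm k i \<alpha> + R.W i {Suc \<alpha>..n} * ?t \<alpha>"
    using \<alpha> T_e_inverse by (simp add: R.W_insert distrib_right) (simp add: R.W_def R.u_def mult.assoc)
  hence "pm k i \<alpha> * ?t (Suc \<alpha>) = pm (Suc k) i \<alpha> * ?t (Suc \<alpha>) - R.W i {Suc \<alpha>..n} * (?t \<alpha> * ?t (Suc \<alpha>))"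
    using i by (simp add: Y[symmetric] R.Y_def algebra_simps)
  also have "?t \<alpha> * ?t (Suc \<alpha>) = q \<bullet> (?t (Suc \<alpha>) * ?t \<alpha>)"
    using R.tt[of \<alpha> "Suc \<alpha>"] \<alpha> q0 by simp
  also have "R.W i {Suc \<alpha>..n} * (q \<bullet> (?t (Suc \<alpha>) * ?t \<alpha>)) = q \<bullet> (pm (Suc k) i (Suc \<alpha>) * ?t \<alpha>)"
    using i by (simp add: Y[symmetric] R.Y_def mult.assoc)
  also have "pm (Suc k) i \<alpha> * ?t (Suc \<alpha>) - q \<bullet> (pm (Suc k) i (Suc \<alpha>) * ?t \<alpha>) \<in> Alg (Suc k)"
    using i \<alpha> by (intro Alg_linear Alg_mult t pm_Alg) auto
  finally show ?thesis .
qed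

lemma T_wd_commute:
  assumes k: "Suc k \<le> m" and \<beta>: "\<beta> \<in> {1..n}" and w: "w \<in> lists ({1..k} \<times> {1..n})"
  shows "\<exists>c. c \<noteq> 0 \<and> T (e (Suc k, \<beta>)) * wd k w = c \<bullet> (wd k w * T (e (Suc k, \<beta>)))"
  using w
proof (induction w)
  case Nil
  show ?case by (rule exI[of _ 1]) simp
next
  case (Cons x w)
  then obtain c where c: "c \<noteq> 0" "T (e (Suc k, \<beta>)) * wd k w = c \<bullet> (wd k w * T (e (Suc k, \<beta>)))" by auto
  define d where "d = (if snd x = \<beta> then inverse q else 1)"
  have "T (e (Suc k, \<beta>)) * pm k (fst x) (snd x) = d \<bullet> (pm k (fst x) (snd x) * T (e (Suc k, \<beta>)))"
    unfolding d_def by (rule T_pm_commute) (use Cons k \<beta> in auto)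
  from commute_assoc[OF this, of "wd k w"]
  have "T (e (Suc k, \<beta>)) * wd k (x # w) = (d * c) \<bullet> (wd k (x # w) * T (e (Suc k, \<beta>)))"
    by (simp add: c(2) mult.assoc)
  moreover have "d * c \<noteq> 0" using c(1) q0 by (simp add: d_def)
  ultimately show ?case by blast
qed

lemma T_add_Alg: "T a \<in> Alg k \<Longrightarrow> T b \<in> Alg k \<Longrightarrow> T (a + b) \<in> Alg k"
proof -
  assume "T a \<in> Alg k" "T b \<in> Alg k"
  hence "q powi (- phi a b) \<bullet> (T a * T b) \<in> Alg k" by (intro Alg_linear Alg_mult)
  thus ?thesis by (simp add: T_mult power_int_minus q0)
qed

definition row_weights :: "nat \<Rightarrow> weight set" where
  "row_weights k = {a. \<forall>x. a x \<noteq> 0 \<longrightarrow> fst x = k \<and> x \<in> box}"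

lemma row_weights_add: "a \<in> row_weights k \<Longrightarrow> b \<in> row_weights k \<Longrightarrow> a + b \<in> row_weights k"
  by (auto simp: row_weights_def) (metis add.left_neutral)+

text \<open>A letter in a column \<open>\<alpha> < n\<close> is completed to a quantum minor by one
  generator of the new row, which passes the rest of the word up to a nonzero scalar. Hence
  \<open>Alg k\<close> lies in the localisation of \<open>Alg (Suc k)\<close> at monomials of the
  new row.\<close>

lemma clear_denominator_wd:
  assumes k: "Suc k \<le> m" and w: "w \<in> lists ({1..k} \<times> {1..n})"
  shows "\<exists>a \<in> row_weights (Suc k). T a \<in> Alg (Suc k) \<and> wd k w * T a \<in> Alg (Suc k)"
  using w
proof (induction w)
  case Nil
  have "\<exists>a \<in> row_weights (Suc k). T a \<in> Alg (Suc k) \<and> wd k [] * T a \<in> Alg (Suc k)"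
    by (rule bexI[of _ 0]) (auto simp: one_Alg row_weights_def)
  thus ?case .
next
  case (Cons x w)
  then obtain a where a: "a \<in> row_weights (Suc k)" "T a \<in> Alg (Suc k)" "wd k w * T a \<in> Alg (Suc k)" by auto
  obtain i \<alpha> where x: "x = (i, \<alpha>)" "i \<in> {1..k}" "\<alpha> \<in> {1..n}" using Cons by (cases x) auto
  show ?case
  proof (cases "\<alpha> = n")
    case True
    \<comment> \<open>In the last column the path sum has a single term, whose two generators of the
      new row cancel.\<close>
    have "pm (Suc k) i n = pm k i n" using x by (simp add: mult.assoc T_e_inverse)
    hence "pm k i n \<in> Alg (Suc k)" using pm_Alg[of i "Suc k" n] x True by auto
    hence "wd k (x # w) * T a \<in> Alg (Suc k)" using a(3) x True by (simp add: mult.assoc Alg_mult)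
    thus ?thesis using a by blast
  next
    case False
    hence \<alpha>: "Suc \<alpha> \<in> {1..n}" using x by auto
    let ?t = "e (Suc k, Suc \<alpha>)"
    obtain c where c: "c \<noteq> 0" "T ?t * wd k w = c \<bullet> (wd k w * T ?t)"
      using T_wd_commute[OF k \<alpha>, of w] Cons by auto
    have "pm k i \<alpha> * T ?t * (wd k w * T a) \<in> Alg (Suc k)"
      using Alg_mult[OF pm_T_next[OF k x(2), of \<alpha>] a(3)] x \<alpha> by auto
    also have "pm k i \<alpha> * T ?t * (wd k w * T a) = (c * q powi phi ?t a) \<bullet> (wd k (x # w) * T (a + ?t))"
      by (simp add: mult.assoc commute_assoc[OF c(2)] x T_mult add.commute)
    finally have "inverse (c * q powi phi ?t a) \<bullet> ((c * q powi phi ?t a) \<bullet> (wd k (x # w) * T (a + ?t))) \<in> Alg (Suc k)"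
      by (rule Alg_linear)
    hence "wd k (x # w) * T (a + ?t) \<in> Alg (Suc k)" using c(1) q0 by (simp del: inverse_mult_distrib wd_simps)
    moreover have "T ?t \<in> Alg (Suc k)" using pm_Alg[of "Suc k" "Suc k" "Suc \<alpha>"] \<alpha> by simp
    moreover have "?t \<in> row_weights (Suc k)" using \<alpha> k by (auto simp: row_weights_def e_def box_def split: if_splits)
    ultimately show ?thesis using a by (blast intro: T_add_Alg row_weights_add)
  qed
qed

lemma clear_denominator:
  assumes k: "Suc k \<le> m" and f: "f \<in> Alg k"
  shows "\<exists>a \<in> row_weights (Suc k). T a \<in> Alg (Suc k) \<and> f * T a \<in> Alg (Suc k)"
  using f[unfolded Alg_def]
proof (induction rule: lop.span_induct_alt)
  case base
  have "\<exists>a \<in> row_weights (Suc k). T a \<in> Alg (Suc k) \<and> 0 * T a \<in> Alg (Suc k)"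
    by (rule bexI[of _ 0]) (auto simp: one_Alg row_weights_def Alg_linear)
  thus ?case .
next
  case (step c x y)
  then obtain w where "w \<in> lists ({1..k} \<times> {1..n})" "x = wd k w" by auto
  then obtain a where a: "a \<in> row_weights (Suc k)" "T a \<in> Alg (Suc k)" "x * T a \<in> Alg (Suc k)"
    using clear_denominator_wd[OF k] by blast
  obtain b where b: "b \<in> row_weights (Suc k)" "T b \<in> Alg (Suc k)" "y * T b \<in> Alg (Suc k)" using step by blast
  have "(c * q powi (- phi a b)) \<bullet> (x * T a * T b) + q powi (- phi b a) \<bullet> (y * T b * T a) \<in> Alg (Suc k)"
    by (intro Alg_linear Alg_mult[OF a(3) b(2)] Alg_mult[OF b(3) a(2)])
  also have "(c * q powi (- phi a b)) \<bullet> (x * T a * T b) + q powi (- phi b a) \<bullet> (y * T b * T a) = (c \<bullet> x + y) * T (a + b)"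
    by (simp add: mult.assoc T_mult power_int_minus q0 distrib_right add.commute[of b a])
  finally show ?case using a b by (blast intro: T_add_Alg row_weights_add)
qed

section \<open>Monomials lying in the algebra\<close>

definition Gam :: "weight set" where "Gam = {a. T a \<in> Alg m}"

lemma Gam_0: "0 \<in> Gam" by (simp add: Gam_def one_Alg)

lemma Gam_add: "a \<in> Gam \<Longrightarrow> b \<in> Gam \<Longrightarrow> a + b \<in> Gam"
  by (simp add: Gam_def T_add_Alg)

lemma Gam_Lam: "Gam \<subseteq> Lam"
proof
  fix a assume "a \<in> Gam"
  hence "T a \<in> QT" using Alg_QT[of m] by (auto simp: Gam_def)
  thus "a \<in> Lam" using supp_Lam[of "T a" a] by (simp add: cf_T)
qed

text \<open>The generator of position \<open>(i, \<alpha>)\<close> is itself an entry of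
  \<open>pm i\<close>. Each later row is passed by clearing denominators, at the cost of exponents
  in that row only.\<close>

lemma Gam_above:
  assumes "i \<in> {1..m}" "\<alpha> \<in> {1..n}"
  shows "\<exists>a. (\<forall>x. a x \<noteq> 0 \<longrightarrow> i < fst x \<and> x \<in> box) \<and> e (i, \<alpha>) + a \<in> Gam"
proof -
  have "\<exists>a. (\<forall>x. a x \<noteq> 0 \<longrightarrow> i < fst x \<and> x \<in> box) \<and> T (e (i, \<alpha>) + a) \<in> Alg k" if "i \<le> k" "k \<le> m" for k
    using that
  proof (induction k rule: dec_induct)
    case base
    have "pm i i \<alpha> = T (e (i, \<alpha>))" using assms by (cases i) auto
    thus ?case using pm_Alg[of i i \<alpha>] assms by (intro exI[of _ 0]) auto
  next
    case (step k)
    hence "\<exists>a. (\<forall>x. a x \<noteq> 0 \<longrightarrow> i < fst x \<and> x \<in> box) \<and> T (e (i, \<alpha>) + a) \<in> Alg k"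
      using Suc_leD by blast
    then obtain a where a: "\<forall>x. a x \<noteq> 0 \<longrightarrow> i < fst x \<and> x \<in> box" "T (e (i, \<alpha>) + a) \<in> Alg k" by blast
    obtain b where b: "b \<in> row_weights (Suc k)" "T (e (i, \<alpha>) + a) * T b \<in> Alg (Suc k)"
      using clear_denominator[OF step(4) a(2)] by blast
    have "q powi (- phi (e (i, \<alpha>) + a) b) \<bullet> (T (e (i, \<alpha>) + a) * T b) \<in> Alg (Suc k)"
      using b(2) by (rule Alg_linear)
    hence "T (e (i, \<alpha>) + (a + b)) \<in> Alg (Suc k)" by (simp add: T_mult power_int_minus q0 add.assoc)
    moreover have "i < fst x \<and> x \<in> box" if "(a + b) x \<noteq> 0" for x
    proof (cases "a x = 0")
      case True
      hence "b x \<noteq> 0" using that by simp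
      hence "fst x = Suc k" "x \<in> box" using b(1) unfolding row_weights_def by blast+
      thus ?thesis using step(1) by simp
    qed (use a(1) in blast)
    ultimately show ?case by blast
  qed
  from this[of m] show ?thesis using assms by (auto simp: Gam_def)
qed

lemma weight_in_subgroup:
  assumes S: "finite S" and D: "0 \<in> D" "\<And>a b. a \<in> D \<Longrightarrow> b \<in> D \<Longrightarrow> a + b \<in> D" "\<And>a. a \<in> D \<Longrightarrow> - a \<in> D"
    and e: "\<And>x. x \<in> S \<Longrightarrow> e x \<in> D" and a: "\<And>x. a x \<noteq> 0 \<Longrightarrow> x \<in> S"
  shows "a \<in> D"
proof -
  have multn: "(\<lambda>y. int k * b y) \<in> D" if "b \<in> D" for k and b :: weight
  proof (induction k)
    case 0
    have "(\<lambda>y. int 0 * b y) = 0" by (simp add: fun_eq_iff)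
    thus ?case using D(1) by simp
  next
    case (Suc k)
    have "(\<lambda>y. int (Suc k) * b y) = (\<lambda>y. int k * b y) + b" by (simp add: fun_eq_iff algebra_simps)
    thus ?case using D(2)[OF Suc that] by simp
  qed
  have mult: "(\<lambda>y. c * e x y) \<in> D" if "x \<in> S" for c x
  proof (cases "c \<ge> 0")
    case True
    thus ?thesis using multn[OF e[OF that], of "nat c"] by simp
  next
    case False
    have "(\<lambda>y. c * e x y) = - (\<lambda>y. int (nat (- c)) * e x y)" using False by (simp add: fun_eq_iff)
    thus ?thesis using D(3)[OF multn[OF e[OF that], of "nat (- c)"]] by (simp only:)
  qed
  have "(\<Sum>x\<in>S. (\<lambda>y. a x * e x y)) \<in> D"
    using S mult by (induction S rule: finite_induct) (auto intro: D)
  moreover have "(\<Sum>x\<in>S. (\<lambda>y. a x * e x y)) y = a y" for y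
  proof -
    have "(\<Sum>x\<in>S. (\<lambda>y. a x * e x y)) y = (\<Sum>x\<in>S. a x * e x y)" by (induction S rule: infinite_finite_induct) auto
    also have "\<dots> = (\<Sum>x\<in>S. if x = y then a y else 0)" by (intro sum.cong refl) (auto simp: e_def)
    also have "\<dots> = a y" using S a[of y] by auto
    finally show ?thesis .
  qed
  ultimately show ?thesis by (metis ext)
qed

text \<open>By triangularity: \<open>Gam\<close> contains each \<open>e (i, \<alpha>)\<close> up to
  exponents in later rows, and these are differences by induction from the last row upwards. So
  every monomial of the torus is, up to a scalar, a fraction of monomials in the algebra.\<close>

lemma Lam_Gam_diff:
  assumes "a \<in> Lam"
  shows "\<exists>b\<in>Gam. \<exists>c\<in>Gam. a = b - c"
proof -
  define D where "D = {b - c | b c. b \<in> Gam \<and> c \<in> Gam}"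
  have D: "0 \<in> D" "\<And>a b. a \<in> D \<Longrightarrow> b \<in> D \<Longrightarrow> a + b \<in> D" "\<And>a. a \<in> D \<Longrightarrow> - a \<in> D" "Gam \<subseteq> D"
  proof -
    show "0 \<in> D" unfolding D_def using Gam_0 by (intro CollectI exI[of _ 0]) auto
    show "Gam \<subseteq> D"
    proof
      fix a assume "a \<in> Gam" thus "a \<in> D" unfolding D_def using Gam_0 by (intro CollectI exI[of _ a] exI[of _ 0]) auto
    qed
    show "- a \<in> D" if a: "a \<in> D" for a
    proof -
      from a obtain b c where "b \<in> Gam" "c \<in> Gam" "a = b - c" by (auto simp: D_def)
      thus ?thesis unfolding D_def by (intro CollectI exI[of _ c] exI[of _ b]) auto
    qed
    show "a + a' \<in> D" if a: "a \<in> D" "a' \<in> D" for a a'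
    proof -
      from a obtain b c b' c' where "b \<in> Gam" "c \<in> Gam" "a = b - c" "b' \<in> Gam" "c' \<in> Gam" "a' = b' - c'"
        by (auto simp: D_def)
      thus ?thesis unfolding D_def by (intro CollectI exI[of _ "b + b'"] exI[of _ "c + c'"]) (auto intro: Gam_add)
    qed
  qed
  have "e (i, \<alpha>) \<in> D" if "i \<in> {1..m}" "\<alpha> \<in> {1..n}" for i \<alpha>
    using that
  proof (induction "m - i" arbitrary: i \<alpha> rule: less_induct)
    case less
    obtain a where a: "\<And>x. a x \<noteq> 0 \<Longrightarrow> i < fst x \<and> x \<in> box" "e (i, \<alpha>) + a \<in> Gam"
      using Gam_above[OF less.prems] by blast
    have "a \<in> D"
    proof (rule weight_in_subgroup[of "{x\<in>box. i < fst x}"])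
      fix x assume "x \<in> {x\<in>box. i < fst x}"
      thus "e x \<in> D" using less.hyps[of "fst x" "snd x"] less.prems by (auto simp: box_def)
    qed (use a D in auto)
    hence "(e (i, \<alpha>) + a) + (- a) \<in> D" using a(2) D by blast
    thus ?case by simp
  qed
  hence eD: "e x \<in> D" if "x \<in> box" for x using that by (cases x) (auto simp: box_def)
  have "a \<in> D"
    by (rule weight_in_subgroup[OF finite_box D(1-3) eD]) (use assms in \<open>auto simp: Lam_def\<close>)
  thus ?thesis by (auto simp: D_def)
qed

end

section \<open>Primitivity in terms of the radical of the commutation form\<close>

lemma poly_op_altdef: "poly_op z p = (\<Sum>k\<le>degree p. coeff p k \<bullet> z ^ k)"
proof (induction p)
  case (pCons a p)
  have "z * poly_op z p = (\<Sum>k\<le>degree p. coeff p k \<bullet> z ^ Suc k)"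
    by (simp add: pCons sum_distrib_left)
  moreover have "(\<Sum>k\<le>degree (pCons a p). coeff (pCons a p) k \<bullet> z ^ k) =
      a \<bullet> 1 + (\<Sum>k\<le>degree p. coeff p k \<bullet> z ^ Suc k)"
    by (cases "p = 0") (simp_all add: sum.atMost_Suc_shift del: sum.atMost_Suc)
  ultimately show ?case by simp
qed simp

definition wmult :: "nat \<Rightarrow> weight \<Rightarrow> weight" where "wmult k a = (\<lambda>y. int k * a y)"

lemma wmult_simps [simp]: "wmult 0 a = 0" "wmult (Suc k) a = a + wmult k a" "wmult (k + l) a = wmult k a + wmult l a"
  "wmult k (a + b) = wmult k a + wmult k b" "wmult k (a - b) = wmult k a - wmult k b"
  by (auto simp: wmult_def fun_eq_iff algebra_simps)

lemma wmult_inj: "a \<noteq> 0 \<Longrightarrow> wmult k a = wmult l a \<longleftrightarrow> k = l"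
  by (auto simp: wmult_def fun_eq_iff)

context qtorus
begin

lemma T_power: "\<exists>d. d \<noteq> 0 \<and> T a ^ k * T b = d \<bullet> T (wmult k a + b)"
proof (induction k)
  case 0
  have "T a ^ 0 * T b = 1 \<bullet> T (wmult 0 a + b)" by simp
  thus ?case by (metis zero_neq_one)
next
  case (Suc k)
  then obtain d where d: "d \<noteq> 0" "T a ^ k * T b = d \<bullet> T (wmult k a + b)" by blast
  have "T a ^ Suc k * T b = (d * q powi phi a (wmult k a + b)) \<bullet> T (wmult (Suc k) a + b)"
    by (simp add: mult.assoc d(2) T_mult add.assoc)
  moreover have "d * q powi phi a (wmult k a + b) \<noteq> 0" using d q0 by simp
  ultimately show ?case by blast
qed

lemma Gam_wmult: "a \<in> Gam \<Longrightarrow> wmult k a \<in> Gam"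
  by (induction k) (auto intro: Gam_0 Gam_add)

text \<open>An exponent in the radical gives a central monomial \<open>T a\<close>; this verifies
  the hypotheses of the criterion with \<open>z = T a\<close>.\<close>

lemma not_left_primitive_if_radical:
  assumes a: "a \<in> Lam" "a \<noteq> 0" and rad: "\<And>b. b \<in> Lam \<Longrightarrow> skew a b = 0"
  shows "\<not> left_primitive_ring (subring_record (Alg m))"
proof (rule not_left_primitive_ring_if_central)
  show "is_subring (Alg m)" "lop.subspace (Alg m)" by (rule Alg_subring Alg_subspace)+
  show "countable (wd m ` lists ({1..m} \<times> {1..n}))" by (intro countable_image countable_lists) simp
  show "Alg m \<subseteq> lop.span (wd m ` lists ({1..m} \<times> {1..n}))" by (simp add: Alg_def)
next
  fix b assume "b \<in> Alg m"
  hence "b \<in> QT" using Alg_QT by auto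
  thus "T a * b = b * T a"
  proof (induction rule: QT_induct)
    case (add c d f)
    thus ?case using T_commute[of a d] rad by (simp add: distrib_left distrib_right)
  qed simp
next
  fix p :: "complex poly" and N :: nat
  assume p: "p \<noteq> 0"
  obtain b c where bc: "b \<in> Gam" "c \<in> Gam" "a = b - c" using Lam_Gam_diff[OF a(1)] by blast
  \<comment> \<open>Multiplication by \<open>T t\<close> clears the denominators of the powers of
    \<open>T a\<close> up to \<open>N\<close> at once, since
    \<open>i a + N c = i b + (N - i) c\<close> for \<open>i \<le> N\<close>.\<close>
  define t where "t = wmult N c"
  obtain d where d: "\<And>k. d k \<noteq> 0" "\<And>k. T a ^ k * T t = d k \<bullet> T (wmult k a + t)"
    using T_power[of a _ t] by metis
  have "T a ^ i * T t \<in> Alg m" if "i \<le> N" for i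
  proof -
    have "N = i + (N - i)" using that by simp
    hence "t = wmult i c + wmult (N - i) c" unfolding t_def by (metis wmult_simps(3))
    hence "wmult i a + t = wmult i b + wmult (N - i) c" by (simp add: bc(3) algebra_simps)
    also have "\<dots> \<in> Gam" using bc by (intro Gam_add Gam_wmult)
    finally have "wmult i a + t \<in> Gam" .
    thus ?thesis using d(2)[of i] by (simp add: Gam_def Alg_linear)
  qed
  moreover have "poly_op (T a) p * T t \<noteq> 0"
  proof
    assume "poly_op (T a) p * T t = 0"
    hence "0 = cf (poly_op (T a) p * T t) (wmult (degree p) a + t)" by simp
    also have "\<dots> = (\<Sum>k\<le>degree p. if k = degree p then coeff p k * d k else 0)"
      unfolding poly_op_altdef sum_distrib_right cf_sum
      by (intro sum.cong refl) (auto simp: d(2) cf_T wmult_inj[OF a(2)])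
    also have "\<dots> = lead_coeff p * d (degree p)" by simp
    finally show False using p d(1) by simp
  qed
  moreover have "T t \<in> Alg m" using Gam_wmult[OF bc(2)] by (simp add: t_def Gam_def)
  ultimately show "\<exists>b\<in>Alg m. (\<forall>i\<le>N. T a ^ i * b \<in> Alg m) \<and> poly_op (T a) p * b \<noteq> 0" by blast
qed

text \<open>Take a nonzero element of smallest support. Its twisted commutator with a monomial
  \<open>T b\<close>, chosen to kill one term, has smaller support and must vanish. So all exponents
  pair equally with \<open>Gam\<close>, hence with \<open>Lam\<close>, and nondegeneracy leaves a
  single exponent.\<close>

lemma ideal_contains_monomial:
  assumes rad: "\<And>a. a \<in> Lam \<Longrightarrow> (\<And>b. b \<in> Lam \<Longrightarrow> skew b a = 0) \<Longrightarrow> a = 0"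
    and I: "is_left_ideal (Alg m) I" "is_right_ideal (Alg m) I" "I \<noteq> {0}"
  shows "\<exists>a. T a \<in> I"
proof -
  have scale: "c \<bullet> x \<in> I" if "x \<in> I" for c x
    using is_left_idealD(4)[OF I(1) Alg_linear(4)[OF one_Alg, of c] that] by simp
  obtain f0 where "f0 \<in> I" "f0 \<noteq> 0" using I(1,3) unfolding is_left_ideal_def by blast
  then obtain f where f: "f \<in> I" "f \<noteq> 0"
    "\<And>g. g \<in> I \<Longrightarrow> g \<noteq> 0 \<Longrightarrow> card {a. cf f a \<noteq> 0} \<le> card {a. cf g a \<noteq> 0}"
    using ex_has_least_nat[of "\<lambda>f. f \<in> I \<and> f \<noteq> 0" f0 "\<lambda>f. card {a. cf f a \<noteq> 0}"] by auto
  have QT: "g \<in> QT" if "g \<in> I" for g using is_left_idealD(1)[OF I(1) that] Alg_QT by auto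
  obtain a0 where a0: "cf f a0 \<noteq> 0" using QT_eq_0[OF QT[OF f(1)]] f(2) by blast
  have skew_Gam: "skew b a = skew b a0" if b: "b \<in> Gam" and a: "cf f a \<noteq> 0" for a b
  proof -
    define g where "g = T b * f - q powi skew b a0 \<bullet> (f * T b)"
    have bA: "T b \<in> Alg m" using b by (simp add: Gam_def)
    have "T b * f \<in> I" using is_left_idealD(4)[OF I(1) bA f(1)] .
    moreover have "f * T b \<in> I" using I(2) bA f(1) by (auto simp: is_right_ideal_def)
    ultimately have gI: "g \<in> I"
      unfolding g_def by (intro is_left_ideal_diff(2)[OF Alg_subring I(1)] scale)
    have cfg: "cf g (x + b) = (q powi phi b x - q powi (skew b a0 + phi x b)) * cf f x" for x
      using cf_mult_T[OF QT[OF f(1)], of b "x + b"] cf_T_mult[of b f "x + b"]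
      by (simp add: g_def power_int_add q0 algebra_simps)
    have "{x. cf g x \<noteq> 0} \<subseteq> (\<lambda>x. x + b) ` ({x. cf f x \<noteq> 0} - {a0})"
    proof
      fix y assume y: "y \<in> {x. cf g x \<noteq> 0}"
      define x where "x = y - b"
      have yx: "y = x + b" by (simp add: x_def)
      have "cf g (x + b) \<noteq> 0" using y yx by simp
      hence "cf f x \<noteq> 0" "x \<noteq> a0" unfolding cfg by (auto simp: skew_def)
      thus "y \<in> (\<lambda>x. x + b) ` ({x. cf f x \<noteq> 0} - {a0})" using yx by blast
    qed
    hence "card {x. cf g x \<noteq> 0} \<le> card ((\<lambda>x. x + b) ` ({x. cf f x \<noteq> 0} - {a0}))"
      using finite_supp[OF QT[OF f(1)]] by (intro card_mono) auto
    also have "\<dots> \<le> card ({x. cf f x \<noteq> 0} - {a0})"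
      using finite_supp[OF QT[OF f(1)]] by (intro card_image_le) auto
    also have "\<dots> < card {x. cf f x \<noteq> 0}"
      using finite_supp[OF QT[OF f(1)]] a0 by (intro card_Diff1_less) auto
    finally have "g = 0" using f(3)[OF gI] by linarith
    hence "(q powi phi b a - q powi (skew b a0 + phi a b)) * cf f a = 0" using cfg[of a] by simp
    hence "q powi phi b a = q powi (skew b a0 + phi a b)" using a by simp
    thus ?thesis by (simp add: q_powi_inj skew_def)
  qed
  have "a = a0" if a: "cf f a \<noteq> 0" for a
  proof -
    have "a - a0 = 0"
    proof (rule rad)
      show "a - a0 \<in> Lam" using supp_Lam[OF QT[OF f(1)]] a a0 by (intro Lam_closed)
      fix b assume "b \<in> Lam"
      then obtain c d where "c \<in> Gam" "d \<in> Gam" "b = c - d" using Lam_Gam_diff by blast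
      thus "skew b (a - a0) = 0"
        using skew_Gam[of c a] skew_Gam[of d a] a by (simp add: skew_diff)
    qed
    thus ?thesis by simp
  qed
  hence "{a. cf f a \<noteq> 0} = {a0}" using a0 by blast
  hence "f = cf f a0 \<bullet> T a0" using QT_expand[OF QT[OF f(1)]] by simp
  hence "inverse (cf f a0) \<bullet> f = T a0" using a0 by (metis lop.scale_scale left_inverse lop.scale_one)
  thus ?thesis using scale[OF f(1)] by metis
qed

text \<open>Write each \<open>e x\<close> as \<open>b x - c x\<close> in \<open>Gam\<close> and add
  up all \<open>b x + c x\<close>. Then \<open>r + e x\<close> contains \<open>b x\<close> twice and
  \<open>r - e x\<close> contains \<open>c x\<close> twice, with the rest in \<open>Gam\<close>;
  sums of such bounds cover all of \<open>Lam\<close>.\<close>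

lemma dominating_weight:
  assumes "m > 0" "n > 0"
  shows "\<exists>r\<in>Gam. r \<noteq> 0 \<and> (\<forall>a\<in>Lam. \<exists>k. wmult k r - a \<in> Gam)"
proof -
  have "\<exists>b c. b \<in> Gam \<and> c \<in> Gam \<and> e x = b - c" if "x \<in> box" for x
    using Lam_Gam_diff[OF e_Lam[OF that]] by blast
  then obtain b c where bc: "\<And>x. x \<in> box \<Longrightarrow> b x \<in> Gam" "\<And>x. x \<in> box \<Longrightarrow> c x \<in> Gam"
    "\<And>x. x \<in> box \<Longrightarrow> e x = b x - c x" by metis
  have sumG: "(\<Sum>x\<in>S. b x + c x) \<in> Gam" if "finite S" "S \<subseteq> box" for S
    using that by (induction S rule: finite_induct) (auto intro: Gam_0 Gam_add bc)
  define r where "r = (\<Sum>x\<in>box. b x + c x)"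
  define G where "G = {a. \<exists>k. wmult k r + a \<in> Gam \<and> wmult k r - a \<in> Gam}"
  have G0: "0 \<in> G" unfolding G_def using Gam_0 by (intro CollectI exI[of _ 0]) auto
  have Gadd: "a + a' \<in> G" if "a \<in> G" "a' \<in> G" for a a'
  proof -
    from that obtain k l where "wmult k r + a \<in> Gam" "wmult k r - a \<in> Gam" "wmult l r + a' \<in> Gam" "wmult l r - a' \<in> Gam"
      by (auto simp: G_def)
    from Gam_add[OF this(1,3)] Gam_add[OF this(2,4)] show ?thesis
      unfolding G_def by (intro CollectI exI[of _ "k + l"]) (simp add: algebra_simps)
  qed
  have Gmin: "- a \<in> G" if "a \<in> G" for a
    using that unfolding G_def by auto
  have eG: "e x \<in> G" if x: "x \<in> box" for x
  proof -
    define s where "s = (\<Sum>x\<in>box - {x}. b x + c x)"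
    have s: "s \<in> Gam" unfolding s_def by (rule sumG) auto
    have "r = (b x + c x) + s" unfolding r_def s_def using x by (intro sum.remove) auto
    hence r': "wmult 1 r + e x = (b x + b x) + s" "wmult 1 r - e x = (c x + c x) + s"
      using bc(3)[OF x] by (simp_all add: algebra_simps)
    have "wmult 1 r + e x \<in> Gam \<and> wmult 1 r - e x \<in> Gam"
      unfolding r' using bc(1,2)[OF x] s by (intro conjI Gam_add)
    thus ?thesis unfolding G_def by blast
  qed
  have LG: "Lam \<subseteq> G"
  proof
    fix a assume "a \<in> Lam"
    thus "a \<in> G"
      using weight_in_subgroup[OF finite_box G0 Gadd Gmin eG, of a] by (auto simp: Lam_def)
  qed
  show ?thesis
  proof (cases "r = 0")
    case False
    moreover have "r \<in> Gam" unfolding r_def by (rule sumG) auto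
    ultimately show ?thesis using LG unfolding G_def by blast
  next
    \<comment> \<open>If \<open>r = 0\<close>, the bounds say that \<open>Gam\<close> is all of
      \<open>Lam\<close>, so any nonzero exponent serves.\<close>
    case True
    have w0: "wmult k 0 = 0" for k by (simp add: wmult_def fun_eq_iff)
    have LG': "Lam \<subseteq> Gam" using LG by (auto simp: G_def True w0)
    have "(1, 1) \<in> box" using assms by (auto simp: box_def)
    hence e1: "e (1, 1) \<in> Lam" by (rule e_Lam)
    have "e (1, 1) (1, 1) \<noteq> (0 :: weight) (1, 1)" by (simp add: e_def)
    hence "e (1, 1) \<noteq> 0" by metis
    moreover have "wmult 0 (e (1, 1)) - a \<in> Gam" if "a \<in> Lam" for a
      using Lam_closed(3)[OF that] LG' by auto
    ultimately show ?thesis using e1 LG' by blast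
  qed
qed

text \<open>An inverse would be a geometric series. Comparing coefficients along the multiples of
  \<open>r\<close> gives a two-term recursion with nonzero factors, so the support is infinite:
  forwards from 0 if the coefficient at 0 is nonzero, backwards from \<open>- r\<close>
  otherwise.\<close>

lemma one_minus_T_not_left_invertible:
  assumes f: "f \<in> QT" and r: "r \<noteq> 0"
  shows "f * (1 - T r) \<noteq> 1"
proof
  assume inv: "f * (1 - T r) = 1"
  have rec: "cf f b - q powi phi (b - r) r * cf f (b - r) = (if b = 0 then 1 else 0)" for b
    using arg_cong[OF inv, of "\<lambda>f. cf f b"] cf_mult_T[OF f, of r b] cf_T[of 0 b]
    by (simp add: right_diff_distrib)
  have step: "cf f b \<noteq> 0 \<longleftrightarrow> cf f (b - r) \<noteq> 0" if "b \<noteq> 0" for b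
    using rec[of b] that q0 by auto
  have inj: "inj (\<lambda>k. wmult k r)" using wmult_inj[OF r] by (auto simp: inj_def)
  show False
  proof (cases "cf f 0 = 0")
    case False
    have "cf f (wmult k r) \<noteq> 0" for k
    proof (induction k)
      case 0
      show ?case by (simp only: wmult_simps(1)) (rule False)
    next
      case (Suc k)
      have "r + wmult k r \<noteq> 0" using wmult_inj[OF r, of "Suc k" 0] by simp
      from step[OF this] Suc have "cf f (r + wmult k r) \<noteq> 0" by simp
      thus ?case by (simp only: wmult_simps(2) not_False_eq_True)
    qed
    hence "range (\<lambda>k. wmult k r) \<subseteq> {a. cf f a \<noteq> 0}" by auto
    thus False using finite_supp[OF f] finite_subset finite_imageD[OF _ inj] by blast
  next
    case True
    have "cf f (- wmult (Suc k) r) \<noteq> 0" for k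
    proof (induction k)
      case 0
      have "cf f (- r) \<noteq> 0" using rec[of 0] True by auto
      moreover have "wmult (Suc 0) r = r" by simp
      ultimately show ?case by (simp only: not_False_eq_True)
    next
      case (Suc k)
      have "wmult (Suc k) r \<noteq> 0" using wmult_inj[OF r, of "Suc k" 0] by simp
      hence "- wmult (Suc k) r \<noteq> 0" by (simp only: neg_equal_0_iff_equal not_False_eq_True)
      from step[OF this] Suc have "cf f (- wmult (Suc k) r - r) \<noteq> 0" by blast
      moreover have "- wmult (Suc k) r - r = - wmult (Suc (Suc k)) r" by (simp add: algebra_simps)
      ultimately show ?case by metis
    qed
    hence "range (\<lambda>k. - wmult (Suc k) r) \<subseteq> {a. cf f a \<noteq> 0}" by auto
    moreover have "inj (\<lambda>k. - wmult (Suc k) r)"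
      using wmult_inj[OF r, of "Suc _" "Suc _"] by (auto simp: inj_def simp del: wmult_simps)
    ultimately show False using finite_supp[OF f] finite_subset finite_imageD by blast
  qed
qed

text \<open>For the dominating exponent \<open>r\<close>, every monomial of the algebra divides a
  power of \<open>T r\<close> inside the algebra. A monomial in an ideal therefore puts a power of
  \<open>T r\<close> there.\<close>

lemma left_primitive_if_no_radical:
  assumes mn: "m > 0" "n > 0"
    and rad: "\<And>a. a \<in> Lam \<Longrightarrow> (\<And>b. b \<in> Lam \<Longrightarrow> skew b a = 0) \<Longrightarrow> a = 0"
  shows "left_primitive_ring (subring_record (Alg m))"
proof -
  obtain r where r: "r \<in> Gam" "r \<noteq> 0" "\<And>a. a \<in> Lam \<Longrightarrow> \<exists>k. wmult k r - a \<in> Gam"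
    using dominating_weight[OF mn] by blast
  show ?thesis
  proof (rule left_primitive_ring_if_powers_meet_ideals[of _ "T r"])
    show "is_subring (Alg m)" by (rule Alg_subring)
    show "T r \<in> Alg m" using r(1) by (simp add: Gam_def)
    show "f * (1 - T r) \<noteq> 1" if "f \<in> Alg m" for f
      using one_minus_T_not_left_invertible[OF _ r(2)] that Alg_QT by blast
  next
    fix I assume I: "is_left_ideal (Alg m) I" "is_right_ideal (Alg m) I" "I \<noteq> {0}"
    obtain a where a: "T a \<in> I" using ideal_contains_monomial[OF rad I] by blast
    hence "T a \<in> Alg m" using is_left_idealD(1)[OF I(1)] by blast
    hence "a \<in> Lam" using Gam_Lam by (auto simp: Gam_def)
    then obtain k where k: "wmult k r - a \<in> Gam" using r(3) by blast
    define b where "b = wmult k r - a"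
    obtain d where d: "T r ^ k * T 0 = d \<bullet> T (wmult k r + 0)" using T_power[of r k 0] by blast
    have "(d * q powi (- phi b a)) \<bullet> T b \<in> Alg m" using k by (auto simp: Gam_def b_def intro: Alg_linear)
    from is_left_idealD(4)[OF I(1) this a]
    have "(d * q powi (- phi b a)) \<bullet> T b * T a \<in> I" .
    also have "(d * q powi (- phi b a)) \<bullet> T b * T a = d \<bullet> T (b + a)"
      using q0 by (simp add: T_mult power_int_minus)
    also have "\<dots> = T r ^ k" using d by (simp add: b_def)
    finally have "T r ^ k \<in> I" .
    thus "\<exists>k. T r ^ k \<in> I" by blast
  qed
qed

end

section \<open>The radical of the commutation form\<close>

text \<open>The terms with \<open>j < i\<close> carry a minus sign, which antiperiodicity turns into
  a shift by \<open>M\<close>. The indices then fill the window from \<open>i + 1\<close> to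
  \<open>i + M - 1\<close>.\<close>

lemma antiperiodic_sum:
  fixes V :: "int \<Rightarrow> int"
  assumes V: "\<And>x. V (x + int M) = - V x" and i: "i \<in> {1..M}"
  shows "(\<Sum>j\<in>{1..M}. (of_bool (i < j) - of_bool (j < i)) * V (int j)) = (\<Sum>k\<in>{1..<M}. V (int i + int k))"
proof -
  have "(\<Sum>j\<in>{1..M}. (of_bool (i < j) - of_bool (j < i)) * V (int j)) =
      (\<Sum>j\<in>{1..M}. if i < j then V (int j) else 0) + (\<Sum>j\<in>{1..M}. if j < i then - V (int j) else 0)"
    unfolding sum.distrib[symmetric] by (intro sum.cong refl) auto
  also have "(\<Sum>j\<in>{1..M}. if i < j then V (int j) else 0) = (\<Sum>k\<in>{1..M - i}. V (int i + int k))"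
    by (subst sum.inter_filter[symmetric], simp)
       (rule sum.reindex_bij_witness[of _ "\<lambda>k. i + k" "\<lambda>j. j - i"], use i in auto)
  also have "(\<Sum>j\<in>{1..M}. if j < i then - V (int j) else 0) = (\<Sum>k\<in>{M - i + 1..<M}. V (int i + int k))"
  proof (subst sum.inter_filter[symmetric], simp, rule sum.reindex_bij_witness[of _ "\<lambda>k. i + k - M" "\<lambda>j. j + M - i"])
    fix j assume j: "j \<in> {j \<in> {1..M}. j < i}"
    have "int i + int (j + M - i) = int j + int M" using i by simp
    thus "V (int i + int (j + M - i)) = - V (int j)" using V by simp
  qed (use i in auto)
  also have "(\<Sum>k\<in>{1..M - i}. V (int i + int k)) + (\<Sum>k\<in>{M - i + 1..<M}. V (int i + int k)) =
      (\<Sum>k\<in>{1..M - i} \<union> {M - i + 1..<M}. V (int i + int k))"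
    by (rule sum.union_disjoint[symmetric]) auto
  also have "{1..M - i} \<union> {M - i + 1..<M} = {1..<M}" using i by auto
  finally show ?thesis .
qed

text \<open>Dividing by the gcd removes equal multiplicities, and of the two coprime quotients at
  most one is even.\<close>

lemma multiplicity_2_eq_iff:
  assumes "m > 0" "n > 0"
  shows "multiplicity (2::nat) m = multiplicity 2 n \<longleftrightarrow> odd (m div gcd m n) \<and> odd (n div gcd m n)"
proof -
  define g m' n' where "g = gcd m n" and "m' = m div g" and "n' = n div g"
  have g: "g \<noteq> 0" "m = g * m'" "n = g * n'" using assms by (auto simp: g_def m'_def n'_def)
  have nz: "m' \<noteq> 0" "n' \<noteq> 0" using g assms by auto
  have cop: "coprime m' n'"
    unfolding m'_def n'_def g_def using assms by (intro div_gcd_coprime) auto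
  have "multiplicity 2 m = multiplicity 2 n \<longleftrightarrow> multiplicity 2 m' = multiplicity 2 n'"
    unfolding g(2,3) using g(1) nz by (simp add: prime_elem_multiplicity_mult_distrib)
  also have "\<dots> \<longleftrightarrow> odd m' \<and> odd n'"
  proof
    assume eq: "multiplicity 2 m' = multiplicity 2 n'"
    have "even m' \<longleftrightarrow> even n'"
      using eq nz by (metis prime_elem_multiplicity_eq_zero_iff prime_imp_prime_elem two_is_prime_nat)
    moreover have "\<not> (even m' \<and> even n')" using cop by (metis coprime_common_divisor_nat even_numeral numeral_One odd_one)
    ultimately show "odd m' \<and> odd n'" by blast
  next
    assume "odd m' \<and> odd n'"
    thus "multiplicity 2 m' = multiplicity 2 n'" by (simp add: not_dvd_imp_multiplicity_0)
  qed
  finally show ?thesis by (simp add: m'_def n'_def g_def)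
qed

lemma antiperiodic_multiple:
  fixes V :: "int \<Rightarrow> int"
  assumes V: "\<And>x. V (x + p) = - V x"
  shows "V (x + int k * p) = (if even k then V x else - V x)"
proof (induction k)
  case (Suc k)
  have "V (x + int (Suc k) * p) = V (x + int k * p + p)" by (simp add: algebra_simps)
  thus ?case using Suc V by auto
qed simp

text \<open>
  \<open>F\<close> is a kernel element of the commutation form, extended antiperiodically in both variables;
  then the form becomes a sum over full periods minus the diagonal term, and differencing in both
  variables isolates \<open>F\<close>.
\<close>
lemma antiperiodic_kernel_zero:
  fixes F :: "int \<Rightarrow> int \<Rightarrow> int"
  assumes mn: "m > 0" "n > 0" and v2: "multiplicity (2::nat) m \<noteq> multiplicity 2 n"
    and Fm: "\<And>x y. F (x + int m) y = - F x y" and Fn: "\<And>x y. F x (y + int n) = - F x y"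
    and ker: "\<And>x y. (\<Sum>k\<in>{1..<m}. F (x + int k) y) + (\<Sum>k\<in>{1..<n}. F x (y + int k)) = 0"
  shows "F x y = 0"
proof -
  have tele: "(\<Sum>k\<in>{1..<M}. V (z + int k)) - (\<Sum>k\<in>{1..<M}. V (z + 1 + int k)) = V (z + 1) + V z"
    if "M > 0" "\<And>z. V (z + int M) = - V z" for V :: "int \<Rightarrow> int" and M z
  proof -
    have "(\<Sum>k\<in>{1..<M}. V (z + int k)) - (\<Sum>k\<in>{1..<M}. V (z + 1 + int k)) = - (\<Sum>k\<in>{1..<M}. V (z + int (Suc k)) - V (z + int k))"
      by (simp add: sum_subtractf sum_negf algebra_simps)
    also have "\<dots> = V (z + 1) - V (z + int M)"
      using that(1) sum_Suc_diff'[of 1 M "\<lambda>k. V (z + int k)"] by simp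
    finally show ?thesis using that(2) by simp
  qed
  have shift: "F (x + 1) (y + 1) = F x y" for x y
  proof -
    let ?E = "\<lambda>x y. (\<Sum>k\<in>{1..<m}. F (x + int k) y) + (\<Sum>k\<in>{1..<n}. F x (y + int k))"
    have D: "F (x + 1) y + F x y + (\<Sum>k\<in>{1..<n}. F x (y + int k)) - (\<Sum>k\<in>{1..<n}. F (x + 1) (y + int k)) = 0" for y
      using ker[of x y] ker[of "x + 1" y] tele[of m "\<lambda>x. F x y" x] mn(1) Fm by simp
    have "(\<Sum>k\<in>{1..<n}. F x (y + int k)) - (\<Sum>k\<in>{1..<n}. F x (y + 1 + int k)) = F x (y + 1) + F x y"
      "(\<Sum>k\<in>{1..<n}. F (x + 1) (y + int k)) - (\<Sum>k\<in>{1..<n}. F (x + 1) (y + 1 + int k)) = F (x + 1) (y + 1) + F (x + 1) y"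
      using tele[of n "F x" y] tele[of n "F (x + 1)" y] mn(2) Fn by auto
    \<comment> \<open>The relation at \<open>y\<close> minus the one at \<open>y + 1\<close> is
      \<open>2 * F x y - 2 * F (x + 1) (y + 1) = 0\<close>.\<close>
    thus ?thesis using D[of y] D[of "y + 1"] by linarith
  qed
  have diag: "F (x + int k) (y + int k) = F x y" for k
  proof (induction k)
    case (Suc k)
    thus ?case using shift[of "x + int k" "y + int k"] by (simp add: ac_simps)
  qed simp
  define g m' n' where "g = gcd m n" and "m' = m div g" and "n' = n div g"
  have g: "m = g * m'" "n = g * n'" using mn by (auto simp: g_def m'_def n'_def)
  have cop: "coprime m' n'"
    unfolding m'_def n'_def g_def using mn by (intro div_gcd_coprime) auto
  have par: "even m' \<noteq> even n'"
    using multiplicity_2_eq_iff[OF mn] v2 cop unfolding m'_def n'_def g_def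
    by (metis coprime_common_divisor_nat even_numeral numeral_One odd_one)
  have eq: "int n' * int m = int (g * m' * n')" "int m' * int n = int (g * m' * n')" using g by auto
  \<comment> \<open>Both displacements equal the lcm, so this is a move along the diagonal. Undoing
    it costs \<open>n'\<close> sign changes in one variable and \<open>m'\<close> in the other;
    exactly one of these numbers is even, hence \<open>F x y = - F x y\<close>.\<close>
  have "F x y = F (x + int n' * int m) (y + int m' * int n)"
    unfolding eq by (rule diag[symmetric])
  also have "\<dots> = (if even n' then F x (y + int m' * int n) else - F x (y + int m' * int n))"
    using antiperiodic_multiple[of "\<lambda>x. F x (y + int m' * int n)" "int m" x n'] Fm by simp
  also have "F x (y + int m' * int n) = (if even m' then F x y else - F x y)"
    using antiperiodic_multiple[of "F x" "int n" y m'] Fn by simp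
  finally show ?thesis using par by (auto split: if_splits)
qed

context qtorus
begin

lemma skew_e_eq:
  assumes "i \<in> {1..m}" "\<alpha> \<in> {1..n}"
  shows "skew (e (i, \<alpha>)) a = (\<Sum>j\<in>{1..m}. (of_bool (i < j) - of_bool (j < i)) * a (j, \<alpha>)) +
     (\<Sum>\<beta>\<in>{1..n}. (of_bool (\<alpha> < \<beta>) - of_bool (\<beta> < \<alpha>)) * a (i, \<beta>))"
proof -
  have ib: "(i, \<alpha>) \<in> box" using assms by (simp add: box_def)
  have "phi (e (i, \<alpha>)) a = (\<Sum>x\<in>box. if x = (i, \<alpha>) then \<Sum>y\<in>box. bx (i, \<alpha>) y * a y else 0)"
    unfolding phi_def by (intro sum.cong refl) (auto simp: e_def)
  hence 1: "phi (e (i, \<alpha>)) a = (\<Sum>y\<in>box. bx (i, \<alpha>) y * a y)" using ib by simp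
  have "phi a (e (i, \<alpha>)) = (\<Sum>x\<in>box. \<Sum>y\<in>box. if y = (i, \<alpha>) then bx x (i, \<alpha>) * a x else 0)"
    unfolding phi_def by (intro sum.cong refl) (auto simp: e_def)
  hence 2: "phi a (e (i, \<alpha>)) = (\<Sum>x\<in>box. bx x (i, \<alpha>) * a x)" using ib by simp
  have "skew (e (i, \<alpha>)) a = (\<Sum>y\<in>box. (bx (i, \<alpha>) y - bx y (i, \<alpha>)) * a y)"
    by (simp add: skew_def 1 2 sum_subtractf left_diff_distrib)
  also have "\<dots> = (\<Sum>j\<in>{1..m}. \<Sum>\<beta>\<in>{1..n}.
      (if \<beta> = \<alpha> then (of_bool (i < j) - of_bool (j < i)) * a (j, \<alpha>) else 0) +
      (if j = i then (of_bool (\<alpha> < \<beta>) - of_bool (\<beta> < \<alpha>)) * a (i, \<beta>) else 0))"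
    unfolding box_def sum.cartesian_product
    by (intro sum.cong refl) (auto simp: bx_def)
  also have "\<dots> = (\<Sum>j\<in>{1..m}. \<Sum>\<beta>\<in>{1..n}. if \<beta> = \<alpha> then (of_bool (i < j) - of_bool (j < i)) * a (j, \<alpha>) else 0) +
      (\<Sum>j\<in>{1..m}. \<Sum>\<beta>\<in>{1..n}. if j = i then (of_bool (\<alpha> < \<beta>) - of_bool (\<beta> < \<alpha>)) * a (i, \<beta>) else 0)"
    by (simp only: sum.distrib)
  also have "(\<Sum>j\<in>{1..m}. \<Sum>\<beta>\<in>{1..n}. if \<beta> = \<alpha> then (of_bool (i < j) - of_bool (j < i)) * a (j, \<alpha>) else 0) =
      (\<Sum>j\<in>{1..m}. (of_bool (i < j) - of_bool (j < i)) * a (j, \<alpha>))"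
    using assms by (simp add: sum.delta)
  also have "(\<Sum>j\<in>{1..m}. \<Sum>\<beta>\<in>{1..n}. if j = i then (of_bool (\<alpha> < \<beta>) - of_bool (\<beta> < \<alpha>)) * a (i, \<beta>) else 0) =
      (\<Sum>\<beta>\<in>{1..n}. (of_bool (\<alpha> < \<beta>) - of_bool (\<beta> < \<alpha>)) * a (i, \<beta>))"
    by (subst sum.swap) (use assms in \<open>simp add: sum.delta\<close>)
  finally show ?thesis .
qed

text \<open>Positions are numbered from 1, so \<open>x - 1\<close> is divided with remainder. The
  two quotients count the periods crossed, each of which flips the sign; comparing their parities
  yields the product of both signs.\<close>

definition antiext :: "weight \<Rightarrow> int \<Rightarrow> int \<Rightarrow> int" where
  "antiext a x y = (if even ((x - 1) div int m) = even ((y - 1) div int n) then 1 else -1) *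
     a (nat (1 + (x - 1) mod int m), nat (1 + (y - 1) mod int n))"

lemma no_radical:
  assumes mn: "m > 0" "n > 0" and v2: "multiplicity (2::nat) m \<noteq> multiplicity 2 n"
    and a: "a \<in> Lam" "\<And>b. b \<in> Lam \<Longrightarrow> skew b a = 0"
  shows "a = 0"
proof -
  define F where "F = antiext a"
  have Fm: "F (x + int m) y = - F x y" for x y
  proof -
    have "(x + int m - 1) div int m = (x - 1) div int m + 1" "(x + int m - 1) mod int m = (x - 1) mod int m"
      using mn div_add_self2[of "int m" "x - 1"] mod_add_self2[of "x - 1" "int m"] by (simp_all add: algebra_simps)
    thus ?thesis by (simp add: F_def antiext_def)
  qed
  have Fn: "F x (y + int n) = - F x y" for x y
  proof -
    have "(y + int n - 1) div int n = (y - 1) div int n + 1" "(y + int n - 1) mod int n = (y - 1) mod int n"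
      using mn div_add_self2[of "int n" "y - 1"] mod_add_self2[of "y - 1" "int n"] by (simp_all add: algebra_simps)
    thus ?thesis by (simp add: F_def antiext_def)
  qed
  have Fbox: "F (int i) (int \<alpha>) = a (i, \<alpha>)" if "i \<in> {1..m}" "\<alpha> \<in> {1..n}" for i \<alpha>
  proof -
    have "(int i - 1) div int m = 0" "(int i - 1) mod int m = int i - 1"
      "(int \<alpha> - 1) div int n = 0" "(int \<alpha> - 1) mod int n = int \<alpha> - 1"
      using that by (auto simp: div_pos_pos_trivial mod_pos_pos_trivial)
    thus ?thesis by (simp add: F_def antiext_def)
  qed
  define E where "E x y = (\<Sum>k\<in>{1..<m}. F (x + int k) y) + (\<Sum>k\<in>{1..<n}. F x (y + int k))" for x y
  have Em: "E (x + int m) y = - E x y" for x y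
  proof -
    have "F (x + int m + int k) y = - F (x + int k) y" for k using Fm[of "x + int k" y] by (simp add: ac_simps)
    thus ?thesis by (simp add: E_def Fm sum_negf)
  qed
  have En: "E x (y + int n) = - E x y" for x y
  proof -
    have "F x (y + int n + int k) = - F x (y + int k)" for k using Fn[of x "y + int k"] by (simp add: ac_simps)
    thus ?thesis by (simp add: E_def Fn sum_negf)
  qed
  have Ebox: "E (int i) (int \<alpha>) = 0" if i: "i \<in> {1..m}" "\<alpha> \<in> {1..n}" for i \<alpha>
  proof -
    have "0 = skew (e (i, \<alpha>)) a" using a(2) e_Lam[of "(i, \<alpha>)"] i by (simp add: box_def)
    also have "\<dots> = (\<Sum>j\<in>{1..m}. (of_bool (i < j) - of_bool (j < i)) * F (int j) (int \<alpha>)) +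
     (\<Sum>\<beta>\<in>{1..n}. (of_bool (\<alpha> < \<beta>) - of_bool (\<beta> < \<alpha>)) * F (int i) (int \<beta>))"
      unfolding skew_e_eq[OF i] using i by (intro arg_cong2[of _ _ _ _ "(+)"] sum.cong refl) (simp_all only: Fbox)
    also have "\<dots> = E (int i) (int \<alpha>)"
      unfolding E_def
      using antiperiodic_sum[of "\<lambda>x. F x (int \<alpha>)" m i] antiperiodic_sum[of "F (int i)" n \<alpha>] Fm Fn i by simp
    finally show ?thesis by simp
  qed
  \<comment> \<open>Being antiperiodic in both variables, \<open>E\<close> vanishes everywhere once
    it vanishes on the box.\<close>
  have E0: "E x y = 0" for x y
  proof -
    have antip: "V (z * p + w) = 0 \<longleftrightarrow> V w = 0" if "\<And>x. V (x + p) = - V x" for V :: "int \<Rightarrow> int" and z p w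
    proof (induction z rule: int_induct[of _ 0])
      case (step1 i)
      have "V ((i + 1) * p + w) = V (i * p + w + p)" by (simp add: algebra_simps)
      thus ?case using step1 that by simp
    next
      case (step2 i)
      have "V (i * p + w) = V ((i - 1) * p + w + p)" by (simp add: algebra_simps)
      thus ?case using step2 that by simp
    qed simp
    define i \<alpha> where "i = nat (1 + (x - 1) mod int m)" and "\<alpha> = nat (1 + (y - 1) mod int n)"
    have x: "x = ((x - 1) div int m) * int m + int i" and y: "y = ((y - 1) div int n) * int n + int \<alpha>"
      using mn div_mult_mod_eq[of "x - 1" "int m"] div_mult_mod_eq[of "y - 1" "int n"]
      by (simp_all add: i_def \<alpha>_def)
    have "i \<in> {1..m}" "\<alpha> \<in> {1..n}"
      using mn pos_mod_bound[of "int m" "x - 1"] pos_mod_bound[of "int n" "y - 1"]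
        pos_mod_sign[of "int m" "x - 1"] pos_mod_sign[of "int n" "y - 1"]
      by (auto simp: i_def \<alpha>_def simp del: pos_mod_bound pos_mod_sign)
    hence "E (int i) (int \<alpha>) = 0" by (rule Ebox)
    hence "E (int i) y = 0"
      using antip[of "E (int i)" "int n" "(y - 1) div int n" "int \<alpha>"] En y by metis
    thus ?thesis
      using antip[of "\<lambda>x. E x y" "int m" "(x - 1) div int m" "int i"] Em x by metis
  qed
  have "F x y = 0" for x y
    by (rule antiperiodic_kernel_zero[OF mn v2 Fm Fn E0[unfolded E_def]])
  hence "a x = 0" if "x \<in> box" for x using Fbox[of "fst x" "snd x"] that by (auto simp: box_def)
  moreover have "a x = 0" if "x \<notin> box" for x using a(1) that unfolding Lam_def by blast
  ultimately have "a x = (0 :: weight) x" for x by (cases "x \<in> box") simp_all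
  thus ?thesis by (rule ext)
qed

text \<open>An antiperiodic function for the gcd is antiperiodic for \<open>m\<close> and
  \<open>n\<close>, both being odd multiples of it. Placed along the diagonals
  \<open>i - \<alpha>\<close>, it makes the sums over rows and columns cancel.\<close>

lemma radical_exists:
  assumes mn: "m > 0" "n > 0" and v2: "multiplicity (2::nat) m = multiplicity 2 n"
  shows "\<exists>a\<in>Lam. a \<noteq> 0 \<and> (\<forall>b\<in>Lam. skew a b = 0)"
proof -
  define g m' n' where "g = gcd m n" and "m' = m div g" and "n' = n div g"
  have g: "g > 0" "m = g * m'" "n = g * n'" using mn by (auto simp: g_def m'_def n'_def)
  have odd: "odd m'" "odd n'" using multiplicity_2_eq_iff[OF mn] v2 by (auto simp: m'_def n'_def g_def)
  \<comment> \<open>The simplest nonzero function with antiperiod \<open>g\<close>: alternating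
    signs on the multiples of \<open>g\<close>.\<close>
  define f :: "int \<Rightarrow> int" where "f x = (if int g dvd x then if even (x div int g) then 1 else -1 else 0)" for x
  have fg: "f (x + int g) = - f x" for x using g(1) by (auto simp: f_def)
  have fm: "f (x + int m) = - f x" for x
    using antiperiodic_multiple[of f "int g" x m'] fg odd g by (simp add: mult.commute)
  have fn: "f (x + int n) = - f x" for x
    using antiperiodic_multiple[of f "int g" x n'] fg odd g by (simp add: mult.commute)
  have sum_add: "(\<Sum>k<a + b. h k) = (\<Sum>k<a. h k) + (\<Sum>k<b. h (a + k))" for a b and h :: "nat \<Rightarrow> int"
    by (induction b) auto
  \<comment> \<open>Consecutive blocks of length \<open>g\<close> have opposite sums, so an odd
    number of blocks leaves just one. This makes the sums of lengths \<open>m\<close> and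
    \<open>n\<close> agree.\<close>
  have block: "(\<Sum>k<g * M. f (x + int k)) = (if even M then 0 else (\<Sum>k<g. f (x + int k)))" for M x
  proof (induction M)
    case (Suc M)
    have "(\<Sum>k<g * Suc M. f (x + int k)) = (\<Sum>k<g * M. f (x + int k)) + (\<Sum>k<g. f (x + int (g * M + k)))"
      using sum_add[of "\<lambda>k. f (x + int k)" "g * M" g] by (simp add: add.commute[of g])
    also have "(\<Sum>k<g. f (x + int (g * M + k))) = (\<Sum>k<g. if even M then f (x + int k) else - f (x + int k))"
    proof (intro sum.cong refl)
      fix k
      show "f (x + int (g * M + k)) = (if even M then f (x + int k) else - f (x + int k))"
        using antiperiodic_multiple[of f "int g" "x + int k" M] fg by (simp add: algebra_simps)
    qed
    finally show ?case using Suc by (simp add: sum_negf)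
  qed simp
  have sum_from_1: "(\<Sum>k\<in>{1..<M}. f (x + int k)) = (\<Sum>k<M. f (x + int k)) - f x" if "M > 0" for M x
  proof -
    have "{..<M} = insert 0 {1..<M}" using that by auto
    thus ?thesis by simp
  qed
  have same: "(\<Sum>k\<in>{1..<m}. f (x + int k)) = (\<Sum>k\<in>{1..<n}. f (x + int k))" for x
    using sum_from_1[OF mn(1)] sum_from_1[OF mn(2)] block[of x m'] block[of x n'] odd g by simp
  define a :: weight where "a x = (if x \<in> box then f (int (fst x) - int (snd x)) else 0)" for x
  have skew_a: "skew (e x) a = 0" if x: "x \<in> box" for x
  proof -
    obtain i \<alpha> where i: "x = (i, \<alpha>)" "i \<in> {1..m}" "\<alpha> \<in> {1..n}" using x by (cases x) (auto simp: box_def)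
    have "skew (e x) a = (\<Sum>j\<in>{1..m}. (of_bool (i < j) - of_bool (j < i)) * f (int j - int \<alpha>)) +
       (\<Sum>\<beta>\<in>{1..n}. (of_bool (\<alpha> < \<beta>) - of_bool (\<beta> < \<alpha>)) * f (int i - int \<beta>))"
      unfolding i(1) skew_e_eq[OF i(2,3)] using i
      by (intro arg_cong2[of _ _ _ _ "(+)"] sum.cong refl) (simp_all add: a_def box_def)
    also have "\<dots> = (\<Sum>k\<in>{1..<m}. f (int i + int k - int \<alpha>)) + (\<Sum>k\<in>{1..<n}. f (int i - (int \<alpha> + int k)))"
    proof (intro arg_cong2[of _ _ _ _ "(+)"])
      show "(\<Sum>j\<in>{1..m}. (of_bool (i < j) - of_bool (j < i)) * f (int j - int \<alpha>)) = (\<Sum>k\<in>{1..<m}. f (int i + int k - int \<alpha>))"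
        using fm[of "_ - int \<alpha>"] by (intro antiperiodic_sum[of "\<lambda>x. f (x - int \<alpha>)"] i) (simp add: algebra_simps)
      have "f (int i - (x + int n)) = - f (int i - x)" for x
        using fn[of "int i - (x + int n)"] by (simp add: algebra_simps)
      thus "(\<Sum>\<beta>\<in>{1..n}. (of_bool (\<alpha> < \<beta>) - of_bool (\<beta> < \<alpha>)) * f (int i - int \<beta>)) = (\<Sum>k\<in>{1..<n}. f (int i - (int \<alpha> + int k)))"
        by (intro antiperiodic_sum[of "\<lambda>x. f (int i - x)"] i)
    qed
    \<comment> \<open>Replacing \<open>k\<close> by \<open>n - k\<close> reverses the direction of
      the window, and antiperiodicity supplies the minus sign that cancels the other sum.\<close>
    also have "(\<Sum>k\<in>{1..<n}. f (int i - (int \<alpha> + int k))) = (\<Sum>k\<in>{1..<n}. - f ((int i - int \<alpha>) + int k))"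
    proof (rule sum.reindex_bij_witness[of _ "\<lambda>k. n - k" "\<lambda>k. n - k"])
      fix k assume "k \<in> {1..<n}"
      hence "int i - int \<alpha> + int (n - k) = int i - (int \<alpha> + int k) + int n" by auto
      thus "- f (int i - int \<alpha> + int (n - k)) = f (int i - (int \<alpha> + int k))" by (simp only: fn)
    qed auto
    also have "(\<Sum>k\<in>{1..<m}. f (int i + int k - int \<alpha>)) = (\<Sum>k\<in>{1..<n}. f ((int i - int \<alpha>) + int k))"
      unfolding same[symmetric] by (intro sum.cong refl) (simp add: algebra_simps)
    finally show ?thesis by (simp add: sum_negf)
  qed
  have "skew b a = 0" if "b \<in> Lam" for b
  proof -
    have "b \<in> {b. skew b a = 0}"
      by (rule weight_in_subgroup[OF finite_box]) (use that skew_a in \<open>auto simp: skew_add skew_uminus Lam_def\<close>)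
    thus ?thesis by simp
  qed
  hence "skew a b = 0" if "b \<in> Lam" for b using that by (simp add: skew_def)
  moreover have "a \<in> Lam" by (simp add: Lam_def a_def)
  moreover have "a (1, 1) \<noteq> (0 :: weight) (1, 1)" using mn by (simp add: a_def box_def f_def)
  hence "a \<noteq> 0" by metis
  ultimately show ?thesis by blast
qed

end

section \<open>Transport of primitivity along ring isomorphisms\<close>

text \<open>Restriction of scalars along \<open>h\<close>. The elements of the module keep their
  type, so \<open>left_primitive_idealI\<close> is what brings them to the type that the definition
  demands.\<close>

lemma left_primitive_ring_iso:
  fixes R :: "('a, 'c) ring_scheme" and S :: "('b, 'd) ring_scheme"
  assumes R: "ring R" and h: "h \<in> ring_iso R S" and prim: "left_primitive_ring S"
  shows "left_primitive_ring R"
proof -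
  obtain M :: "('b, 'b set) module" where simple: "simple_left_module S M" and ann: "annihilator S M = {\<zero>\<^bsub>S\<^esub>}"
    using prim unfolding left_primitive_ring_def left_primitive_ideal_def by blast
  interpret M: left_module S M using simple by (simp add: simple_left_module_def)
  interpret R: ring R by (rule R)
  have hom: "h \<in> ring_hom R S" and bij: "bij_betw h (carrier R) (carrier S)"
    using h by (auto simp: ring_iso_def)
  interpret h: ring_hom_ring R S h by (rule ring_hom_ringI2[OF R M.R.ring_axioms hom])
  define N :: "('a, 'b set) module" where
    "N = \<lparr>carrier = carrier M, mult = (\<lambda>x y. x), one = \<zero>\<^bsub>M\<^esub>, zero = \<zero>\<^bsub>M\<^esub>,
          add = add M, smult = (\<lambda>a x. h a \<odot>\<^bsub>M\<^esub> x)\<rparr>"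
  have N: "carrier N = carrier M" "\<zero>\<^bsub>N\<^esub> = \<zero>\<^bsub>M\<^esub>" "x \<oplus>\<^bsub>N\<^esub> y = x \<oplus>\<^bsub>M\<^esub> y" "a \<odot>\<^bsub>N\<^esub> x = h a \<odot>\<^bsub>M\<^esub> x"
    for x y a
    by (simp_all add: N_def)
  have agN: "abelian_group N"
  proof (rule abelian_groupI)
    fix x assume "x \<in> carrier N"
    thus "\<exists>y\<in>carrier N. y \<oplus>\<^bsub>N\<^esub> x = \<zero>\<^bsub>N\<^esub>"
      by (intro bexI[of _ "\<ominus>\<^bsub>M\<^esub> x"]) (simp_all add: N M.M.l_neg)
  qed (simp_all add: N M.M.a_ac)
  interpret N: abelian_group N by (rule agN)
  have lm: "left_module R N"
    by unfold_locales (auto simp: N M.smult_l_distr M.smult_r_distr M.smult_assoc)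
  have sub: "submodule H S M" if H: "submodule H R N" for H
  proof -
    interpret H: submodule H R N by (rule H)
    have "subgroup H (add_monoid M)" using H.subgroup_axioms by (simp add: subgroup_def m_inv_def N)
    moreover have "a \<odot>\<^bsub>M\<^esub> x \<in> H" if "a \<in> carrier S" "x \<in> H" for a x
    proof -
      obtain b where "b \<in> carrier R" "a = h b" using bij \<open>a \<in> carrier S\<close> by (auto simp: bij_betw_def)
      thus ?thesis using H.smult_closed[of b x] \<open>x \<in> H\<close> by (simp add: N)
    qed
    ultimately show ?thesis by (intro submodule.intro submodule_axioms.intro)
  qed
  have "annihilator R N = {\<zero>\<^bsub>R\<^esub>}"
  proof -
    have "r = \<zero>\<^bsub>R\<^esub>" if "r \<in> annihilator R N" for r
    proof -
      have r: "r \<in> carrier R" "h r \<in> annihilator S M" using that by (auto simp: annihilator_def N)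
      hence "h r = h \<zero>\<^bsub>R\<^esub>" using ann by simp
      thus ?thesis using r bij by (auto simp: bij_betw_def inj_on_def)
    qed
    moreover have "\<zero>\<^bsub>R\<^esub> \<in> annihilator R N"
      by (auto simp: annihilator_def N M.smult_l_null)
    ultimately show ?thesis by blast
  qed
  moreover have "simple_left_module R N"
    using simple lm sub by (auto simp: simple_left_module_def N)
  ultimately show ?thesis unfolding left_primitive_ring_def by (intro left_primitive_idealI)
qed

section \<open>The quantum matrix algebra embeds into the quantum torus\<close>

definition word_fun :: "'x list \<Rightarrow> 'x list \<Rightarrow> 'k::field" where
  "word_fun w = (\<lambda>v. if v = w then 1 else 0)"

definition conv :: "('x list \<Rightarrow> 'k::field) \<Rightarrow> ('x list \<Rightarrow> 'k) \<Rightarrow> 'x list \<Rightarrow> 'k" where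
  "conv f g = (\<lambda>w. \<Sum>k\<le>length w. f (take k w) * g (drop k w))"

lemma free_algebra_simps:
  "mult (free_algebra X) = conv" "add (free_algebra X) = (\<lambda>f g w. f w + g w)"
  "\<zero>\<^bsub>free_algebra X\<^esub> = (\<lambda>w. 0)" "\<one>\<^bsub>free_algebra X\<^esub> = word_fun []"
  "carrier (free_algebra X) = {f. finite {w. f w \<noteq> 0} \<and> {w. f w \<noteq> 0} \<subseteq> lists X}"
  by (simp_all add: free_algebra_def word_fun_def conv_def fun_eq_iff)

lemma conv_word_fun: "conv (word_fun u) (word_fun v) = (word_fun (u @ v) :: 'x list \<Rightarrow> 'k::field)"
proof
  fix w :: "'x list"
  have "conv (word_fun u) (word_fun v) w = (\<Sum>k\<le>length w. if k = length u then (if w = u @ v then 1 else 0) else (0 :: 'k))"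
  unfolding conv_def
  proof (intro sum.cong refl)
    fix k assume k: "k \<in> {..length w}"
    show "word_fun u (take k w) * word_fun v (drop k w) = (if k = length u then (if w = u @ v then 1 else 0) else (0 :: 'k))"
    proof (cases "k = length u")
      case True
      hence "w = u @ v \<longleftrightarrow> take k w = u \<and> drop k w = v" by (metis append_eq_conv_conj)
      thus ?thesis using True by (simp add: word_fun_def)
    next
      case False
      hence "take k w \<noteq> u" using k by auto
      thus ?thesis using False by (simp add: word_fun_def)
    qed
  qed
  thus "conv (word_fun u) (word_fun v) w = (word_fun (u @ v) w :: 'k)" by (auto simp: word_fun_def)
qed

lemma conv_linear:
  "conv (\<lambda>w. f w - g w) h = (\<lambda>w. conv f h w - conv g h w)"
  "conv h (\<lambda>w. f w - g w) = (\<lambda>w. conv h f w - conv h g w)"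
  "conv (\<lambda>w. c * f w) h = (\<lambda>w. c * conv f h w)"
  "conv h (\<lambda>w. c * f w) = (\<lambda>w. c * conv h f w)"
  for f g h :: "'x list \<Rightarrow> 'k::field"
  by (auto simp: conv_def fun_eq_iff algebra_simps sum_subtractf sum_distrib_left)

lemma free_scalar_eq: "free_scalar c = (\<lambda>w. c * word_fun [] w)"
  by (auto simp: free_scalar_def word_fun_def)

lemma free_gen_eq: "free_gen x = word_fun [x]"
  by (auto simp: free_gen_def word_fun_def)

lemma word_fun_closed: "w \<in> lists X \<Longrightarrow> (word_fun w :: 'x list \<Rightarrow> 'k::field) \<in> carrier (free_algebra X)"
proof -
  assume "w \<in> lists X"
  moreover have "{v. (word_fun w v :: 'k) \<noteq> 0} = {w}" by (auto simp: word_fun_def)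
  ultimately show ?thesis by (simp add: free_algebra_simps)
qed

lemma free_algebra_minus:
  fixes f g :: "'x list \<Rightarrow> 'k::field"
  assumes "f \<in> carrier (free_algebra X)" "g \<in> carrier (free_algebra X)"
  shows "f \<ominus>\<^bsub>free_algebra X\<^esub> g = (\<lambda>w. f w - g w)"
proof -
  interpret ring "free_algebra X :: ('x list \<Rightarrow> 'k) ring" by (rule ring_free_algebra)
  have "\<ominus>\<^bsub>free_algebra X\<^esub> g = (\<lambda>w. - g w)"
    using assms by (intro minus_equality) (auto simp: free_algebra_simps)
  thus ?thesis by (simp add: a_minus_def free_algebra_simps)
qed

lemma not_sorted_descent:
  "\<not> sorted w \<Longrightarrow> \<exists>u b a v. w = u @ b # a # v \<and> a < b"
proof (induction w rule: induct_list012)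
  case (3 x y zs)
  show ?case
  proof (cases "x \<le> y")
    case True
    hence "\<not> sorted (y # zs)" using 3(3) by (auto dest: order_trans)
    then obtain u b a v where "y # zs = u @ b # a # v" "a < b" using 3(2) by blast
    thus ?thesis by (intro exI[of _ "x # u"]) auto
  next
    case False
    thus ?thesis by (intro exI[of _ "[]"]) auto
  qed
qed auto

lemma sorted_count_list_inj:
  assumes "sorted u" "sorted v" "\<And>x. count_list u x = count_list v x"
  shows "u = v"
proof -
  have "mset u = mset v" using assms(3) by (intro multiset_eqI) (simp add: count_mset)
  thus ?thesis using assms by (metis sort_key_id_if_sorted properties_for_sort sorted_sort_id)
qed

context qtorus
begin

section \<open>Evaluation of the free algebra in the torus\<close>

definition ev :: "((nat \<times> nat) list \<Rightarrow> complex) \<Rightarrow> weight lop" where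
  "ev f = (\<Sum>w | f w \<noteq> 0. f w \<bullet> wd m w)"

lemma ev_superset:
  assumes "finite S" "{w. f w \<noteq> 0} \<subseteq> S"
  shows "ev f = (\<Sum>w\<in>S. f w \<bullet> wd m w)"
  unfolding ev_def using assms by (intro sum.mono_neutral_left) auto

lemma ev_linear:
  assumes "finite {w. f w \<noteq> 0}" "finite {w. g w \<noteq> 0}"
  shows "ev (\<lambda>w. f w + g w) = ev f + ev g" "ev (\<lambda>w. f w - g w) = ev f - ev g" "ev (\<lambda>w. c * f w) = c \<bullet> ev f"
proof -
  let ?S = "{w. f w \<noteq> 0} \<union> {w. g w \<noteq> 0}"
  have S: "finite ?S" using assms by simp
  have "ev f = (\<Sum>w\<in>?S. f w \<bullet> wd m w)" "ev g = (\<Sum>w\<in>?S. g w \<bullet> wd m w)"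
    "ev (\<lambda>w. f w + g w) = (\<Sum>w\<in>?S. (f w + g w) \<bullet> wd m w)"
    "ev (\<lambda>w. f w - g w) = (\<Sum>w\<in>?S. (f w - g w) \<bullet> wd m w)"
    "ev (\<lambda>w. c * f w) = (\<Sum>w\<in>?S. (c * f w) \<bullet> wd m w)"
    by (rule ev_superset[OF S]; auto)+
  thus "ev (\<lambda>w. f w + g w) = ev f + ev g" "ev (\<lambda>w. f w - g w) = ev f - ev g" "ev (\<lambda>w. c * f w) = c \<bullet> ev f"
    by (simp_all add: lop.scale_left_distrib lop.scale_left_diff_distrib sum.distrib sum_subtractf lop.scale_sum_right)
qed

lemma ev_conv:
  assumes f: "finite {w. f w \<noteq> 0}" and g: "finite {w. g w \<noteq> 0}"
  shows "ev (conv f g) = ev f * ev g"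
proof -
  let ?F = "{w. f w \<noteq> 0}" and ?G = "{w. g w \<noteq> 0}"
  define S where "S = (\<lambda>(u, v). u @ v) ` (?F \<times> ?G)"
  define h where "h u v = (f u * g v) \<bullet> (wd m u * wd m v)" for u v
  have S: "finite S" using f g by (simp add: S_def)
  have "{w. conv f g w \<noteq> 0} \<subseteq> S"
  proof
    fix w assume "w \<in> {w. conv f g w \<noteq> 0}"
    then obtain k where "f (take k w) * g (drop k w) \<noteq> 0"
      unfolding conv_def using sum.not_neutral_contains_not_neutral by blast
    thus "w \<in> S" unfolding S_def by (intro image_eqI[of _ _ "(take k w, drop k w)"]) auto
  qed
  moreover have SI: "u @ v \<in> S" if "f u \<noteq> 0" "g v \<noteq> 0" for u v
    unfolding S_def using that by (intro image_eqI[of _ _ "(u, v)"]) auto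
  ultimately have "ev (conv f g) = (\<Sum>w\<in>S. \<Sum>k\<le>length w. (f (take k w) * g (drop k w)) \<bullet> wd m w)"
    using ev_superset[OF S] by (simp add: conv_def lop.scale_sum_left)
  also have "\<dots> = (\<Sum>w\<in>S. \<Sum>k\<le>length w. h (take k w) (drop k w))"
    unfolding h_def by (intro sum.cong refl) (metis append_take_drop_id wd_simps(3))
  also have "\<dots> = (\<Sum>(w, k)\<in>Sigma S (\<lambda>w. {..length w}). h (take k w) (drop k w))"
    using S by (simp add: sum.Sigma)
  also have "\<dots> = (\<Sum>(u, v)\<in>?F \<times> ?G. h u v)"
  \<comment> \<open>A word with a cut point is a pair of words. Cuts whose pieces leave the supports
    contribute 0 and are discarded as \<open>S'\<close>.\<close>
  proof (rule sum.reindex_bij_witness_not_neutral[where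
        S' = "{(w, k) \<in> Sigma S (\<lambda>w. {..length w}). f (take k w) = 0 \<or> g (drop k w) = 0}" and T' = "{}"
        and i = "\<lambda>(u, v). (u @ v, length u)" and j = "\<lambda>(w, k). (take k w, drop k w)"])
    have "finite (Sigma S (\<lambda>w. {..length w}))" using S by (intro finite_SigmaI) auto
    thus "finite {(w, k) \<in> Sigma S (\<lambda>w. {..length w}). f (take k w) = 0 \<or> g (drop k w) = 0}"
      by (rule rev_finite_subset) auto
  qed (auto simp: h_def min_absorb2 intro: SI)
  also have "\<dots> = ev f * ev g"
    by (simp add: ev_def h_def sum_product sum.cartesian_product mult.commute)
  finally show ?thesis .
qed

lemma ev_word_fun: "ev (word_fun w) = wd m w"
proof -
  have "ev (word_fun w) = (\<Sum>v\<in>{w}. word_fun w v \<bullet> wd m v)" by (rule ev_superset) (auto simp: word_fun_def)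
  thus ?thesis by (simp add: word_fun_def)
qed

lemma finite_word_fun: "finite {v. (word_fun w v :: 'k::field) \<noteq> 0}"
  by (rule finite_subset[of _ "{w}"]) (auto simp: word_fun_def)

lemma ev_word_fun_diff: "ev (\<lambda>w. word_fun u w - c * word_fun v w) = wd m u - c \<bullet> wd m v"
proof -
  have "finite {w. c * word_fun v w \<noteq> 0}" by (rule finite_subset[OF _ finite_word_fun[of v]]) auto
  from ev_linear(2)[OF finite_word_fun this, of u] show ?thesis
    using ev_linear(3)[OF finite_word_fun finite_word_fun, of c v] by (simp add: ev_word_fun)
qed

lemma ev_closed:
  assumes "f \<in> carrier (qm_free m n)"
  shows "ev f \<in> Alg m"
  unfolding ev_def
proof (rule lop.subspace_sum[OF Alg_subspace])
  fix w assume "w \<in> {w. f w \<noteq> 0}"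
  hence "w \<in> lists ({1..m} \<times> {1..n})" using assms by (auto simp: free_algebra_simps)
  thus "f w \<bullet> wd m w \<in> Alg m" by (intro Alg_linear wd_Alg)
qed

lemma ev_surj: "ev ` carrier (qm_free m n) = Alg m"
proof
  show "ev ` carrier (qm_free m n) \<subseteq> Alg m" using ev_closed by blast
  show "Alg m \<subseteq> ev ` carrier (qm_free m n)"
  proof
    fix x assume "x \<in> Alg m"
    thus "x \<in> ev ` carrier (qm_free m n)"
      unfolding Alg_def
    proof (induction rule: lop.span_induct_alt)
      case base
      have "(\<lambda>w. 0) \<in> carrier (qm_free m n)" by (simp add: free_algebra_simps)
      moreover have "ev (\<lambda>w. 0) = 0" by (simp add: ev_def)
      ultimately show ?case by (metis imageI)
    next
      case (step c x y)
      then obtain w f where w: "w \<in> lists ({1..m} \<times> {1..n})" "x = wd m w" "f \<in> carrier (qm_free m n)" "y = ev f" by auto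
      let ?g = "\<lambda>v. c * word_fun w v + f v"
      have fin: "finite {v. f v \<noteq> 0}" using w(3) by (simp add: free_algebra_simps)
      have fin': "finite {v. c * word_fun w v \<noteq> 0}" using finite_word_fun[of w] by (rule rev_finite_subset) auto
      have "ev ?g = c \<bullet> x + y"
        using ev_linear(1)[OF fin' fin] ev_linear(3)[OF finite_word_fun finite_word_fun, of c w] by (simp add: ev_word_fun w)
      moreover have "?g \<in> carrier (qm_free m n)"
      proof -
        have sub: "{v. ?g v \<noteq> 0} \<subseteq> insert w {v. f v \<noteq> 0}" by (auto simp: word_fun_def)
        from sub have "finite {v. ?g v \<noteq> 0}" using fin by (rule finite_subset[OF _ finite.insertI])
        moreover have "insert w {v. f v \<noteq> 0} \<subseteq> lists ({1..m} \<times> {1..n})"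
          using w(1,3) by (simp add: free_algebra_simps del: One_nat_def)
        ultimately show ?thesis using sub unfolding free_algebra_simps by blast
      qed
      ultimately show ?case by (intro image_eqI[of _ ev ?g]) (simp_all only:)
    qed
  qed
qed

sublocale ev: ring_hom_ring "qm_free m n" "subring_record (Alg m)" ev
proof (rule ring_hom_ringI)
  show "ring (qm_free m n)" by (rule ring_free_algebra)
  show "ring (subring_record (Alg m))" by (rule ring_subring_record[OF Alg_subring])
qed (auto simp: ev_closed free_algebra_simps ev_conv ev_linear ev_word_fun)

section \<open>The ideal of relations and the kernel of evaluation\<close>

abbreviation J :: "((nat \<times> nat) list \<Rightarrow> complex) set" where
  "J \<equiv> genideal (qm_free m n) (qm_relators q m n)"

lemma relator_forms:
  assumes "a \<in> {1..m} \<times> {1..n}" "b \<in> {1..m} \<times> {1..n}" "c \<in> {1..m} \<times> {1..n}" "d \<in> {1..m} \<times> {1..n}"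
  shows "free_gen b \<otimes>\<^bsub>qm_free m n\<^esub> free_gen a \<ominus>\<^bsub>qm_free m n\<^esub>
        free_scalar s \<otimes>\<^bsub>qm_free m n\<^esub> free_gen a \<otimes>\<^bsub>qm_free m n\<^esub> free_gen b = (\<lambda>w. word_fun [b, a] w - s * word_fun [a, b] w)"
    "free_gen b \<otimes>\<^bsub>qm_free m n\<^esub> free_gen a \<ominus>\<^bsub>qm_free m n\<^esub>
        free_gen a \<otimes>\<^bsub>qm_free m n\<^esub> free_gen b = (\<lambda>w. word_fun [b, a] w - word_fun [a, b] w)"
    "free_gen b \<otimes>\<^bsub>qm_free m n\<^esub> free_gen a \<ominus>\<^bsub>qm_free m n\<^esub>
        (free_gen a \<otimes>\<^bsub>qm_free m n\<^esub> free_gen b \<ominus>\<^bsub>qm_free m n\<^esub>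
          free_scalar s \<otimes>\<^bsub>qm_free m n\<^esub> free_gen c \<otimes>\<^bsub>qm_free m n\<^esub> free_gen d) =
      (\<lambda>w. word_fun [b, a] w - (word_fun [a, b] w - s * word_fun [c, d] w))"
proof -
  have m2: "free_gen x \<otimes>\<^bsub>qm_free m n\<^esub> free_gen y = (word_fun [x, y] :: (nat \<times> nat) list \<Rightarrow> complex)" for x y
    unfolding free_algebra_simps free_gen_eq conv_word_fun by simp
  have m3: "free_scalar s \<otimes>\<^bsub>qm_free m n\<^esub> free_gen x \<otimes>\<^bsub>qm_free m n\<^esub> free_gen y = (\<lambda>w. s * word_fun [x, y] w)" for x y
    unfolding free_algebra_simps free_gen_eq free_scalar_eq conv_linear conv_word_fun by simp
  have c2: "(word_fun [x, y] :: (nat \<times> nat) list \<Rightarrow> complex) \<in> carrier (qm_free m n)"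
    if "x \<in> {1..m} \<times> {1..n}" "y \<in> {1..m} \<times> {1..n}" for x y using that by (intro word_fun_closed) simp
  have c3: "(\<lambda>w. s * word_fun [x, y] w) \<in> carrier (qm_free m n)"
    if "x \<in> {1..m} \<times> {1..n}" "y \<in> {1..m} \<times> {1..n}" for x y
    unfolding m3[symmetric] using that by (intro ev.R.m_closed free_scalar_closed free_gen_closed)
  have c4: "(\<lambda>w. word_fun [a, b] w - s * word_fun [c, d] w) \<in> carrier (qm_free m n)"
    using ev.R.minus_closed[OF c2[OF assms(1,2)] c3[OF assms(3,4)]]
    by (simp only: free_algebra_minus[OF c2[OF assms(1,2)] c3[OF assms(3,4)]])
  show "free_gen b \<otimes>\<^bsub>qm_free m n\<^esub> free_gen a \<ominus>\<^bsub>qm_free m n\<^esub>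
        free_scalar s \<otimes>\<^bsub>qm_free m n\<^esub> free_gen a \<otimes>\<^bsub>qm_free m n\<^esub> free_gen b = (\<lambda>w. word_fun [b, a] w - s * word_fun [a, b] w)"
    unfolding m2 m3 by (rule free_algebra_minus[OF c2[OF assms(2,1)] c3[OF assms(1,2)]])
  show "free_gen b \<otimes>\<^bsub>qm_free m n\<^esub> free_gen a \<ominus>\<^bsub>qm_free m n\<^esub>
        free_gen a \<otimes>\<^bsub>qm_free m n\<^esub> free_gen b = (\<lambda>w. word_fun [b, a] w - word_fun [a, b] w)"
    unfolding m2 by (rule free_algebra_minus[OF c2[OF assms(2,1)] c2[OF assms(1,2)]])
  show "free_gen b \<otimes>\<^bsub>qm_free m n\<^esub> free_gen a \<ominus>\<^bsub>qm_free m n\<^esub>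
        (free_gen a \<otimes>\<^bsub>qm_free m n\<^esub> free_gen b \<ominus>\<^bsub>qm_free m n\<^esub>
          free_scalar s \<otimes>\<^bsub>qm_free m n\<^esub> free_gen c \<otimes>\<^bsub>qm_free m n\<^esub> free_gen d) =
      (\<lambda>w. word_fun [b, a] w - (word_fun [a, b] w - s * word_fun [c, d] w))"
    unfolding m2 m3 free_algebra_minus[OF c2[OF assms(1,2)] c3[OF assms(3,4)]]
    by (rule free_algebra_minus[OF c2[OF assms(2,1)] c4])
qed

lemma relators_in_kernel: "qm_relators q m n \<subseteq> a_kernel (qm_free m n) (subring_record (Alg m)) ev"
proof
  fix r assume r: "r \<in> qm_relators q m n"
  have rel: "qm_relations q m n (pm m)" by (rule pm_relations) simp
  have "ev r = 0"
    using r
  proof cases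
    case (same_row i \<alpha> \<beta>)
    have mem: "(i, \<alpha>) \<in> {1..m} \<times> {1..n}" "(i, \<beta>) \<in> {1..m} \<times> {1..n}" using same_row by auto
    have "r = (\<lambda>w. word_fun [(i, \<beta>), (i, \<alpha>)] w - inverse q * word_fun [(i, \<alpha>), (i, \<beta>)] w)"
      unfolding same_row(1) by (rule relator_forms(1)[OF mem mem])
    moreover have "pm m i \<beta> * pm m i \<alpha> = inverse q \<bullet> (pm m i \<alpha> * pm m i \<beta>)"
      by (rule qm_relationsD(1)[OF rel same_row(2-5)])
    ultimately show ?thesis by (simp add: ev_word_fun_diff)
  next
    case (same_column i j \<alpha>)
    have mem: "(i, \<alpha>) \<in> {1..m} \<times> {1..n}" "(j, \<alpha>) \<in> {1..m} \<times> {1..n}" using same_column by auto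
    have "r = (\<lambda>w. word_fun [(j, \<alpha>), (i, \<alpha>)] w - inverse q * word_fun [(i, \<alpha>), (j, \<alpha>)] w)"
      unfolding same_column(1) by (rule relator_forms(1)[OF mem mem])
    moreover have "pm m j \<alpha> * pm m i \<alpha> = inverse q \<bullet> (pm m i \<alpha> * pm m j \<alpha>)"
      by (rule qm_relationsD(2)[OF rel same_column(2-5)])
    ultimately show ?thesis by (simp add: ev_word_fun_diff)
  next
    case (antidiagonal i j \<alpha> \<beta>)
    have mem: "(i, \<alpha>) \<in> {1..m} \<times> {1..n}" "(j, \<beta>) \<in> {1..m} \<times> {1..n}" using antidiagonal by auto
    have "r = (\<lambda>w. word_fun [(j, \<beta>), (i, \<alpha>)] w - word_fun [(i, \<alpha>), (j, \<beta>)] w)"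
      unfolding antidiagonal(1) by (rule relator_forms(2)[OF mem mem])
    moreover have "pm m j \<beta> * pm m i \<alpha> = pm m i \<alpha> * pm m j \<beta>"
      by (rule qm_relationsD(3)[OF rel antidiagonal(2-7)])
    ultimately show ?thesis using ev_linear(2)[OF finite_word_fun finite_word_fun] by (simp add: ev_word_fun)
  next
    case (diagonal i j \<alpha> \<beta>)
    let ?f = "\<lambda>w. (q - inverse q) * word_fun [(i, \<beta>), (j, \<alpha>)] w"
    have fin: "finite {w. ?f w \<noteq> 0}" by (rule finite_subset[OF _ finite_word_fun]) auto
    have fin': "finite {w. word_fun [(i, \<alpha>), (j, \<beta>)] w - ?f w \<noteq> 0}"
      by (rule finite_subset[OF _ finite_UnI[OF finite_word_fun fin]]) auto
    have "r = (\<lambda>w. word_fun [(j, \<beta>), (i, \<alpha>)] w - (word_fun [(i, \<alpha>), (j, \<beta>)] w - ?f w))"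
      unfolding diagonal(1) by (rule relator_forms(3)) (use diagonal in auto)
    moreover have "pm m j \<beta> * pm m i \<alpha> = pm m i \<alpha> * pm m j \<beta> - (q - inverse q) \<bullet> (pm m i \<beta> * pm m j \<alpha>)"
      by (rule qm_relationsD(4)[OF rel diagonal(2-7)])
    ultimately show ?thesis
      using ev_linear(2)[OF finite_word_fun fin', of "[(j, \<beta>), (i, \<alpha>)]"]
        ev_word_fun_diff[of "[(i, \<alpha>), (j, \<beta>)]" "q - inverse q" "[(i, \<beta>), (j, \<alpha>)]"]
      by (simp add: ev_word_fun)
  qed
  moreover have "r \<in> carrier (qm_free m n)" using r qm_relators_subset by blast
  ultimately show "r \<in> a_kernel (qm_free m n) (subring_record (Alg m)) ev"
    unfolding a_kernel_def' by simp
qed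

lemma J_ideal: "ideal J (qm_free m n)"
  using ev.R.genideal_ideal[OF qm_relators_subset] .

lemma J_subset_kernel: "J \<subseteq> a_kernel (qm_free m n) (subring_record (Alg m)) ev"
  using ev.kernel_is_ideal relators_in_kernel by (rule ev.R.genideal_minimal)

lemma relators_in_J: "qm_relators q m n \<subseteq> J"
  by (rule ev.R.genideal_self[OF qm_relators_subset])

lemma J_closed:
  "(\<lambda>w. 0) \<in> J" "f \<in> J \<Longrightarrow> g \<in> J \<Longrightarrow> (\<lambda>w. f w + g w) \<in> J" "f \<in> J \<Longrightarrow> (\<lambda>w. c * f w) \<in> J"
  "f \<in> J \<Longrightarrow> u \<in> lists ({1..m} \<times> {1..n}) \<Longrightarrow> v \<in> lists ({1..m} \<times> {1..n}) \<Longrightarrow> conv (conv (word_fun u) f) (word_fun v) \<in> J"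
proof -
  interpret J: ideal J "qm_free m n" by (rule J_ideal)
  show "(\<lambda>w. 0) \<in> J" using J.zero_closed by (simp add: free_algebra_simps)
  show "f \<in> J \<Longrightarrow> g \<in> J \<Longrightarrow> (\<lambda>w. f w + g w) \<in> J" using J.a_closed[of f g] by (simp add: free_algebra_simps)
  show "(\<lambda>w. c * f w) \<in> J" if f: "f \<in> J"
  proof -
    have "free_scalar c \<otimes>\<^bsub>qm_free m n\<^esub> f \<in> J" by (rule J.I_l_closed[OF f free_scalar_closed])
    moreover have "conv (word_fun []) f = f"
      using ev.R.l_one[of f] J.a_subset f by (auto simp: free_algebra_simps)
    ultimately show ?thesis by (simp only: free_algebra_simps free_scalar_eq conv_linear)
  qed
  show "conv (conv (word_fun u) f) (word_fun v) \<in> J"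
    if "f \<in> J" "u \<in> lists ({1..m} \<times> {1..n})" "v \<in> lists ({1..m} \<times> {1..n})"
    using J.I_r_closed[OF J.I_l_closed[OF that(1) word_fun_closed[OF that(2)]] word_fun_closed[OF that(3)]]
    by (simp only: free_algebra_simps)
qed

text \<open>A rewriting rule that covers all four relations; only the diagonal one needs the second
  word. The decrease of the first letter, \<open>a < b\<close> and \<open>x < b\<close>, is what
  termination rests on.\<close>

lemma swap_step:
  assumes a: "a \<in> {1..m} \<times> {1..n}" and b: "b \<in> {1..m} \<times> {1..n}" and ab: "a < b"
  shows "\<exists>x y s r. x \<in> {1..m} \<times> {1..n} \<and> y \<in> {1..m} \<times> {1..n} \<and> x < b \<and>
     (\<lambda>w. word_fun [b, a] w - (s * word_fun [a, b] w + r * word_fun [x, y] w)) \<in> J"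
proof -
  obtain i \<alpha> j \<beta> where eq: "a = (i, \<alpha>)" "b = (j, \<beta>)" by (cases a; cases b)
  have mem: "i \<in> {1..m}" "j \<in> {1..m}" "\<alpha> \<in> {1..n}" "\<beta> \<in> {1..n}" using a b eq by auto
  have "i < j \<or> i = j \<and> \<alpha> < \<beta>" using ab eq by auto
  then consider "i = j" "\<alpha> < \<beta>" | "i < j" "\<alpha> = \<beta>" | "i < j" "\<beta> < \<alpha>" | "i < j" "\<alpha> < \<beta>" by linarith
  thus ?thesis
  proof cases
    case 1
    have "(\<lambda>w. word_fun [b, a] w - inverse q * word_fun [a, b] w) \<in> J"
      using subsetD[OF relators_in_J qm_relators.same_row[OF mem(1,3,4) 1(2)]] relator_forms(1)[OF a b a b] 1 eq by (simp del: One_nat_def)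
    thus ?thesis using a b ab by (intro exI[of _ a] exI[of _ b] exI[of _ "inverse q"] exI[of _ 0]) (simp del: One_nat_def)
  next
    case 2
    have "(\<lambda>w. word_fun [b, a] w - inverse q * word_fun [a, b] w) \<in> J"
      using subsetD[OF relators_in_J qm_relators.same_column[OF mem(1,2,3) 2(1)]] relator_forms(1)[OF a b a b] 2 eq by (simp del: One_nat_def)
    thus ?thesis using a b ab by (intro exI[of _ a] exI[of _ b] exI[of _ "inverse q"] exI[of _ 0]) (simp del: One_nat_def)
  next
    case 3
    have "(\<lambda>w. word_fun [b, a] w - word_fun [a, b] w) \<in> J"
      using subsetD[OF relators_in_J qm_relators.antidiagonal[OF mem 3]] relator_forms(2)[OF a b a b] eq by (simp del: One_nat_def)
    thus ?thesis using a b ab by (intro exI[of _ a] exI[of _ b] exI[of _ 1] exI[of _ 0]) (simp del: One_nat_def)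
  next
    case 4
    have xy: "(i, \<beta>) \<in> {1..m} \<times> {1..n}" "(j, \<alpha>) \<in> {1..m} \<times> {1..n}" using mem by auto
    have "(\<lambda>w. word_fun [b, a] w - (word_fun [a, b] w - (q - inverse q) * word_fun [(i, \<beta>), (j, \<alpha>)] w)) \<in> J"
      using subsetD[OF relators_in_J qm_relators.diagonal[OF mem 4]] relator_forms(3)[OF a b xy] eq by (simp del: One_nat_def)
    thus ?thesis using xy ab 4 eq
      by (intro exI[of _ "(i, \<beta>)"] exI[of _ "(j, \<alpha>)"] exI[of _ 1] exI[of _ "- (q - inverse q)"]) (simp add: algebra_simps del: One_nat_def)
  qed
qed

section \<open>Sorted words span the quotient\<close>

definition sorted_words :: "(nat \<times> nat) list set" where
  "sorted_words = {w \<in> lists ({1..m} \<times> {1..n}). sorted w}"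

definition reducible :: "((nat \<times> nat) list \<Rightarrow> complex) \<Rightarrow> bool" where
  "reducible f \<longleftrightarrow> (\<exists>g. finite {w. g w \<noteq> 0} \<and> {w. g w \<noteq> 0} \<subseteq> sorted_words \<and> (\<lambda>w. f w - g w) \<in> J)"

lemma reducible_0: "reducible (\<lambda>w. 0)"
  unfolding reducible_def by (rule exI[of _ "\<lambda>w. 0"]) (simp add: J_closed(1) del: One_nat_def)

lemma reducible_add:
  assumes "reducible f" "reducible f'"
  shows "reducible (\<lambda>w. f w + f' w)"
proof -
  obtain g g' where g: "finite {w. g w \<noteq> 0}" "{w. g w \<noteq> 0} \<subseteq> sorted_words" "(\<lambda>w. f w - g w) \<in> J"
    "finite {w. g' w \<noteq> 0}" "{w. g' w \<noteq> 0} \<subseteq> sorted_words" "(\<lambda>w. f' w - g' w) \<in> J"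
    using assms by (auto simp: reducible_def)
  have sub: "{w. g w + g' w \<noteq> 0} \<subseteq> {w. g w \<noteq> 0} \<union> {w. g' w \<noteq> 0}" by auto
  have "(\<lambda>w. (f w + f' w) - (g w + g' w)) \<in> J"
    using J_closed(2)[OF g(3,6)] by (simp add: algebra_simps del: One_nat_def)
  thus ?thesis unfolding reducible_def
    using g sub by (intro exI[of _ "\<lambda>w. g w + g' w"]) (blast intro: finite_subset)
qed

lemma reducible_scale:
  assumes "reducible f"
  shows "reducible (\<lambda>w. c * f w)"
proof -
  obtain g where g: "finite {w. g w \<noteq> 0}" "{w. g w \<noteq> 0} \<subseteq> sorted_words" "(\<lambda>w. f w - g w) \<in> J"
    using assms by (auto simp: reducible_def)
  have sub: "{w. c * g w \<noteq> 0} \<subseteq> {w. g w \<noteq> 0}" by auto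
  have "(\<lambda>w. c * f w - c * g w) \<in> J"
    using J_closed(3)[OF g(3), of c] by (simp add: algebra_simps del: One_nat_def)
  thus ?thesis unfolding reducible_def
    using g sub by (intro exI[of _ "\<lambda>w. c * g w"]) (blast intro: finite_subset)
qed

lemma reducible_cong:
  assumes "reducible f'" "(\<lambda>w. f w - f' w) \<in> J"
  shows "reducible f"
proof -
  obtain g where g: "finite {w. g w \<noteq> 0}" "{w. g w \<noteq> 0} \<subseteq> sorted_words" "(\<lambda>w. f' w - g w) \<in> J"
    using assms by (auto simp: reducible_def)
  have "(\<lambda>w. f w - g w) \<in> J" using J_closed(2)[OF assms(2) g(3)] by (simp del: One_nat_def)
  thus ?thesis unfolding reducible_def using g by blast
qed

text \<open>Rewriting a descent keeps the length and lowers the letter at the position of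
  \<open>b\<close>, so both new words are smaller in the length-lexicographic order, whatever the
  following letter is.\<close>

lemma reducible_word_fun: "w \<in> lists ({1..m} \<times> {1..n}) \<Longrightarrow> reducible (word_fun w)"
proof (induction w rule: wf_induct_rule[OF wf_lenlex[OF wf]])
  case (1 w)
  show ?case
  proof (cases "sorted w")
    case True
    have "{v. (word_fun w v :: complex) \<noteq> 0} = {w}" by (auto simp: word_fun_def)
    thus ?thesis unfolding reducible_def
      using True 1(2) J_closed(1) by (intro exI[of _ "word_fun w"]) (simp add: sorted_words_def del: One_nat_def)
  next
    case False
    then obtain u b a v where w: "w = u @ b # a # v" "a < b" using not_sorted_descent by blast
    have mem: "u \<in> lists ({1..m} \<times> {1..n})" "v \<in> lists ({1..m} \<times> {1..n})" "a \<in> {1..m} \<times> {1..n}" "b \<in> {1..m} \<times> {1..n}"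
      using 1(2) w(1) by auto
    obtain x y s r where xy: "x \<in> {1..m} \<times> {1..n}" "y \<in> {1..m} \<times> {1..n}" "x < b"
      "(\<lambda>w. word_fun [b, a] w - (s * word_fun [a, b] w + r * word_fun [x, y] w)) \<in> J"
      using swap_step[OF mem(3,4) w(2)] by blast
    have small: "(u @ x' # y' # v, w) \<in> lenlex {(x, y). x < y}" if "x' < b" for x' y'
      unfolding w(1) lenlex_conv using that by (auto intro!: lex_append_leftI simp: Cons_in_lex)
    have "reducible (word_fun (u @ a # b # v))"
      by (rule 1(1)[OF small[OF w(2)]]) (use mem in auto)
    moreover have "reducible (word_fun (u @ x # y # v))"
      by (rule 1(1)[OF small[OF xy(3)]]) (use mem xy in auto)
    ultimately have "reducible (\<lambda>w. s * word_fun (u @ a # b # v) w + r * word_fun (u @ x # y # v) w)"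
      by (intro reducible_add reducible_scale)
    moreover have "(\<lambda>z. word_fun w z - (s * word_fun (u @ a # b # v) z + r * word_fun (u @ x # y # v) z)) \<in> J"
    proof -
      have eq: "(\<lambda>w. word_fun [b, a] w - (s * word_fun [a, b] w + r * word_fun [x, y] w)) = (\<lambda>w. (word_fun [b, a] w - s * word_fun [a, b] w) - r * word_fun [x, y] w)"
        by (simp add: algebra_simps)
      have "conv (conv (word_fun u) (\<lambda>w. (word_fun [b, a] w - s * word_fun [a, b] w) - r * word_fun [x, y] w)) (word_fun v) \<in> J"
        by (rule J_closed(4)[OF xy(4)[unfolded eq] mem(1,2)])
      thus ?thesis unfolding conv_linear conv_word_fun w(1) by (simp add: algebra_simps del: One_nat_def)
    qed
    ultimately show ?thesis by (rule reducible_cong)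
  qed
qed

lemma reducible_all:
  assumes "f \<in> carrier (qm_free m n)"
  shows "reducible f"
proof -
  have fin: "finite {w. f w \<noteq> 0}" and sub: "{w. f w \<noteq> 0} \<subseteq> lists ({1..m} \<times> {1..n})"
    using assms by (auto simp: free_algebra_simps)
  have "reducible (\<lambda>v. \<Sum>w\<in>S. f w * word_fun w v)" if "finite S" "S \<subseteq> lists ({1..m} \<times> {1..n})" for S
    using that
  proof (induction S rule: finite_induct)
    case empty
    show ?case using reducible_0 by simp
  next
    case (insert w S)
    thus ?case using reducible_add[OF reducible_scale[OF reducible_word_fun[of w], of "f w"], of "\<lambda>v. \<Sum>w\<in>S. f w * word_fun w v"]
      by simp
  qed
  from this[OF fin sub] have "reducible (\<lambda>v. \<Sum>w | f w \<noteq> 0. f w * word_fun w v)" .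
  also have "(\<lambda>v. \<Sum>w | f w \<noteq> 0. f w * word_fun w v) = f"
  proof
    fix v
    have "(\<Sum>w | f w \<noteq> 0. f w * word_fun w v) = (\<Sum>w | f w \<noteq> 0. if w = v then f v else 0)"
      by (intro sum.cong refl) (auto simp: word_fun_def)
    thus "(\<Sum>w | f w \<noteq> 0. f w * word_fun w v) = f v" using fin by simp
  qed
  finally show ?thesis .
qed

text \<open>Modulo \<open>J\<close>, a kernel element is a combination of sorted words that still
  evaluates to 0. Their evaluations have distinct leading exponents, so the combination is zero and
  the element lies in \<open>J\<close>.\<close>

lemma J_eq_kernel: "J = a_kernel (qm_free m n) (subring_record (Alg m)) ev"
proof (rule equalityI[OF J_subset_kernel], rule subsetI)
  fix f assume "f \<in> a_kernel (qm_free m n) (subring_record (Alg m)) ev"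
  hence f: "f \<in> carrier (qm_free m n)" "ev f = 0" unfolding a_kernel_def' by simp_all
  then obtain g where g: "finite {w. g w \<noteq> 0}" "{w. g w \<noteq> 0} \<subseteq> sorted_words" "(\<lambda>w. f w - g w) \<in> J"
    using reducible_all[OF f(1)] unfolding reducible_def by blast
  have "ev (\<lambda>w. f w - g w) = 0" using subsetD[OF J_subset_kernel g(3)] unfolding a_kernel_def' by simp
  moreover have "finite {w. f w \<noteq> 0}" using f(1) by (auto simp: free_algebra_simps)
  ultimately have "ev g = 0" using ev_linear(2)[of f g] f(2) g(1) by simp
  hence "\<forall>w\<in>{w. g w \<noteq> 0}. g w = 0"
    unfolding ev_def
  proof (intro lead_independent[OF g(1), where a = "\<lambda>w x. int (count_list w x)"])
    fix w assume "w \<in> {w. g w \<noteq> 0}"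
    thus "lead (wd m w) (\<lambda>x. int (count_list w x))"
      using g(2) by (intro lead_wd) (auto simp: sorted_words_def)
  next
    show "inj_on (\<lambda>w x. int (count_list w x)) {w. g w \<noteq> 0}"
    proof (rule inj_onI)
      fix u v assume "u \<in> {w. g w \<noteq> 0}" "v \<in> {w. g w \<noteq> 0}"
        and eq: "(\<lambda>x. int (count_list u x)) = (\<lambda>x. int (count_list v x))"
      hence "sorted u" "sorted v" using g(2) by (auto simp: sorted_words_def)
      moreover have "count_list u x = count_list v x" for x using fun_cong[OF eq, of x] by simp
      ultimately show "u = v" by (rule sorted_count_list_inj)
    qed
  qed
  hence "g w = 0" for w by blast
  thus "f \<in> J" using g(3) by (simp del: One_nat_def)
qed

lemma left_primitive_quantum_matrices_iff:
  "left_primitive_ring (quantum_matrices q m n) \<longleftrightarrow> left_primitive_ring (subring_record (Alg m))"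
proof -
  have "(\<lambda>X. the_elem (ev ` X)) \<in> ring_iso (quantum_matrices q m n) (subring_record (Alg m))"
    unfolding quantum_matrices_def J_eq_kernel by (rule ev.FactRing_iso_set) (simp add: ev_surj del: One_nat_def)
  thus ?thesis
    using left_primitive_ring_iso ring_iso_set_sym ring_quantum_matrices ring_subring_record[OF Alg_subring]
    by metis
qed

end

theorem theorem1p6:
  fixes q :: complex and m n :: nat
  assumes "q \<noteq> 0" and "\<And>k :: nat. k > 0 \<Longrightarrow> q ^ k \<noteq> 1"
    and "m > 0" and "n > 0"
  shows "left_primitive_ring (quantum_matrices q m n) \<longleftrightarrow>
         multiplicity (2::nat) m \<noteq> multiplicity (2::nat) n"
proof -
  interpret qtorus q m n using assms(1,2) by unfold_locales
  show ?thesis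
  proof (cases "multiplicity (2::nat) m = multiplicity 2 n")
    case True
    obtain a where "a \<in> Lam" "a \<noteq> 0" "\<And>b. b \<in> Lam \<Longrightarrow> skew a b = 0"
      using radical_exists[OF assms(3,4) True] by blast
    thus ?thesis
      using not_left_primitive_if_radical True left_primitive_quantum_matrices_iff by blast
  next
    case False
    hence "left_primitive_ring (subring_record (Alg m))"
      by (intro left_primitive_if_no_radical assms no_radical) auto
    thus ?thesis using False left_primitive_quantum_matrices_iff by blast
  qed
qed

end
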